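(* Let $\alpha>3$ and $c_1=c_1(\alpha):=\frac23e^{-\sqrt2\,\frac{\alpha-1}{\alpha-3}}$. Let $\kappa\in(0,1]$, $\overline W>0$ and $m\ge0$ satisfy $$\kappa\le\frac1{16\,c_1\log2},\qquad \overline W\ge\frac1{2c_1}\,\frac1\kappa\,\log_2\frac{36}\kappa,\qquad m\le c_1\kappa\overline W .$$ Let $N\in\mathbb N$, $\Lambda_N=\{0,1\}^N$, and consider the hierarchical model on $\Lambda_N$ with weights $W^H_{ij}=w^H(d_H(i,j))$ for $i\ne j$ in $\Lambda_N$, and uniform pinning $W_{i\rho}=h^H>0$ for all $i\in\Lambda_N$, where $w^H:[1,\infty)\to(0,\infty)$ and $h^H$ fulfil $$w^H(r)\ge8\,\overline W\,2^{-2r}r^\alpha\ \text{ for all }r\in\mathbb N,\qquad h^H\ge2\,\overline W\,2^{-N}(N+1)^\alpha .$$ Then for all $i\in\Lambda_N$, $$\mathbb E^{\Lambda_N}_{W^H,h^H}\big[(\cosh u_i)^m\big]\le1+\kappa .$$ The displayed conditions on $(\kappa,\overline W,m)$ are satisfied in particular for the following choices. (i) For $s\in(0,1)$: $\kappa=\overline W^{-s}$ and any $m\in[0,c_1\overline W^{1-s}]$, provided $\overline W$ is large enough, depending on $\alpha$ and $s$. (ii) For a constant $c_2>1/(2c_1\log2)$: $\kappa=c_2\frac{\log\overline W}{\overline W}$ and any $m\in[0,c_1c_2\log\overline W]$, provided $\overline W$ is large enough, depending on $\alpha$ and $c_2$.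
   Context: Hierarchical distance. For $i=(i_0,\dots,i_{N-1})$ and $j=(j_0,\dots,j_{N-1})$ in $\{0,1\}^N$, $d_H(i,j)=\min(\{l\in\{0,\ldots,N-1\}: i_k=j_k\text{ for all }k\ge l\}\cup\{N\})$. Model. Let $\Lambda$ be a finite non-empty set, $\rho\notin\Lambda$ (the pinning vertex), and let $E$ be the set of all two-element subsets of $\Lambda\cup\{\rho\}$. Let $W_e\ge0$, $e\in E$, be weights ($W_{ij}:=W_{\{i,j\}}$); the weights $h_i:=W_{i\rho}$, $i\in\Lambda$, are the pinning strengths. Let $E_+=\{e\in E:W_e>0\}$ and assume $(\Lambda\cup\{\rho\},E_+)$ is connected. For $(u,s)\in\mathbb R^\Lambda\times\mathbb R^\Lambda$ set $u_\rho=s_\rho=0$ and, for $i,j\in\Lambda\cup\{\rho\}$, $$B_{ij}=\cosh(u_i-u_j)+\tfrac12(s_i-s_j)^2e^{u_i+u_j}.$$ Let $D=(D_{ij})_{i,j\in\Lambda}$ with $D_{ij}=-W_{ij}e^{u_i+u_j}$ for $i\ne j$ and $D_{ii}=\sum_{k\in(\Lambda\cup\{\rho\})\setminus\{i\}}W_{ik}e^{u_i+u_k}$. Then $$\mu^\Lambda_{W,h}(du\,ds)=e^{-\sum_{e\in E_+}W_e(B_e-1)}\det D\prod_{i\in\Lambda}\frac{e^{-u_i}}{2\pi}\,du_i\,ds_i$$ is a probability measure on $\mathbb R^\Lambda\times\mathbb R^\Lambda$ (known fact); $\mathbb E^\Lambda_{W,h}$ denotes expectation with respect to it, where $W$ denotes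 the weights between vertices of $\Lambda$ and $h=(h_i)_{i\in\Lambda}$. *)

theory Defs
  imports "HOL-Analysis.Analysis"
begin

text \<open>
  The vertex set \<open>\<Lambda> \<union> {\<rho>}\<close> lives in \<open>'a option\<close>: the pinning vertex \<open>\<rho>\<close> is \<open>None\<close>, and
  \<open>i \<in> \<Lambda>\<close> is \<open>Some i\<close>. Edges are two-element sets of vertices.
\<close>

definition vertices :: "'a set \<Rightarrow> 'a option set" where
  "vertices \<Lambda> = insert None (Some ` \<Lambda>)"

definition edges :: "'a set \<Rightarrow> 'a option set set" where
  "edges \<Lambda> = {e. e \<subseteq> vertices \<Lambda> \<and> card e = 2}"

text \<open>The value \<open>f\<^sub>e := f i j\<close> on an edge \<open>e = {i, j}\<close>; only meaningful for symmetric \<open>f\<close>.\<close>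

definition on_edge :: "('b \<Rightarrow> 'b \<Rightarrow> real) \<Rightarrow> 'b set \<Rightarrow> real" where
  "on_edge f e = (THE x. \<exists>i j. e = {i, j} \<and> x = f i j)"

lemma on_edge_doubleton:
  assumes "f i j = f j i"
  shows "on_edge f {i, j} = f i j"
  unfolding on_edge_def using assms by (intro the_equality) (auto simp: doubleton_eq_iff)

text \<open>Combines \<open>W\<close> (weights inside \<open>\<Lambda>\<close>) and \<open>h\<close> (pinning strengths) into weights on \<open>\<Lambda> \<union> {\<rho>}\<close>.
  The diagonal values are never used.\<close>

fun full_weight :: "('a \<Rightarrow> 'a \<Rightarrow> real) \<Rightarrow> ('a \<Rightarrow> real) \<Rightarrow> 'a option \<Rightarrow> 'a option \<Rightarrow> real" where
  "full_weight W h (Some i) (Some j) = W i j"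
| "full_weight W h (Some i) None = h i"
| "full_weight W h None (Some j) = h j"
| "full_weight W h None None = 0"

definition pos_edges :: "'a set \<Rightarrow> ('a \<Rightarrow> 'a \<Rightarrow> real) \<Rightarrow> ('a \<Rightarrow> real) \<Rightarrow> 'a option set set" where
  "pos_edges \<Lambda> W h = {e \<in> edges \<Lambda>. on_edge (full_weight W h) e > 0}"

text \<open>The convention \<open>u\<^sub>\<rho> = s\<^sub>\<rho> = 0\<close>.\<close>

definition pin :: "('a \<Rightarrow> real) \<Rightarrow> 'a option \<Rightarrow> real" where
  "pin u x = (case x of None \<Rightarrow> 0 | Some i \<Rightarrow> u i)"

definition Bfun :: "('a \<Rightarrow> real) \<Rightarrow> ('a \<Rightarrow> real) \<Rightarrow> 'a option \<Rightarrow> 'a option \<Rightarrow> real" where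
  "Bfun u s i j = cosh (pin u i - pin u j)
     + 1 / 2 * (pin s i - pin s j)\<^sup>2 * exp (pin u i + pin u j)"

lemma full_weight_sym: "(\<And>i j. W i j = W j i) \<Longrightarrow> full_weight W h x y = full_weight W h y x"
  by (cases x; cases y) simp_all

lemma Bfun_sym: "Bfun u s x y = Bfun u s y x"
proof -
  have "cosh (pin u x - pin u y) = cosh (pin u y - pin u x)"
    by (metis cosh_minus minus_diff_eq)
  then show ?thesis
    by (simp add: Bfun_def power2_commute add.commute)
qed

definition Dmat :: "'a set \<Rightarrow> ('a \<Rightarrow> 'a \<Rightarrow> real) \<Rightarrow> ('a \<Rightarrow> real) \<Rightarrow> ('a \<Rightarrow> real) \<Rightarrow> 'a \<Rightarrow> 'a \<Rightarrow> real" where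
  "Dmat \<Lambda> W h u i j =
     (if i = j
      then \<Sum>k\<in>vertices \<Lambda> - {Some i}. full_weight W h (Some i) k * exp (u i + pin u k)
      else - W i j * exp (u i + u j))"

text \<open>Leibniz formula; unlike \<^const>\<open>det\<close>, the index set is an arbitrary finite set, not a type.\<close>

definition det_on :: "'a set \<Rightarrow> ('a \<Rightarrow> 'a \<Rightarrow> real) \<Rightarrow> real" where
  "det_on \<Lambda> A = (\<Sum>p | p permutes \<Lambda>. of_int (sign p) * (\<Prod>i\<in>\<Lambda>. A i (p i)))"

text \<open>The factor \<open>det D\<close> is nonnegative for nonnegative weights (\<open>D\<close> is a weighted Laplacian with
  pinning), so \<^const>\<open>ennreal\<close> truncates nothing. \<open>\<real>\<^sup>\<Lambda>\<close> is the product space of extensional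
  functions on \<open>\<Lambda>\<close>.\<close>

definition mu :: "'a set \<Rightarrow> ('a \<Rightarrow> 'a \<Rightarrow> real) \<Rightarrow> ('a \<Rightarrow> real)
    \<Rightarrow> (('a \<Rightarrow> real) \<times> ('a \<Rightarrow> real)) measure" where
  "mu \<Lambda> W h = density ((\<Pi>\<^sub>M i\<in>\<Lambda>. lborel) \<Otimes>\<^sub>M (\<Pi>\<^sub>M i\<in>\<Lambda>. lborel))
     (\<lambda>(u, s). ennreal (
        exp (- (\<Sum>e\<in>pos_edges \<Lambda> W h.
                  on_edge (full_weight W h) e * (on_edge (Bfun u s) e - 1)))
        * det_on \<Lambda> (Dmat \<Lambda> W h u)
        * (\<Prod>i\<in>\<Lambda>. exp (- u i) / (2 * pi))))"

definition Lambda_N :: "nat \<Rightarrow> nat list set" where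
  "Lambda_N N = {i. set i \<subseteq> {0, 1} \<and> length i = N}"

definition d_H :: "nat \<Rightarrow> nat list \<Rightarrow> nat list \<Rightarrow> nat" where
  "d_H N i j = Min ({l \<in> {..<N}. \<forall>k. l \<le> k \<and> k < N \<longrightarrow> i ! k = j ! k} \<union> {N})"

definition W_H :: "nat \<Rightarrow> (real \<Rightarrow> real) \<Rightarrow> nat list \<Rightarrow> nat list \<Rightarrow> real" where
  "W_H N w i j = w (real (d_H N i j))"

lemma W_H_sym: "W_H N w i j = W_H N w j i"
  by (simp add: W_H_def d_H_def eq_commute)

definition c1 :: "real \<Rightarrow> real" where
  "c1 \<alpha> = 2 / 3 * exp (- sqrt 2 * ((\<alpha> - 1) / (\<alpha> - 3)))"

definition admissible :: "real \<Rightarrow> real \<Rightarrow> real \<Rightarrow> real \<Rightarrow> bool" where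
  "admissible \<alpha> \<kappa> Wbar m \<longleftrightarrow>
     0 < \<kappa> \<and> \<kappa> \<le> 1 \<and> Wbar > 0 \<and> m \<ge> 0 \<and>
     \<kappa> \<le> 1 / (16 * c1 \<alpha> * ln 2) \<and>
     Wbar \<ge> 1 / (2 * c1 \<alpha>) * (1 / \<kappa>) * log 2 (36 / \<kappa>) \<and>
     m \<le> c1 \<alpha> * \<kappa> * Wbar"

end

theory Submission
  imports Defs "HOL-Probability.Distributions" "HOL-Real_Asymp.Real_Asymp"
begin

text \<open>
  Integrating out \<open>s\<close> leaves the density \<open>exp (- energy) * sqrt (det D) * (\<Prod>i. exp (- u i) / sqrt (2 * pi))\<close>.
  For fixed values of the other coordinates, substitute \<open>t = 2 \<beta>\<^sub>x = (\<Sum>k. W\<^sub>x\<^sub>k exp u\<^sub>k) / exp u\<^sub>x\<close>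
  for \<open>u\<^sub>x\<close>. The density then factors into an explicit probability density in \<open>t\<close>, depending only on the
  total weight at \<open>x\<close>, and the density of the model on the remaining vertices with weights
  \<open>W\<^sub>y\<^sub>z + W\<^sub>y\<^sub>x W\<^sub>x\<^sub>z / t\<close>. This has three consequences.

  First, the measure has mass one for all weights. Comparing the weights \<open>W\<close> and \<open>W - m\<close> turns
  this into an exponential moment bound for \<open>cosh (u\<^sub>x - u\<^sub>y) - 1\<close> summed over any set of edges,
  because lowering one weight \<open>W\<^sub>e\<close> by \<open>m\<^sub>e\<close> decreases \<open>det D\<close> at most by the factor \<open>1 - m\<^sub>e / W\<^sub>e\<close>.

  Second, two vertices with the same weights to all others may be merged into a single vertex with
  doubled weights without changing the law of the other coordinates: after eliminating both, the
  others only see one scalar, whose law does not depend on the weight between the two.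

  Third, merging the siblings of all balls containing a given vertex reduces the hierarchical model
  to one containing a path from that vertex to \<open>\<rho>\<close>, with weights at least \<open>Wbar * r powr \<alpha>\<close>.
  On the path, Cauchy-Schwarz and \<open>1 + x\<^sup>2 / 2 \<le> cosh x \<le> exp (x\<^sup>2 / 2)\<close> bound \<open>cosh u powr m\<close> by an
  exponential of the energies of its edges.
\<close>

section \<open>Determinants over finite index sets\<close>

text \<open>The obstacle is \<open>det D\<close>: it couples all coordinates, so passing to a
  subgraph changes the law, and a single edge at distance \<open>r\<close> may have weight of order
  \<open>2 powr (-2 * r)\<close> up to powers of \<open>r\<close>, too little for a path argument.
  Merging repairs both. Along the path the merged siblings have multiplicities 1, 1, 2, 4, ..., and
  the product of two consecutive ones, at least \<open>2 powr (2 * r - 1)\<close>, compensates the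
  decay; the factors 8 and 2 in the hypotheses on \<open>w\<close> and \<open>h\<close> absorb the
  remaining powers of two. Cauchy-Schwarz with weights \<open>q r\<close> bounds
  \<open>(u i)^2\<close> by \<open>Q\<close> times the sum of \<open>x^2 / q r\<close>, where
  \<open>x\<close> is the increment over edge \<open>r\<close> and \<open>Q\<close> bounds the sum
  of the \<open>q r\<close>. An edge of weight at least \<open>Wbar / (q r)^2\<close> then loses at
  most the fraction \<open>m * Q * q r / Wbar\<close>, in total at most
  \<open>Q^2 * m / Wbar\<close>. So \<open>q\<close> has to be summable with
  \<open>1 / (q r)^2\<close> at most \<open>(r + 1) powr \<alpha>\<close>. The bound
  \<open>1 + \<kappa>\<close> follows once the total is at most \<open>2 / 3 * \<kappa>\<close>,
  which \<open>m \<le> c1 \<alpha> * \<kappa> * Wbar\<close> reduces to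
  \<open>Q^2 * c1 \<alpha> \<le> 2 / 3\<close>.\<close>

lemma det_on_row_linear:
  assumes "finite V" "k \<in> V"
  shows "det_on V (\<lambda>i j. if i = k then A k j + c * B j else A i j)
       = det_on V A + c * det_on V (\<lambda>i j. if i = k then B j else A i j)"
proof -
  have split: "(\<Prod>i\<in>V. G i) = G k * (\<Prod>i\<in>V-{k}. G i)" for G :: "'a \<Rightarrow> real"
    using assms by (simp add: prod.remove)
  show ?thesis
    unfolding det_on_def sum_distrib_left sum.distrib [symmetric]
  proof (intro sum.cong refl)
    fix p
    have [simp]: "(\<Prod>i\<in>V-{k}. if i = k then X i else A i (p i)) = (\<Prod>i\<in>V-{k}. A i (p i))" for X
      by (intro prod.cong) auto
    show "of_int (sign p) * (\<Prod>i\<in>V. if i = k then A k (p i) + c * B (p i) else A i (p i)) =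
      of_int (sign p) * (\<Prod>i\<in>V. A i (p i))
      + c * (of_int (sign p) * (\<Prod>i\<in>V. if i = k then B (p i) else A i (p i)))"
      by (simp add: split algebra_simps)
  qed
qed

lemma det_on_identical_rows:
  assumes "finite V" "k \<in> V" "l \<in> V" "k \<noteq> l" "A k = A l"
  shows "det_on V A = 0"
proof -
  let ?t = "Transposition.transpose k l"
  have t: "?t permutes V" using assms by (simp add: permutes_swap_id)
  have inv: "p \<circ> ?t \<circ> ?t = p" for p :: "'a \<Rightarrow> 'a" by (simp add: o_assoc [symmetric])
  have "det_on V A = (\<Sum>p | p permutes V. of_int (sign (p \<circ> ?t)) * (\<Prod>i\<in>V. A i ((p \<circ> ?t) i)))"
    unfolding det_on_def
    by (rule sum.reindex_bij_witness [of _ "\<lambda>p. p \<circ> ?t" "\<lambda>p. p \<circ> ?t"])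
       (auto simp: inv intro: permutes_compose [OF t])
  also have "\<dots> = (\<Sum>p | p permutes V. - (of_int (sign p) * (\<Prod>i\<in>V. A i (p i))))"
  proof (intro sum.cong refl)
    fix p assume "p \<in> {p. p permutes V}"
    then have p: "p permutes V" by simp
    have "sign (p \<circ> ?t) = - sign p"
      using sign_compose [of p ?t] p assms permutation_permutes permutation_swap_id sign_swap_id
      by (metis mult_minus1_right)
    moreover have "(\<Prod>i\<in>V. A i ((p \<circ> ?t) i)) = (\<Prod>i\<in>V. A i (p i))"
    proof -
      have "(\<Prod>i\<in>V. A i (p i)) = (\<Prod>i\<in>V. A (?t i) (p (?t i)))"
        by (rule prod.permute [OF t, unfolded o_def])
      also have "\<dots> = (\<Prod>i\<in>V. A i ((p \<circ> ?t) i))"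
        by (intro prod.cong refl) (use assms(5) in \<open>auto simp: Transposition.transpose_def\<close>)
      finally show ?thesis by simp
    qed
    ultimately show "of_int (sign (p \<circ> ?t)) * (\<Prod>i\<in>V. A i ((p \<circ> ?t) i))
      = - (of_int (sign p) * (\<Prod>i\<in>V. A i (p i)))" by simp
  qed
  also have "\<dots> = - det_on V A" by (simp add: det_on_def sum_negf)
  finally show ?thesis by simp
qed

lemma det_on_cong:
  assumes "\<And>i j. i \<in> V \<Longrightarrow> j \<in> V \<Longrightarrow> A i j = B i j"
  shows "det_on V A = det_on V B"
  unfolding det_on_def using assms
  by (intro sum.cong prod.cong refl arg_cong2 [where f="(*)"]) (auto dest: permutes_in_image)

lemma det_on_row_ops:
  assumes "finite V" "x \<in> V" "finite T" "T \<subseteq> V - {x}"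
  shows "det_on V (\<lambda>i j. if i \<in> T then A i j - l i * A x j else A i j) = det_on V A"
  using assms(3,4)
proof (induction T)
  case (insert k T)
  let ?B = "\<lambda>i j. if i \<in> T then A i j - l i * A x j else A i j"
  have "det_on V (\<lambda>i j. if i \<in> insert k T then A i j - l i * A x j else A i j)
      = det_on V (\<lambda>i j. if i = k then ?B k j + (- l k) * A x j else ?B i j)"
    using insert by (intro det_on_cong) auto
  also have "\<dots> = det_on V ?B + (- l k) * det_on V (\<lambda>i j. if i = k then A x j else ?B i j)"
    using assms insert by (intro det_on_row_linear) auto
  also have "det_on V (\<lambda>i j. if i = k then A x j else ?B i j) = 0"
    using assms insert by (intro det_on_identical_rows [of V k x]) (auto simp: fun_eq_iff)
  finally show ?case using insert by simp
qed simp

lemma det_on_zero_column: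
  assumes "finite V" "x \<notin> V" "\<And>i. i \<in> V \<Longrightarrow> A i x = 0"
  shows "det_on (insert x V) A = A x x * det_on V A"
proof -
  have "det_on (insert x V) A
      = (\<Sum>p | p permutes V. of_int (sign p) * (\<Prod>i\<in>insert x V. A i (p i)))"
    unfolding det_on_def
  proof (rule sum.mono_neutral_right)
    show "finite {p. p permutes insert x V}" using assms by (simp add: finite_permutations)
    show "{p. p permutes V} \<subseteq> {p. p permutes insert x V}"
      using permutes_subset by blast
    show "\<forall>p\<in>{p. p permutes insert x V} - {p. p permutes V}.
      of_int (sign p) * (\<Prod>i\<in>insert x V. A i (p i)) = 0"
    proof
      fix p assume p: "p \<in> {p. p permutes insert x V} - {p. p permutes V}"
      then have "p x \<noteq> x"
        using permutes_superset [of p "insert x V" V] by auto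
      moreover obtain i where i: "i \<in> insert x V" "p i = x"
        using p by (metis DiffD1 insertI1 mem_Collect_eq permutes_def permutes_in_image)
      ultimately have "i \<in> V" by auto
      then have "(\<Prod>i\<in>insert x V. A i (p i)) = 0"
        using assms i by (intro prod_zero) auto
      then show "of_int (sign p) * (\<Prod>i\<in>insert x V. A i (p i)) = 0" by simp
    qed
  qed
  also have "\<dots> = (\<Sum>p | p permutes V. A x x * (of_int (sign p) * (\<Prod>i\<in>V. A i (p i))))"
    using assms by (intro sum.cong refl) (auto simp: permutes_def)
  finally show ?thesis by (simp add: det_on_def sum_distrib_left)
qed

text \<open>Row operations clear column \<open>x\<close> outside the pivot, and what is left on
  \<open>V\<close> is the Schur complement. Later determinants are peeled off by this step, one
  vertex at a time.\<close>

lemma det_on_schur: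
  assumes "finite V" "x \<notin> V" "A x x \<noteq> 0"
  shows "det_on (insert x V) A = A x x * det_on V (\<lambda>i j. A i j - A i x * A x j / A x x)"
proof -
  let ?B = "\<lambda>i j. if i \<in> V then A i j - (A i x / A x x) * A x j else A i j"
  have "det_on (insert x V) A = det_on (insert x V) ?B"
    using assms by (intro det_on_row_ops [symmetric]) auto
  also have "\<dots> = ?B x x * det_on V ?B"
    using assms by (intro det_on_zero_column) auto
  also have "det_on V ?B = det_on V (\<lambda>i j. A i j - A i x * A x j / A x x)"
    by (intro det_on_cong) auto
  finally show ?thesis using assms by simp
qed

section \<open>One-dimensional integrals\<close>

text \<open>Exhaustion by compact intervals and monotone convergence. The range of \<open>g\<close>
  enters as an indicator because below it is sometimes the whole line and sometimes a
  half-line.\<close>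

lemma nn_integral_substitution_range:
  fixes f :: "real \<Rightarrow> ennreal" and g g' :: "real \<Rightarrow> real"
  assumes f [measurable]: "f \<in> borel_measurable borel"
    and deriv: "\<And>x. (g has_real_derivative g' x) (at x)"
    and cont: "continuous_on UNIV g'" and pos: "\<And>x. g' x \<ge> 0"
  shows "(\<integral>\<^sup>+x. f x * indicator (range g) x \<partial>lborel) = (\<integral>\<^sup>+x. f (g x) * ennreal (g' x) \<partial>lborel)"
proof -
  have mono: "g x \<le> g y" if "x \<le> y" for x y
    using DERIV_nonneg_imp_nondecreasing [OF that] deriv pos by blast
  have contg: "continuous_on A g" for A
    using deriv by (meson DERIV_isCont continuous_at_imp_continuous_on)
  have [measurable]: "g \<in> borel_measurable borel" "g' \<in> borel_measurable borel"
    using contg cont by (auto intro: borel_measurable_continuous_onI)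
  \<comment> \<open>\<open>Suc n\<close> instead of \<open>n\<close> keeps every interval
    nondegenerate.\<close>
  have *: "(\<integral>\<^sup>+x. f x * indicator {g (- real (Suc n))..g (real (Suc n))} x \<partial>lborel)
      = (\<integral>\<^sup>+x. f (g x) * g' x * indicator {- real (Suc n)..real (Suc n)} x \<partial>lborel)" for n
    by (rule nn_integral_substitution_aux)
       (auto intro: deriv pos continuous_on_subset [OF cont])
  have "(\<integral>\<^sup>+x. f x * indicator (range g) x \<partial>lborel)
      = (\<integral>\<^sup>+x. (SUP n. f x * indicator {g (- real (Suc n))..g (real (Suc n))} x) \<partial>lborel)"
  proof (intro nn_integral_cong)
    fix x
    have "(SUP n. indicator {g (- real (Suc n))..g (real (Suc n))} x :: ennreal) = indicator (range g) x"
    proof (cases "x \<in> range g")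
      case True
      then obtain y where y: "x = g y" by auto
      obtain n where "\<bar>y\<bar> \<le> real n" using real_arch_simple by blast
      then have "x \<in> {g (- real (Suc n))..g (real (Suc n))}"
        unfolding y by (auto intro!: mono)
      then have "1 \<le> (SUP n. indicator {g (- real (Suc n))..g (real (Suc n))} x :: ennreal)"
        by (intro SUP_upper2 [of n]) auto
      moreover have "(SUP n. indicator {g (- real (Suc n))..g (real (Suc n))} x :: ennreal) \<le> 1"
        by (intro SUP_least) (auto simp: indicator_def)
      ultimately show ?thesis using True by auto
    next
      case False
      have "x \<notin> {g (- real (Suc n))..g (real (Suc n))}" for n
        using IVT' [of g "- real (Suc n)" x "real (Suc n)"] False contg by auto
      then have "(indicator {g (- real (Suc n))..g (real (Suc n))} x :: ennreal) = 0" for n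
        by (meson indicator_simps(2))
      then show ?thesis using False by simp
    qed
    then show "f x * indicator (range g) x
      = (SUP n. f x * indicator {g (- real (Suc n))..g (real (Suc n))} x)"
      by (simp only: SUP_mult_left_ennreal [symmetric])
  qed
  also have "\<dots> = (SUP n. \<integral>\<^sup>+x. f x * indicator {g (- real (Suc n))..g (real (Suc n))} x \<partial>lborel)"
  proof (intro nn_integral_monotone_convergence_SUP)
    show "incseq (\<lambda>n x. f x * indicator {g (- real (Suc n))..g (real (Suc n))} x)"
    proof (intro incseq_SucI le_funI mult_left_mono)
      fix n x
      have "g (- real (Suc (Suc n))) \<le> g (- real (Suc n))" "g (real (Suc n)) \<le> g (real (Suc (Suc n)))"
        by (auto intro!: mono)
      then show "(indicator {g (- real (Suc n))..g (real (Suc n))} x :: ennreal)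
          \<le> indicator {g (- real (Suc (Suc n)))..g (real (Suc (Suc n)))} x"
        by (auto simp del: of_nat_Suc split: split_indicator)
    qed auto
  qed measurable
  also have "\<dots> = (SUP n. \<integral>\<^sup>+x. f (g x) * g' x * indicator {- real (Suc n)..real (Suc n)} x \<partial>lborel)"
    by (simp only: *)
  also have "\<dots> = (\<integral>\<^sup>+x. (SUP n. f (g x) * g' x * indicator {- real (Suc n)..real (Suc n)} x) \<partial>lborel)"
  proof (intro nn_integral_monotone_convergence_SUP [symmetric])
    show "incseq (\<lambda>n x. f (g x) * g' x * indicator {- real (Suc n)..real (Suc n)} x)"
      by (intro incseq_SucI le_funI mult_left_mono) (auto split: split_indicator)
  qed measurable
  also have "\<dots> = (\<integral>\<^sup>+x. f (g x) * ennreal (g' x) \<partial>lborel)"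
  proof (intro nn_integral_cong)
    fix x
    obtain n where n: "\<bar>x\<bar> \<le> real n" using real_arch_simple by blast
    show "(SUP n. f (g x) * g' x * indicator {- real (Suc n)..real (Suc n)} x) = f (g x) * ennreal (g' x)"
    proof (rule antisym)
      show "f (g x) * ennreal (g' x) \<le> (SUP n. f (g x) * g' x * indicator {- real (Suc n)..real (Suc n)} x)"
        using n by (intro SUP_upper2 [of n]) (auto simp: indicator_def)
    qed (auto intro!: SUP_least simp: indicator_def)
  qed
  finally show ?thesis .
qed

lemma nn_integral_gaussian:
  fixes \<sigma> \<mu> :: real assumes "\<sigma> > 0"
  shows "(\<integral>\<^sup>+x. ennreal (exp (- (x - \<mu>)\<^sup>2 / (2 * \<sigma>\<^sup>2))) \<partial>lborel) = ennreal (sqrt (2 * pi * \<sigma>\<^sup>2))"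
proof -
  have "(\<integral>\<^sup>+x. ennreal (exp (- (x - \<mu>)\<^sup>2 / (2 * \<sigma>\<^sup>2))) \<partial>lborel)
     = (\<integral>\<^sup>+x. ennreal (sqrt (2 * pi * \<sigma>\<^sup>2)) * ennreal (normal_density \<mu> \<sigma> x) \<partial>lborel)"
    using assms by (subst ennreal_mult' [symmetric]) (simp_all add: normal_density_def)
  also have "\<dots> = ennreal (sqrt (2 * pi * \<sigma>\<^sup>2)) * (\<integral>\<^sup>+x. ennreal (normal_density \<mu> \<sigma> x) \<partial>lborel)"
    by (intro nn_integral_cmult) auto
  also have "(\<integral>\<^sup>+x. ennreal (normal_density \<mu> \<sigma> x) \<partial>lborel) = 1"
    using assms by (subst nn_integral_eq_integral) simp_all
  finally show ?thesis by simp
qed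

text \<open>
  The density of \<open>a = ln t\<close>, where \<open>t = 2 \<beta>\<^sub>x\<close> and \<open>S\<close> is the total weight at \<open>x\<close>;
  in terms of \<open>t\<close> it is \<open>exp (- (t - S)\<^sup>2 / (2 * t)) / sqrt (2 * pi * t)\<close>. The logarithmic coordinate
  makes every integral below range over all of \<open>\<real>\<close>.
\<close>

definition ig_log :: "real \<Rightarrow> real \<Rightarrow> real" where
  "ig_log S a = exp (a / 2 - (exp a + S\<^sup>2 * exp (- a)) / 2 + S) / sqrt (2 * pi)"

lemma ig_log_pos: "ig_log S a > 0" by (simp add: ig_log_def)

lemma ig_log_measurable [measurable]: "(\<lambda>x. ig_log (f x) (g x)) \<in> borel_measurable M"
  if [measurable]: "f \<in> borel_measurable M" "g \<in> borel_measurable M"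
  unfolding ig_log_def by measurable

text \<open>Centred at \<open>ln S\<close>, the exponent is \<open>- (g y)^2 / 2\<close> with
  \<open>g\<close> odd, and the only asymmetric factor is \<open>exp (y / 2)\<close>. Adding the
  integrals over \<open>y\<close> and \<open>- y\<close> replaces it by
  \<open>2 * cosh (y / 2)\<close>, which is proportional to the derivative of \<open>g\<close>; a
  standard Gaussian integral in \<open>g y\<close> remains.\<close>

lemma nn_integral_ig_log:
  assumes "S > 0"
  shows "(\<integral>\<^sup>+a. ennreal (ig_log S a) \<partial>lborel) = 1"
proof -
  define g where "g y = 2 * sqrt S * sinh (y / 2)" for y
  define g' where "g' y = sqrt S * cosh (y / 2)" for y
  define I where "I = (\<integral>\<^sup>+a. ennreal (ig_log S a) \<partial>lborel)"
  define \<phi> where "\<phi> y = sqrt S * exp (y / 2) * (exp (- (g y)\<^sup>2 / 2) / sqrt (2 * pi))" for y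
  have [measurable]: "g \<in> borel_measurable borel" "g' \<in> borel_measurable borel"
    unfolding g_def g'_def by (intro borel_measurable_continuous_onI continuous_intros; simp)+
  have [measurable]: "\<phi> \<in> borel_measurable borel" unfolding \<phi>_def by measurable
  have phi: "ig_log S (ln S + y) = \<phi> y" for y
  proof -
    have "(g y)\<^sup>2 = S * (exp (y/2) - exp (-(y/2)))\<^sup>2"
      using assms by (simp add: g_def sinh_def power_mult_distrib power2_eq_square)
    also have "\<dots> = S * (exp y + exp (- y) - 2)"
    proof -
      have "exp y = exp (y/2) * exp (y/2)" "exp (-y) = exp (-(y/2)) * exp (-(y/2))"
        "exp (y/2) * exp (-(y/2)) = 1"
        by (simp_all flip: exp_add)
      then show ?thesis by (simp add: power2_eq_square algebra_simps)
    qed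
    finally have g2: "(g y)\<^sup>2 = S * (exp y + exp (- y) - 2)" .
    have e1: "exp (ln S / 2) = sqrt S" using assms by (simp add: ln_sqrt [symmetric])
    have e2: "exp (ln S + y) + S\<^sup>2 * exp (- (ln S + y)) = S * (exp y + exp (- y))"
    proof -
      have "exp (- (ln S + y)) = exp (- y) / S"
        unfolding exp_minus exp_add using assms by (simp add: field_simps)
      then show ?thesis using assms by (simp add: exp_add power2_eq_square algebra_simps)
    qed
    have e3: "(ln S + y) / 2 - (S * (exp y + exp (- y))) / 2 + S
       = ln S / 2 + y / 2 + - (g y)\<^sup>2 / 2"
      unfolding g2 by (simp add: field_simps)
    have "ig_log S (ln S + y) = exp (ln S / 2 + y / 2 + - (g y)\<^sup>2 / 2) / sqrt (2 * pi)"
      unfolding ig_log_def e2 e3 ..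
    then show ?thesis unfolding exp_add e1 by (simp add: \<phi>_def)
  qed
  have I1: "I = (\<integral>\<^sup>+y. ennreal (\<phi> y) \<partial>lborel)"
    unfolding I_def phi [symmetric]
    by (subst nn_integral_real_affine [where c=1 and t="ln S"]) auto
  have I2: "I = (\<integral>\<^sup>+y. ennreal (\<phi> (- y)) \<partial>lborel)"
    unfolding I1 by (subst nn_integral_real_affine [where c="-1" and t=0]) auto
  have "I + I = (\<integral>\<^sup>+y. ennreal (\<phi> y) + ennreal (\<phi> (- y)) \<partial>lborel)"
    unfolding nn_integral_add [of "\<lambda>y. ennreal (\<phi> y)" lborel "\<lambda>y. ennreal (\<phi> (- y))", simplified]
    using I1 I2 by simp
  also have "\<dots> = (\<integral>\<^sup>+y. ennreal (2 * exp (- (g y - 0)\<^sup>2 / (2 * 1\<^sup>2)) / sqrt (2 * pi)) * ennreal (g' y) \<partial>lborel)"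
  proof (intro nn_integral_cong)
    fix y
    have "g (- y) = - g y" by (simp add: g_def)
    then have "\<phi> y + \<phi> (- y) = 2 * exp (- (g y)\<^sup>2 / 2) / sqrt (2 * pi) * g' y"
      by (simp add: \<phi>_def g'_def cosh_def field_simps)
    moreover have "\<phi> y \<ge> 0" "\<phi> (- y) \<ge> 0" "g' y \<ge> 0"
      using assms by (auto simp: \<phi>_def g'_def intro!: mult_nonneg_nonneg cosh_real_nonneg)
    ultimately show "ennreal (\<phi> y) + ennreal (\<phi> (- y))
        = ennreal (2 * exp (- (g y - 0)\<^sup>2 / (2 * 1\<^sup>2)) / sqrt (2 * pi)) * ennreal (g' y)"
      by (simp add: ennreal_plus [symmetric] ennreal_mult' [symmetric] del: ennreal_plus)
  qed
  also have "\<dots> = (\<integral>\<^sup>+x. ennreal (2 * exp (- (x - 0)\<^sup>2 / (2 * 1\<^sup>2)) / sqrt (2 * pi)) * indicator (range g) x \<partial>lborel)"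
  proof (rule nn_integral_substitution_range [symmetric])
    show "(g has_real_derivative g' x) (at x)" for x
      unfolding g_def g'_def by (auto intro!: derivative_eq_intros)
    show "continuous_on UNIV g'"
      unfolding g'_def by (intro continuous_intros) simp_all
    show "g' x \<ge> 0" for x using assms by (auto simp: g'_def intro!: mult_nonneg_nonneg cosh_real_nonneg)
  qed measurable
  also have "range g = UNIV"
  proof -
    have "g (2 * arsinh (z / (2 * sqrt S))) = z" for z
      using assms by (simp add: g_def)
    then show ?thesis by (rule surjI)
  qed
  also have "(\<integral>\<^sup>+x. ennreal (2 * exp (- (x - 0)\<^sup>2 / (2 * 1\<^sup>2)) / sqrt (2 * pi)) * indicator UNIV x \<partial>lborel)
     = (\<integral>\<^sup>+x. ennreal (2 / sqrt (2 * pi)) * ennreal (exp (- (x - 0)\<^sup>2 / (2 * 1\<^sup>2))) \<partial>lborel)"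
    by (intro nn_integral_cong) (simp add: ennreal_mult' [symmetric])
  also have "\<dots> = ennreal (2 / sqrt (2 * pi)) * ennreal (sqrt (2 * pi * 1\<^sup>2))"
    by (subst nn_integral_cmult) (use nn_integral_gaussian [of 1 0] in auto)
  also have "\<dots> = ennreal 2" by (simp add: ennreal_mult' [symmetric])
  finally have "2 * I = 2 * 1" by (simp add: mult_2)
  then show ?thesis
    unfolding I_def [symmetric] by (subst (asm) ennreal_mult_cancel_left) auto
qed

text \<open>
  The factors \<open>exp (a/2)\<close>, \<open>exp (b/2)\<close> and the exponents are rewritten in the coordinates
  \<open>(a, z)\<close>, where \<open>exp z = 4 / G\<close> is the rate seen by the other vertices. With
  \<open>q = 4 * exp a - exp z\<close> and \<open>k = exp z + 4 * v\<close> the dependence on \<open>a\<close> is Gaussian in \<open>(q - k) / sqrt q\<close>.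
\<close>

lemma ig_log_mult_eq:
  fixes a b v s :: real
  assumes "v > 0"
  defines "c \<equiv> exp a" and "t \<equiv> exp b"
  defines "G \<equiv> exp (- a) + (1 + v * exp (- a))\<^sup>2 * exp (- b)"
  defines "z \<equiv> ln 4 - ln G"
  defines "q \<equiv> 4 * c - exp z"
  shows "ig_log (v + s) a * ig_log (s * (1 + v * exp (- a))) b
    = 4 * (c + v) * c / (q * sqrt q) * exp (z / 2)
        * exp (- exp z / 2 - (q - (exp z + 4 * v))\<^sup>2 / (8 * q)) / (2 * pi)
      * (((1 + v * exp (- a))\<^sup>2 * exp (- b)) / G)
      * exp (- (s\<^sup>2 * G) / 2 + 2 * s)"
proof -
  \<comment> \<open>\<open>M\<close> is the common term in all quantities:
    \<open>G = M / (c^2 * t)\<close>, \<open>exp z = 4 * c^2 * t / M\<close> and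
    \<open>q = 4 * c * (c + v)^2 / M\<close>. The roots \<open>ca\<close> and \<open>tb\<close> of
    \<open>c\<close> and \<open>t\<close> take care of the half powers.\<close>
  define M where "M = c * t + (c + v)\<^sup>2"
  define ca tb where "ca = exp (a / 2)" and "tb = exp (b / 2)"
  have [simp]: "c > 0" "t > 0" "ca > 0" "tb > 0" by (auto simp: c_def t_def ca_def tb_def)
  have [simp]: "c \<noteq> 0" "t \<noteq> 0" by (auto simp: c_def t_def)
  have cca: "c = ca * ca" "t = tb * tb" by (auto simp: c_def t_def ca_def tb_def simp flip: exp_add)
  have cv: "c + v > 0" using assms(1) by (simp add: add_pos_pos)
  define w where "w = c + v"
  have [simp]: "w \<noteq> 0" using cv by (simp add: w_def)
  have M: "M > 0" unfolding M_def using cv by (intro add_pos_pos) auto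
  have inv: "exp (- a) = 1 / c" "exp (- b) = 1 / t" by (auto simp: c_def t_def exp_minus inverse_eq_divide)
  have G: "G = M / (c\<^sup>2 * t)"
    unfolding G_def inv M_def using assms(1) \<open>c > 0\<close> \<open>t > 0\<close>
    by (simp add: divide_simps power2_eq_square)
  have Gpos: "G > 0" unfolding G using M by simp
  have tau: "exp z = 4 * c\<^sup>2 * t / M"
    unfolding z_def exp_diff using Gpos by (simp add: G)
  have q: "q = 4 * c * (c + v)\<^sup>2 / M"
    unfolding q_def tau using M by (simp add: field_simps) (simp add: M_def power2_eq_square algebra_simps)
  have qpos: "q > 0" unfolding q using M cv by simp
  have sq: "sqrt q = 2 * ca * (c + v) / sqrt M"
    unfolding q using cv by (simp add: real_sqrt_divide real_sqrt_mult cca(1) abs_of_pos)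
  have "exp (z / 2) = sqrt (exp z)"
    by (rule real_sqrt_unique [symmetric]) (simp_all add: power2_eq_square flip: exp_add)
  then have ez: "exp (z / 2) = 2 * c * tb / sqrt M"
    unfolding tau using \<open>c > 0\<close> by (simp add: real_sqrt_divide real_sqrt_mult cca(2) abs_of_pos)
  have g': "((1 + v * exp (- a))\<^sup>2 * exp (- b)) / G = (c + v)\<^sup>2 / M"
    unfolding G inv using M by (simp add: divide_simps power2_eq_square)
  have pre: "4 * (c + v) * c / (q * sqrt q) * exp (z / 2) * ((c + v)\<^sup>2 / M) = ca * tb"
  proof -
    have "4 * (c + v) * c / (q * sqrt q) * exp (z / 2) * ((c + v)\<^sup>2 / M)
      = (4 * (c + v) * c / q) * (exp (z / 2) / sqrt q) * ((c + v)\<^sup>2 / M)" by simp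
    also have "4 * (c + v) * c / q = M / (c + v)"
      unfolding q w_def [symmetric] using M by (simp add: field_simps power2_eq_square)
    also have "exp (z / 2) / sqrt q = c * tb / (ca * (c + v))"
      unfolding ez sq using M by simp
    also have "M / (c + v) * (c * tb / (ca * (c + v))) * ((c + v)\<^sup>2 / M) = c * tb / ca"
      unfolding w_def [symmetric] using M by (simp add: field_simps power2_eq_square)
    finally show ?thesis by (simp add: cca)
  qed
  have ex: "- exp z / 2 - (q - (exp z + 4 * v))\<^sup>2 / (8 * q) = - (c + t + v\<^sup>2 / c - 2 * v) / 2"
  proof -
    have "q + exp z = 4 * c" by (simp add: q_def)
    \<comment> \<open>With \<open>k = exp z + 4 * v\<close> one has
      \<open>q + k = 4 * (c + v)\<close>, and the square of \<open>q - k\<close> is that of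
      \<open>q + k\<close> minus \<open>4 * q * k\<close>.\<close>
    then have "(q - (exp z + 4 * v))\<^sup>2 = 16 * (c + v)\<^sup>2 - 4 * q * (exp z + 4 * v)"
      by (algebra)
    then have "(q - (exp z + 4 * v))\<^sup>2 / (8 * q) = 2 * (c + v)\<^sup>2 / q - (exp z + 4 * v) / 2"
      using qpos by (simp add: field_simps)
    also have "2 * (c + v)\<^sup>2 / q = M / (2 * c)"
      unfolding q w_def [symmetric] using M by (simp add: field_simps power2_eq_square)
    also have "\<dots> = (t + c + 2 * v + v\<^sup>2 / c) / 2"
      unfolding M_def by (simp add: field_simps power2_eq_square)
    finally show ?thesis by (simp add: field_simps)
  qed
  have "ig_log (v + s) a * ig_log (s * (1 + v * exp (- a))) b
     = exp (a / 2 - (c + (v + s)\<^sup>2 * (1 / c)) / 2 + (v + s)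
         + (b / 2 - (t + (s * (1 + v * (1 / c)))\<^sup>2 * (1 / t)) / 2 + s * (1 + v * (1 / c)))) / (2 * pi)"
    unfolding ig_log_def exp_add [symmetric] inv c_def [symmetric] t_def [symmetric]
    by (simp flip: exp_add)
  also have "a / 2 - (c + (v + s)\<^sup>2 * (1 / c)) / 2 + (v + s)
         + (b / 2 - (t + (s * (1 + v * (1 / c)))\<^sup>2 * (1 / t)) / 2 + s * (1 + v * (1 / c)))
      = (a / 2 + b / 2) + - (c + t + v\<^sup>2 / c - 2 * v) / 2 + (- (s\<^sup>2 * G) / 2 + 2 * s)"
    unfolding G_def inv by (simp add: field_simps power2_eq_square)
  also have "exp \<dots> = ca * tb * exp (- (c + t + v\<^sup>2 / c - 2 * v) / 2) * exp (- (s\<^sup>2 * G) / 2 + 2 * s)"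
    unfolding exp_add ca_def tb_def by simp
  also have "ca * tb = 4 * (c + v) * c / (q * sqrt q) * exp (z / 2) * ((c + v)\<^sup>2 / M)"
    by (rule pre [symmetric])
  finally show ?thesis unfolding ex g' by (simp only: times_divide_eq_right times_divide_eq_left mult_ac)
qed

text \<open>This is where \<open>v\<close> disappears. Take first \<open>\<theta> = ln q\<close>,
  then \<open>y = (q - k) / sqrt q\<close>, whose derivative in \<open>\<theta>\<close> is
  \<open>(q + k) / (2 * sqrt q)\<close>. Since \<open>exp a + v = (q + k) / 4\<close>, the integrand
  already contains this Jacobian, and what remains is a centred Gaussian of variance 4, whatever the
  value of \<open>k\<close>.\<close>

lemma nn_integral_ig_pair_inner:
  fixes z v :: real
  assumes "v > 0"
  shows "(\<integral>\<^sup>+a. ennreal (4 * (exp a + v) * exp a / ((4 * exp a - exp z) * sqrt (4 * exp a - exp z)) * exp (z / 2)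
        * exp (- exp z / 2 - (4 * exp a - exp z - (exp z + 4 * v))\<^sup>2 / (8 * (4 * exp a - exp z))) / (2 * pi))
      * indicator {a. exp z < 4 * exp a} a \<partial>lborel)
    = ennreal (exp (z / 2 - exp z / 2) / sqrt (2 * pi))"
    (is "(\<integral>\<^sup>+a. ennreal (?f a) * indicator _ a \<partial>lborel) = _")
proof -
  define k where "k = exp z + 4 * v"
  have k: "k > 0" using assms by (simp add: k_def add_pos_pos)
  define \<alpha> where "\<alpha> \<theta> = ln ((exp \<theta> + exp z) / 4)" for \<theta>
  define \<alpha>' where "\<alpha>' \<theta> = exp \<theta> / (exp \<theta> + exp z)" for \<theta>
  define y where "y \<theta> = exp (\<theta> / 2) - k * exp (- \<theta> / 2)" for \<theta>
  define y' where "y' \<theta> = (exp (\<theta> / 2) + k * exp (- \<theta> / 2)) / 2" for \<theta>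
  have ea: "exp (\<alpha> \<theta>) = (exp \<theta> + exp z) / 4" for \<theta>
    unfolding \<alpha>_def by (simp add: add_pos_pos)
  have range_\<alpha>: "range \<alpha> = {a. exp z < 4 * exp a}"
  proof (intro equalityI subsetI)
    fix a assume "a \<in> {a. exp z < 4 * exp a}"
    then have "\<alpha> (ln (4 * exp a - exp z)) = a" by (simp add: \<alpha>_def)
    then show "a \<in> range \<alpha>" by (metis rangeI)
  qed (auto simp: ea)
  have range_y: "range y = UNIV"
  proof (rule surjI)
    fix w
    \<comment> \<open>The positive root of \<open>r * r - w * r - k = 0\<close>; it exists for every
      \<open>w\<close> because \<open>k > 0\<close>.\<close>
    define r where "r = (w + sqrt (w\<^sup>2 + 4 * k)) / 2"
    have "sqrt (w\<^sup>2 + 4 * k) > \<bar>w\<bar>"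
      using k by (intro real_less_rsqrt) auto
    then have r: "r > 0" unfolding r_def by (simp add: abs_less_iff)
    have "r * r - k = w * r"
    proof -
      have "(sqrt (w\<^sup>2 + 4 * k))\<^sup>2 = w\<^sup>2 + 4 * k" using k by simp
      then show ?thesis unfolding r_def by (simp add: field_simps power2_eq_square)
    qed
    then have "r - k / r = w" using r by (simp add: field_simps)
    moreover have "exp (- (2 * ln r) / 2) = 1 / r"
      using r by (simp add: exp_minus inverse_eq_divide)
    ultimately show "y (2 * ln r) = w"
      using r by (simp add: y_def)
  qed
  have "(\<integral>\<^sup>+a. ennreal (?f a) * indicator {a. exp z < 4 * exp a} a \<partial>lborel)
      = (\<integral>\<^sup>+\<theta>. ennreal (?f (\<alpha> \<theta>)) * ennreal (\<alpha>' \<theta>) \<partial>lborel)"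
    unfolding range_\<alpha> [symmetric]
  proof (rule nn_integral_substitution_range)
    show "(\<alpha> has_real_derivative \<alpha>' x) (at x)" for x
      using add_pos_pos [OF exp_gt_zero exp_gt_zero, of x z]
      unfolding \<alpha>_def \<alpha>'_def by (auto intro!: derivative_eq_intros simp: divide_simps)
    show "continuous_on UNIV \<alpha>'"
      unfolding \<alpha>'_def by (intro continuous_intros) (metis add_pos_pos exp_gt_zero less_irrefl)
    show "\<alpha>' x \<ge> 0" for x unfolding \<alpha>'_def by simp
  qed measurable
  also have "\<dots> = (\<integral>\<^sup>+\<theta>. ennreal (exp (z / 2 - exp z / 2) / (4 * pi) * exp (- (y \<theta> - 0)\<^sup>2 / (2 * 2\<^sup>2))) * ennreal (y' \<theta>) \<partial>lborel)"
  proof (intro nn_integral_cong)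
    fix \<theta>
    define q c where "q = exp \<theta>" and "c = (q + exp z) / 4"
    have q: "q > 0" by (simp add: q_def)
    have c: "c > 0" unfolding c_def using q by (simp add: add_pos_pos)
    have eq: "4 * exp (\<alpha> \<theta>) - exp z = q" "exp (\<alpha> \<theta>) = c" "\<alpha>' \<theta> = q / (4 * c)"
      unfolding ea q_def c_def \<alpha>'_def using add_pos_pos [OF exp_gt_zero exp_gt_zero, of \<theta> z]
      by (simp_all add: divide_simps)
    have e2: "exp (\<theta> / 2) = sqrt q"
      by (rule real_sqrt_unique [symmetric]) (simp_all add: power2_eq_square q_def flip: exp_add)
    have e3: "exp (- \<theta> / 2) = 1 / sqrt q"
      using e2 by (simp add: exp_minus inverse_eq_divide)
    have yy: "(y \<theta>)\<^sup>2 = (q - k)\<^sup>2 / q"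
    proof -
      have "y \<theta> = (q - k) / sqrt q"
        unfolding y_def e2 e3 using q by (simp add: field_simps)
      then show ?thesis using q by (simp add: power_divide)
    qed
    have cv: "c + v = (q + k) / 4" by (simp add: c_def k_def)
    have c4: "4 * c - exp z = q" by (simp add: c_def field_simps)
    have "?f (\<alpha> \<theta>) = 4 * (c + v) * c / (q * sqrt q) * exp (z / 2)
       * exp (- exp z / 2 - (q - k)\<^sup>2 / (8 * q)) / (2 * pi)"
      unfolding eq(2) c4 k_def ..
    moreover have "4 * w * c / (q * sq) * e * X / (2 * pi) * (q / (4 * c)) = w / sq * e * X / (2 * pi)"
      for w sq e X :: real
      using c q by (simp add: field_simps)
    ultimately have "?f (\<alpha> \<theta>) * \<alpha>' \<theta> = (c + v) / sqrt q * exp (z / 2)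
       * exp (- exp z / 2 - (q - k)\<^sup>2 / (8 * q)) / (2 * pi)"
      by (simp only: eq(3))
    also have "\<dots> = exp (z / 2 - exp z / 2) / (4 * pi) * exp (- (y \<theta> - 0)\<^sup>2 / (2 * 2\<^sup>2)) * y' \<theta>"
    proof -
      have "y' \<theta> = (q + k) / (2 * sqrt q)"
        unfolding y'_def e2 e3 using q by (simp add: field_simps)
      moreover have "exp (z / 2) * exp (- exp z / 2 - (q - k)\<^sup>2 / (8 * q))
         = exp (z / 2 - exp z / 2) * exp (- (y \<theta> - 0)\<^sup>2 / (2 * 2\<^sup>2))"
        unfolding exp_add [symmetric] using q by (simp add: yy algebra_simps)
      ultimately show ?thesis unfolding cv by (simp add: field_simps)
    qed
    finally have "?f (\<alpha> \<theta>) * \<alpha>' \<theta>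
      = exp (z / 2 - exp z / 2) / (4 * pi) * exp (- (y \<theta> - 0)\<^sup>2 / (2 * 2\<^sup>2)) * y' \<theta>" .
    moreover have "\<alpha>' \<theta> \<ge> 0" "y' \<theta> \<ge> 0" using k by (simp_all add: \<alpha>'_def y'_def)
    ultimately show "ennreal (?f (\<alpha> \<theta>)) * ennreal (\<alpha>' \<theta>)
      = ennreal (exp (z / 2 - exp z / 2) / (4 * pi) * exp (- (y \<theta> - 0)\<^sup>2 / (2 * 2\<^sup>2))) * ennreal (y' \<theta>)"
      by (simp only: ennreal_mult'' [symmetric])
  qed
  also have "\<dots> = (\<integral>\<^sup>+x. ennreal (exp (z / 2 - exp z / 2) / (4 * pi) * exp (- (x - 0)\<^sup>2 / (2 * 2\<^sup>2)))
      * indicator (range y) x \<partial>lborel)"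
  proof (rule nn_integral_substitution_range [symmetric])
    show "(y has_real_derivative y' x) (at x)" for x
      unfolding y_def y'_def by (auto intro!: derivative_eq_intros simp: field_simps)
    show "continuous_on UNIV y'"
      unfolding y'_def by (intro continuous_intros) simp_all
    show "y' x \<ge> 0" for x using k by (simp add: y'_def)
  qed measurable
  also have "\<dots> = (\<integral>\<^sup>+x. ennreal (exp (z / 2 - exp z / 2) / (4 * pi)) * ennreal (exp (- (x - 0)\<^sup>2 / (2 * 2\<^sup>2))) \<partial>lborel)"
    unfolding range_y by (intro nn_integral_cong) (subst ennreal_mult' [symmetric], simp_all)
  also have "\<dots> = ennreal (exp (z / 2 - exp z / 2) / (4 * pi)) * ennreal (sqrt (2 * pi * 2\<^sup>2))"
    by (subst nn_integral_cmult) (use nn_integral_gaussian [of 2 0] in auto)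
  also have "\<dots> = ennreal (exp (z / 2 - exp z / 2) / sqrt (2 * pi))"
  proof (subst ennreal_mult' [symmetric])
    have "sqrt (2 * pi * 2\<^sup>2) = 2 * sqrt (2 * pi)" by (subst real_sqrt_mult) simp
    moreover have "sqrt (2 * pi) * sqrt (2 * pi) = 2 * pi" by simp
    ultimately have "exp (z / 2 - exp z / 2) / (4 * pi) * sqrt (2 * pi * 2\<^sup>2) = exp (z / 2 - exp z / 2) / sqrt (2 * pi)"
      by (simp add: divide_simps)
    then show "ennreal (exp (z / 2 - exp z / 2) / (4 * pi) * sqrt (2 * pi * 2\<^sup>2)) = ennreal (exp (z / 2 - exp z / 2) / sqrt (2 * pi))"
      by simp
  qed simp
  finally show ?thesis .
qed

text \<open>Here \<open>a\<close> and \<open>b\<close> are the logarithmic rates of two vertices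
  eliminated in turn, \<open>v\<close> is the weight between them, and the argument of
  \<open>\<Psi>\<close> is the scalar \<open>G\<close> through which the others see the pair. On the
  right is the same for one vertex with doubled weights, which yields \<open>4 * exp (- z)\<close>.
  At fixed \<open>a\<close> the variable \<open>b\<close> is replaced by
  \<open>z = ln 4 - ln G\<close>; the parameter \<open>s\<close> then occurs only in a factor
  depending on \<open>z\<close>, so after exchanging the integrals the one over \<open>a\<close> can
  be evaluated and is free of \<open>v\<close>.\<close>

lemma nn_integral_ig_pair:
  fixes v s :: real and \<Psi> :: "real \<Rightarrow> ennreal"
  assumes "v > 0" and [measurable]: "\<Psi> \<in> borel_measurable borel"
  shows "(\<integral>\<^sup>+a. ennreal (ig_log (v + s) a) * (\<integral>\<^sup>+b. ennreal (ig_log (s * (1 + v * exp (- a))) b)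
            * \<Psi> (exp (- a) + (1 + v * exp (- a))\<^sup>2 * exp (- b)) \<partial>lborel) \<partial>lborel)
       = (\<integral>\<^sup>+z. ennreal (ig_log (2 * s) z) * \<Psi> (4 * exp (- z)) \<partial>lborel)"
proof -
  define G where "G a b = exp (- a) + (1 + v * exp (- a))\<^sup>2 * exp (- b)" for a b
  define g where "g a b = ln 4 - ln (G a b)" for a b
  define g' where "g' a b = (1 + v * exp (- a))\<^sup>2 * exp (- b) / G a b" for a b
  define H where "H z = ennreal (exp (- (s\<^sup>2 * (4 * exp (- z))) / 2 + 2 * s)) * \<Psi> (4 * exp (- z))" for z
  define \<phi> where "\<phi> a z = 4 * (exp a + v) * exp a / ((4 * exp a - exp z) * sqrt (4 * exp a - exp z)) * exp (z / 2)
        * exp (- exp z / 2 - (4 * exp a - exp z - (exp z + 4 * v))\<^sup>2 / (8 * (4 * exp a - exp z))) / (2 * pi)" for a z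
  have [measurable]: "H \<in> borel_measurable borel" unfolding H_def by measurable
  have Gpos: "G a b > 0" for a b unfolding G_def by (intro add_pos_nonneg) auto
  have Gne: "G a b \<noteq> 0" for a b using Gpos [of a b] by simp
  have va: "1 + v * exp (- a) > 0" for a using assms(1) by (intro add_pos_nonneg) auto
  \<comment> \<open>\<open>G\<close> exceeds \<open>exp (- a)\<close>, so
    \<open>exp z = 4 / G\<close> stays below \<open>4 * exp a\<close>. This half-line is the region
    \<open>q > 0\<close> of the inner integral.\<close>
  have range_g: "range (g a) = {z. exp z < 4 * exp a}" for a
  proof (intro equalityI subsetI)
    fix z assume "z \<in> range (g a)"
    then obtain b where z: "z = g a b" by auto
    have "exp z = 4 / G a b" unfolding z g_def exp_diff using Gpos by simp
    also have "\<dots> < 4 / exp (- a)"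
      using va [of a] Gpos unfolding G_def by (intro divide_strict_left_mono) (auto intro: mult_pos_pos add_pos_pos)
    finally show "z \<in> {z. exp z < 4 * exp a}" by (simp add: exp_minus divide_inverse)
  next
    fix z assume z: "z \<in> {z. exp z < 4 * exp a}"
    define w where "w = (4 * exp (- z) - exp (- a)) / (1 + v * exp (- a))\<^sup>2"
    have "exp (- a) < 4 * exp (- z)" using z by (simp add: exp_minus field_simps)
    then have w: "w > 0" unfolding w_def using va [of a] by simp
    then have "G a (- ln w) = 4 * exp (- z)"
      unfolding G_def w_def using va [of a] by simp
    then have "g a (- ln w) = z"
      unfolding g_def by (simp add: ln_mult)
    then show "z \<in> range (g a)" by (metis rangeI)
  qed
  have Gg: "4 * exp (- g a b) = G a b" for a b
    unfolding g_def using Gpos by (simp add: exp_diff)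
  have step: "(\<integral>\<^sup>+b. ennreal (ig_log (s * (1 + v * exp (- a))) b) * \<Psi> (G a b) \<partial>lborel) * ennreal (ig_log (v + s) a)
     = (\<integral>\<^sup>+z. ennreal (\<phi> a z) * indicator {z. exp z < 4 * exp a} z * H z \<partial>lborel)" for a
  proof -
    have "(\<integral>\<^sup>+b. ennreal (ig_log (s * (1 + v * exp (- a))) b) * \<Psi> (G a b) \<partial>lborel) * ennreal (ig_log (v + s) a)
      = (\<integral>\<^sup>+b. ennreal (ig_log (s * (1 + v * exp (- a))) b) * \<Psi> (G a b) * ennreal (ig_log (v + s) a) \<partial>lborel)"
      unfolding G_def by (rule nn_integral_multc [symmetric]) measurable
    also have "\<dots> = (\<integral>\<^sup>+b. (ennreal (\<phi> a (g a b)) * H (g a b)) * ennreal (g' a b) \<partial>lborel)"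
    proof (intro nn_integral_cong)
      fix b
      let ?e = "exp (- (s\<^sup>2 * G a b) / 2 + 2 * s)"
      have eq: "ig_log (v + s) a * ig_log (s * (1 + v * exp (- a))) b = \<phi> a (g a b) * g' a b * ?e"
        unfolding \<phi>_def g_def g'_def G_def by (rule ig_log_mult_eq [OF assms(1)])
      have nn: "g' a b > 0" unfolding g'_def using Gpos va [of a] by simp
      \<comment> \<open>Positivity of \<open>\<phi>\<close> at this point is read off from the
        factorization: the whole product and all its other factors are positive.\<close>
      have "\<phi> a (g a b) * (g' a b * ?e) > 0"
        using ig_log_pos [of "v + s" a] ig_log_pos [of "s * (1 + v * exp (- a))" b] eq
        by (metis mult.assoc mult_pos_pos)
      then have nn2: "\<phi> a (g a b) > 0"
        by (rule zero_less_mult_pos2) (use nn in simp)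
      have "ennreal (ig_log (s * (1 + v * exp (- a))) b) * \<Psi> (G a b) * ennreal (ig_log (v + s) a)
        = ennreal (ig_log (v + s) a * ig_log (s * (1 + v * exp (- a))) b) * \<Psi> (G a b)"
        by (subst ennreal_mult') (auto simp: less_imp_le [OF ig_log_pos] mult_ac)
      also have "\<dots> = ennreal (\<phi> a (g a b)) * (ennreal ?e * \<Psi> (G a b)) * ennreal (g' a b)"
        unfolding eq using nn nn2 by (simp add: ennreal_mult less_imp_le mult_ac)
      finally show "ennreal (ig_log (s * (1 + v * exp (- a))) b) * \<Psi> (G a b) * ennreal (ig_log (v + s) a)
        = ennreal (\<phi> a (g a b)) * H (g a b) * ennreal (g' a b)"
        unfolding H_def Gg .
    qed
    also have "\<dots> = (\<integral>\<^sup>+z. (ennreal (\<phi> a z) * H z) * indicator (range (g a)) z \<partial>lborel)"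
    proof (rule nn_integral_substitution_range [symmetric])
      show "(\<lambda>z. ennreal (\<phi> a z) * H z) \<in> borel_measurable borel" unfolding \<phi>_def by measurable
      show "(g a has_real_derivative g' a x) (at x)" for x
        using Gpos [of a x] unfolding g_def g'_def G_def
        by (auto intro!: derivative_eq_intros simp: field_simps)
      show "continuous_on UNIV (g' a)"
        unfolding g'_def G_def by (intro continuous_intros) (use Gne in \<open>simp add: G_def\<close>)
      show "g' a x \<ge> 0" for x unfolding g'_def using Gpos [of a x] by simp
    qed
    finally show ?thesis by (simp add: range_g mult_ac)
  qed
  have "(\<integral>\<^sup>+a. ennreal (ig_log (v + s) a) * (\<integral>\<^sup>+b. ennreal (ig_log (s * (1 + v * exp (- a))) b)
            * \<Psi> (exp (- a) + (1 + v * exp (- a))\<^sup>2 * exp (- b)) \<partial>lborel) \<partial>lborel)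
    = (\<integral>\<^sup>+a. (\<integral>\<^sup>+z. ennreal (\<phi> a z) * indicator {z. exp z < 4 * exp a} z * H z \<partial>lborel) \<partial>lborel)"
    unfolding step [symmetric] by (simp add: G_def mult.commute)
  also have "\<dots> = (\<integral>\<^sup>+z. (\<integral>\<^sup>+a. ennreal (\<phi> a z) * indicator {z. exp z < 4 * exp a} z * H z \<partial>lborel) \<partial>lborel)"
    unfolding \<phi>_def by (rule lborel_pair.Fubini') measurable
  also have "\<dots> = (\<integral>\<^sup>+z. ennreal (ig_log (2 * s) z) * \<Psi> (4 * exp (- z)) \<partial>lborel)"
  proof (intro nn_integral_cong)
    fix z
    have "(\<integral>\<^sup>+a. ennreal (\<phi> a z) * indicator {z. exp z < 4 * exp a} z * H z \<partial>lborel)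
       = (\<integral>\<^sup>+a. ennreal (\<phi> a z) * indicator {a. exp z < 4 * exp a} a \<partial>lborel) * H z"
      by (subst nn_integral_multc [symmetric])
         (auto simp: \<phi>_def indicator_def intro!: nn_integral_cong)
    also have "(\<integral>\<^sup>+a. ennreal (\<phi> a z) * indicator {a. exp z < 4 * exp a} a \<partial>lborel)
       = ennreal (exp (z / 2 - exp z / 2) / sqrt (2 * pi))"
      unfolding \<phi>_def by (rule nn_integral_ig_pair_inner [OF assms(1)])
    also have "ennreal (exp (z / 2 - exp z / 2) / sqrt (2 * pi)) * H z
       = ennreal (ig_log (2 * s) z) * \<Psi> (4 * exp (- z))"
    proof -
      have "exp (z / 2 - exp z / 2) / sqrt (2 * pi) * exp (- (s\<^sup>2 * (4 * exp (- z))) / 2 + 2 * s) = ig_log (2 * s) z"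
        unfolding ig_log_def times_divide_eq_left exp_add [symmetric]
        by (simp add: power_mult_distrib algebra_simps add_divide_distrib diff_divide_distrib)
      then show ?thesis
        unfolding H_def mult.assoc [symmetric] by (subst ennreal_mult' [symmetric]) auto
    qed
    finally show "(\<integral>\<^sup>+a. ennreal (\<phi> a z) * indicator {z. exp z < 4 * exp a} z * H z \<partial>lborel)
       = ennreal (ig_log (2 * s) z) * \<Psi> (4 * exp (- z))" .
  qed
  finally show ?thesis .
qed

section \<open>Elimination of a vertex\<close>

text \<open>
  Weights are represented by kernels on \<open>'a option\<close> that treat \<open>\<rho> = None\<close> like any other vertex.
  Diagonal values and values outside the vertex set are irrelevant, so they may be taken positive,
  and \<open>pos_kernel\<close> needs no reference to the vertex set.
\<close>

definition elim :: "('v \<Rightarrow> 'v \<Rightarrow> real) \<Rightarrow> 'v \<Rightarrow> real \<Rightarrow> 'v \<Rightarrow> 'v \<Rightarrow> real" where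
  "elim c x t y z = c y z + c y x * c x z / t"

definition pos_kernel :: "('v \<Rightarrow> 'v \<Rightarrow> real) \<Rightarrow> bool" where
  "pos_kernel c \<longleftrightarrow> (\<forall>x y. c x y > 0 \<and> c x y = c y x)"

definition lap :: "'a set \<Rightarrow> ('a option \<Rightarrow> 'a option \<Rightarrow> real) \<Rightarrow> ('a \<Rightarrow> real) \<Rightarrow> 'a \<Rightarrow> 'a \<Rightarrow> real" where
  "lap V c u i j =
     (if i = j then \<Sum>k\<in>vertices V - {Some i}. c (Some i) k * exp (u i + pin u k)
      else - c (Some i) (Some j) * exp (u i + u j))"

definition det_lap :: "'a set \<Rightarrow> ('a option \<Rightarrow> 'a option \<Rightarrow> real) \<Rightarrow> ('a \<Rightarrow> real) \<Rightarrow> real" where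
  "det_lap V c u = det_on V (lap V c u)"

section \<open>Laplacian determinants under elimination of a vertex\<close>

lemma pin_simps [simp]: "pin u None = 0" "pin u (Some i) = u i"
  by (simp_all add: pin_def)

lemma pin_upd: "pin (u(x := r)) = (pin u)(Some x := r)"
  by (auto simp: pin_def fun_eq_iff split: option.splits)

lemma vertices_insert: "vertices (insert x V) = insert (Some x) (vertices V)"
  by (auto simp: vertices_def)

lemma finite_vertices [simp]: "finite V \<Longrightarrow> finite (vertices V)"
  by (simp add: vertices_def)

lemma None_vertices [simp]: "None \<in> vertices V"
  by (simp add: vertices_def)

lemma Some_vertices [simp]: "Some x \<in> vertices V \<longleftrightarrow> x \<in> V"
  by (auto simp: vertices_def)

lemma pos_kernelD: "pos_kernel c \<Longrightarrow> c x y > 0" "pos_kernel c \<Longrightarrow> c x y = c y x"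
  by (auto simp: pos_kernel_def)

lemma pos_kernel_elim: "pos_kernel c \<Longrightarrow> t > 0 \<Longrightarrow> pos_kernel (elim c x t)"
  by (auto simp: pos_kernel_def elim_def intro!: add_pos_pos mult_pos_pos divide_pos_pos)

lemma sum_pos_kernel:
  assumes "finite V" "pos_kernel c" "\<And>z. f z > 0"
  shows "(\<Sum>z\<in>vertices V. c x z * f z) > 0"
  using assms by (intro sum_pos) (auto simp: pos_kernelD intro: exI [of _ None] dest: arg_cong [of _ _ "\<lambda>A. None \<in> A"])

text \<open>The star-mesh transformation: the Schur complement of a Laplacian is again a Laplacian,
  with the weights of \<open>elim\<close>. The factors \<open>exp r\<close> from row and column
  \<open>x\<close> cancel against the pivot \<open>exp (2 * r) * t\<close>, which leaves
  \<open>t\<close> as the only trace of \<open>r\<close>.\<close>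

lemma lap_upd:
  assumes "finite V" "x \<notin> V" "pos_kernel c" "t > 0"
    and t: "t = exp (- r) * (\<Sum>k\<in>vertices V. c (Some x) k * exp (pin u k))"
  shows "lap (insert x V) c (u(x := r)) x x = exp (2 * r) * t"
    and "\<And>i j. i \<in> V \<Longrightarrow> j \<in> V \<Longrightarrow>
      lap (insert x V) c (u(x := r)) i j
        - lap (insert x V) c (u(x := r)) i x * lap (insert x V) c (u(x := r)) x j / (exp (2 * r) * t)
      = lap V (elim c (Some x) t) u i j"
proof -
  have S: "(\<Sum>k\<in>vertices V. c (Some x) k * exp (pin u k)) = exp r * t"
    unfolding t by (simp add: exp_minus)
  have vx: "vertices (insert x V) - {Some x} = vertices V"
    using assms(2) by (auto simp: vertices_insert)
  have "lap (insert x V) c (u(x := r)) x x = (\<Sum>k\<in>vertices V. c (Some x) k * exp (r + pin u k))"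
    unfolding lap_def vx using assms(2) by (auto intro!: sum.cong simp: pin_upd)
  also have "\<dots> = exp r * (\<Sum>k\<in>vertices V. c (Some x) k * exp (pin u k))"
    by (simp add: sum_distrib_left exp_add mult_ac)
  finally show "lap (insert x V) c (u(x := r)) x x = exp (2 * r) * t"
    unfolding S by (simp add: exp_double power2_eq_square)
  fix i j assume ij: "i \<in> V" "j \<in> V"
  then have ne: "i \<noteq> x" "j \<noteq> x" using assms(2) by auto
  have prod: "lap (insert x V) c (u(x := r)) i x * lap (insert x V) c (u(x := r)) x j / (exp (2 * r) * t)
    = c (Some i) (Some x) * c (Some x) (Some j) / t * exp (u i + u j)"
    unfolding lap_def using ne by (simp add: exp_add exp_double power2_eq_square)
  show "lap (insert x V) c (u(x := r)) i j
        - lap (insert x V) c (u(x := r)) i x * lap (insert x V) c (u(x := r)) x j / (exp (2 * r) * t)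
      = lap V (elim c (Some x) t) u i j"
  proof (cases "i = j")
    case False
    then show ?thesis unfolding prod using ne by (simp add: lap_def elim_def algebra_simps)
  next
    case [simp]: True
    have vi: "vertices (insert x V) - {Some i} = insert (Some x) (vertices V - {Some i})"
      using ne by (auto simp: vertices_insert)
    define A where "A = (\<Sum>k\<in>vertices V - {Some i}. c (Some i) k * exp (u i + pin u k))"
    have l1: "lap (insert x V) c (u(x := r)) i i = c (Some i) (Some x) * exp (u i + r) + A"
      unfolding lap_def vi A_def using ne assms(1,2)
      by (auto intro!: sum.cong simp: pin_upd split: if_splits)
    have l2: "lap V (elim c (Some x) t) u i i
      = A + c (Some i) (Some x) * exp (u i) / t * (\<Sum>k\<in>vertices V - {Some i}. c (Some x) k * exp (pin u k))"
      unfolding lap_def elim_def A_def by (simp add: sum.distrib sum_distrib_left exp_add algebra_simps)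
    \<comment> \<open>A diagonal entry of the new Laplacian runs over \<open>k\<close> different
      from \<open>Some i\<close>, whereas \<open>t\<close> involves all of
      \<open>vertices V\<close>; the missing term is exactly the product subtracted in the Schur
      complement for \<open>i = j\<close>.\<close>
    have l3: "(\<Sum>k\<in>vertices V - {Some i}. c (Some x) k * exp (pin u k))
       = exp r * t - c (Some x) (Some i) * exp (u i)"
      unfolding S [symmetric] using assms(1) ij by (simp add: sum_diff1)
    show ?thesis
      unfolding prod unfolding True [symmetric] l1 l2 l3 exp_add
      using assms(4) by (simp add: field_simps)
  qed
qed

lemma det_lap_insert:
  assumes "finite V" "x \<notin> V" "pos_kernel c" "t > 0"
    and t: "t = exp (- r) * (\<Sum>k\<in>vertices V. c (Some x) k * exp (pin u k))"
  shows "det_lap (insert x V) c (u(x := r)) = exp (2 * r) * t * det_lap V (elim c (Some x) t) u"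
proof -
  have "det_lap (insert x V) c (u(x := r)) = exp (2 * r) * t *
    det_on V (\<lambda>i j. lap (insert x V) c (u(x := r)) i j
        - lap (insert x V) c (u(x := r)) i x * lap (insert x V) c (u(x := r)) x j / (exp (2 * r) * t))"
    unfolding det_lap_def lap_upd(1) [OF assms, symmetric]
    using assms lap_upd(1) [OF assms] by (intro det_on_schur) auto
  also have "det_on V (\<lambda>i j. lap (insert x V) c (u(x := r)) i j
        - lap (insert x V) c (u(x := r)) i x * lap (insert x V) c (u(x := r)) x j / (exp (2 * r) * t))
     = det_lap V (elim c (Some x) t) u"
    unfolding det_lap_def by (intro det_on_cong lap_upd(2) assms)
  finally show ?thesis .
qed

text \<open>The variable \<open>2 \<beta>\<^sub>x\<close> as a function of \<open>u\<close>.\<close>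

definition elim_rate :: "'a set \<Rightarrow> ('a option \<Rightarrow> 'a option \<Rightarrow> real) \<Rightarrow> 'a \<Rightarrow> ('a \<Rightarrow> real) \<Rightarrow> real" where
  "elim_rate V c x u = exp (- u x) * (\<Sum>k\<in>vertices V. c (Some x) k * exp (pin u k))"

lemma elim_rate_pos: "finite V \<Longrightarrow> pos_kernel c \<Longrightarrow> elim_rate V c x u > 0"
  unfolding elim_rate_def by (intro mult_pos_pos sum_pos_kernel) auto

lemma det_lap_insert':
  assumes "finite V" "x \<notin> V" "pos_kernel c"
  shows "det_lap (insert x V) c u
    = exp (2 * u x) * elim_rate V c x u * det_lap V (elim c (Some x) (elim_rate V c x u)) u"
  using det_lap_insert [of V x c "elim_rate V c x u" "u x" u] elim_rate_pos [of V c x u] assms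
  by (simp add: elim_rate_def)

lemma det_lap_pos: "finite V \<Longrightarrow> pos_kernel c \<Longrightarrow> det_lap V c u > 0"
proof (induction V arbitrary: c rule: finite_induct)
  case empty
  then show ?case by (simp add: det_lap_def det_on_def)
next
  case (insert x V)
  then have "pos_kernel (elim c (Some x) (elim_rate V c x u))"
    by (intro pos_kernel_elim elim_rate_pos)
  with insert show ?case
    by (subst det_lap_insert') (auto intro!: mult_pos_pos elim_rate_pos)
qed

lemma det_lap_cong:
  assumes "\<And>y z. y \<in> vertices V \<Longrightarrow> z \<in> vertices V \<Longrightarrow> y \<noteq> z \<Longrightarrow> c y z = c' y z"
    and "\<And>i. i \<in> V \<Longrightarrow> u i = u' i"
  shows "det_lap V c u = det_lap V c' u'"
proof -
  have "pin u k = pin u' k" if "k \<in> vertices V" for k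
    using that assms(2) by (cases k) auto
  moreover have "c y z = c' y z" if "y \<in> vertices V" "z \<in> vertices V - {y}" for y z
    using assms(1) [of y z] that by auto
  ultimately have "(\<Sum>k\<in>vertices V - {Some i}. c (Some i) k * exp (u i + pin u k))
      = (\<Sum>k\<in>vertices V - {Some i}. c' (Some i) k * exp (u' i + pin u' k))" if "i \<in> V" for i
    using that assms(2) by (intro sum.cong) auto
  then show ?thesis
    unfolding det_lap_def lap_def using assms
    by (intro det_on_cong) auto
qed

section \<open>Energy and quadratic form under elimination of a vertex\<close>

lemma sum_sum_insert_symmetric:
  fixes \<phi> :: "'v \<Rightarrow> 'v \<Rightarrow> real"
  assumes "finite A" "X \<notin> A" "\<And>y z. \<phi> y z = \<phi> z y" "\<phi> X X = 0"
  shows "(\<Sum>y\<in>insert X A. \<Sum>z\<in>insert X A. \<phi> y z) = 2 * (\<Sum>z\<in>A. \<phi> X z) + (\<Sum>y\<in>A. \<Sum>z\<in>A. \<phi> y z)"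
proof -
  have "(\<Sum>y\<in>A. \<phi> y X) = (\<Sum>z\<in>A. \<phi> X z)"
    by (intro sum.cong refl assms(3))
  then show ?thesis using assms(1,2,4) by (simp add: sum.distrib)
qed

text \<open>Each edge occurs as two ordered pairs, hence the factor 1/2. Diagonal terms vanish since
  \<open>cosh 0 = 1\<close>, so diagonal values of \<open>c\<close> do not matter.\<close>

definition energy :: "'a set \<Rightarrow> ('a option \<Rightarrow> 'a option \<Rightarrow> real) \<Rightarrow> ('a option \<Rightarrow> real) \<Rightarrow> real" where
  "energy V c p = (\<Sum>y\<in>vertices V. \<Sum>z\<in>vertices V. c y z * (cosh (p y - p z) - 1)) / 2"

text \<open>One factor 1/2 undoes the double counting of edges, the other is the 1/2 in front of the
  square in \<open>Bfun\<close>.\<close>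

definition quad :: "'a set \<Rightarrow> ('a option \<Rightarrow> 'a option \<Rightarrow> real) \<Rightarrow> ('a option \<Rightarrow> real) \<Rightarrow> real" where
  "quad V g q = (\<Sum>y\<in>vertices V. \<Sum>z\<in>vertices V. g y z * (q y - q z)\<^sup>2) / 4"

text \<open>Put \<open>A\<close> and \<open>B\<close> for the sums of \<open>w k * exp (p k)\<close>
  and \<open>w k * exp (- p k)\<close>. The edges at \<open>x\<close> contribute
  \<open>(exp (- r) * A + exp r * B) / 2 - S\<close>, while the new weights contribute
  \<open>(A * B - S^2) / (2 * t)\<close>. Since \<open>A / t = exp r\<close>, the terms with
  \<open>B\<close> agree, and the difference depends on \<open>t\<close> and \<open>S\<close>
  only.\<close>

lemma energy_insert:
  assumes "finite V" "x \<notin> V" "pos_kernel c"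
    and t: "t = exp (- r) * (\<Sum>k\<in>vertices V. c (Some x) k * exp (p k))"
    and S: "S = (\<Sum>k\<in>vertices V. c (Some x) k)"
  shows "energy (insert x V) c (p(Some x := r)) = energy V (elim c (Some x) t) p + (t + S\<^sup>2 / t) / 2 - S"
proof -
  define w where "w = c (Some x)"
  define A B where "A = (\<Sum>k\<in>vertices V. w k * exp (p k))" and "B = (\<Sum>k\<in>vertices V. w k * exp (- p k))"
  define E where "E = (\<Sum>y\<in>vertices V. \<Sum>z\<in>vertices V. c y z * (cosh (p y - p z) - 1))"
  have w: "w y > 0" "c y (Some x) = w y" for y
    using assms(3) by (auto simp: w_def pos_kernelD)
  have A: "A > 0" unfolding A_def w_def using assms by (intro sum_pos_kernel) auto
  have tA: "t = exp (- r) * A" unfolding t A_def w_def ..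
  have nx: "Some x \<notin> vertices V" using assms(2) by simp
  then have upd: "(p(Some x := r)) y = p y" if "y \<in> vertices V" for y using that by auto
  have e0: "2 * energy (insert x V) c (p(Some x := r)) = 2 * (\<Sum>z\<in>vertices V. w z * (cosh (r - p z) - 1)) + E"
  proof -
    have "(\<Sum>z\<in>vertices V. c (Some x) z * (cosh ((p(Some x := r)) (Some x) - (p(Some x := r)) z) - 1))
      = (\<Sum>z\<in>vertices V. w z * (cosh (r - p z) - 1))"
      using assms(2) by (intro sum.cong refl) (auto simp: w_def)
    moreover have "(\<Sum>y\<in>vertices V. \<Sum>z\<in>vertices V. c y z * (cosh ((p(Some x := r)) y - (p(Some x := r)) z) - 1)) = E"
      unfolding E_def by (intro sum.cong refl) (simp only: upd)
    moreover have "cosh ((p(Some x := r)) y - (p(Some x := r)) z) = cosh ((p(Some x := r)) z - (p(Some x := r)) y)" for y z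
      by (metis cosh_minus minus_diff_eq)
    ultimately show ?thesis
      unfolding energy_def vertices_insert
      by (subst sum_sum_insert_symmetric) (use assms(1) nx pos_kernelD(2) [OF assms(3)] in auto)
  qed
  have e0': "(\<Sum>z\<in>vertices V. w z * (cosh (r - p z) - 1)) = (exp (- r) * A + exp r * B) / 2 - S"
  proof -
    have "w z * (cosh (r - p z) - 1) = exp (- r) * (w z * exp (p z)) / 2 + exp r * (w z * exp (- p z)) / 2 - w z" for z
    proof -
      have "cosh (r - p z) = (exp r * exp (- p z) + exp (- r) * exp (p z)) / 2"
        by (simp add: cosh_def flip: exp_add)
      then show ?thesis by (simp add: field_simps)
    qed
    then show ?thesis
      unfolding A_def B_def S w_def [symmetric]
      by (simp add: sum.distrib sum_subtractf sum_distrib_left sum_divide_distrib add_divide_distrib)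
  qed
  have e1: "2 * energy (insert x V) c (p(Some x := r)) = (t + exp r * B) - 2 * S + E"
    unfolding e0 e0' tA by simp
  have "2 * energy V (elim c (Some x) t) p
      = E + (\<Sum>y\<in>vertices V. \<Sum>z\<in>vertices V. w y * w z * (cosh (p y - p z) - 1)) / t"
  proof -
    have "(\<Sum>y\<in>vertices V. \<Sum>z\<in>vertices V. elim c (Some x) t y z * (cosh (p y - p z) - 1))
        = E + (\<Sum>y\<in>vertices V. \<Sum>z\<in>vertices V. w y * w z * (cosh (p y - p z) - 1)) / t"
      unfolding elim_def E_def w(2) w_def [symmetric] sum_divide_distrib
      by (simp add: sum.distrib [symmetric] algebra_simps diff_divide_distrib add_divide_distrib)
    then show ?thesis unfolding energy_def by simp
  qed
  also have "(\<Sum>y\<in>vertices V. \<Sum>z\<in>vertices V. w y * w z * (cosh (p y - p z) - 1)) = A * B - S\<^sup>2"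
  proof -
    have "w y * w z * (cosh (p y - p z) - 1)
      = (w y * exp (p y)) * (w z * exp (- p z)) / 2 + (w y * exp (- p y)) * (w z * exp (p z)) / 2 - w y * w z" for y z
    proof -
      have "cosh (p y - p z) = (exp (p y) * exp (- p z) + exp (- p y) * exp (p z)) / 2"
        by (simp add: cosh_def flip: exp_add)
      then show ?thesis by (simp add: field_simps)
    qed
    then have "(\<Sum>y\<in>vertices V. \<Sum>z\<in>vertices V. w y * w z * (cosh (p y - p z) - 1))
       = A * B / 2 + B * A / 2 - S * S"
      unfolding A_def B_def S w_def [symmetric] sum_product
      by (simp add: sum.distrib sum_subtractf sum_divide_distrib)
    then show ?thesis by (simp add: power2_eq_square)
  qed
  also have "(A * B - S\<^sup>2) / t = exp r * B - S\<^sup>2 / t"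
    using A by (simp add: tA exp_minus field_simps)
  finally show ?thesis using e1 by (simp add: field_simps)
qed

text \<open>Completing the square in \<open>r\<close>: the minimizer is the weighted mean of the
  neighbours, and the minimum is the quadratic form of the reduced network. In contrast to the
  energy, the rate is here the total weight \<open>S\<close> itself.\<close>

lemma quad_insert:
  assumes "finite V" "x \<notin> V" "pos_kernel g"
    and S: "S = (\<Sum>k\<in>vertices V. g (Some x) k)"
  shows "quad (insert x V) g (p(Some x := r))
    = quad V (elim g (Some x) S) p + S * (r - (\<Sum>k\<in>vertices V. g (Some x) k * p k) / S)\<^sup>2 / 2"
proof -
  define w where "w = g (Some x)"
  define A B where "A = (\<Sum>k\<in>vertices V. w k * p k)" and "B = (\<Sum>k\<in>vertices V. w k * (p k)\<^sup>2)"
  define E where "E = (\<Sum>y\<in>vertices V. \<Sum>z\<in>vertices V. g y z * (p y - p z)\<^sup>2)"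
  have w: "w y > 0" "g y (Some x) = w y" for y
    using assms(3) by (auto simp: w_def pos_kernelD)
  have Sp: "S > 0" unfolding S using assms sum_pos_kernel [of V g "\<lambda>_. 1" "Some x"] by auto
  have nx: "Some x \<notin> vertices V" using assms(2) by simp
  then have upd: "(p(Some x := r)) y = p y" if "y \<in> vertices V" for y using that by auto
  have e0: "4 * quad (insert x V) g (p(Some x := r)) = 2 * (\<Sum>z\<in>vertices V. w z * (r - p z)\<^sup>2) + E"
  proof -
    have "(\<Sum>z\<in>vertices V. g (Some x) z * ((p(Some x := r)) (Some x) - (p(Some x := r)) z)\<^sup>2)
      = (\<Sum>z\<in>vertices V. w z * (r - p z)\<^sup>2)"
      using assms(2) by (intro sum.cong refl) (auto simp: w_def)
    moreover have "(\<Sum>y\<in>vertices V. \<Sum>z\<in>vertices V. g y z * ((p(Some x := r)) y - (p(Some x := r)) z)\<^sup>2) = E"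
      unfolding E_def by (intro sum.cong refl) (simp only: upd)
    ultimately show ?thesis
      unfolding quad_def vertices_insert
      by (subst sum_sum_insert_symmetric)
         (use assms(1) nx pos_kernelD(2) [OF assms(3)] in \<open>auto simp: power2_commute\<close>)
  qed
  have e0': "(\<Sum>z\<in>vertices V. w z * (r - p z)\<^sup>2) = S * r\<^sup>2 - 2 * r * A + B"
  proof -
    have "w z * (r - p z)\<^sup>2 = w z * r\<^sup>2 - 2 * r * (w z * p z) + w z * (p z)\<^sup>2" for z
      by (simp add: power2_eq_square algebra_simps)
    then show ?thesis
      unfolding A_def B_def S w_def [symmetric]
      by (simp add: sum.distrib sum_subtractf sum_distrib_left sum_distrib_right)
  qed
  have e1: "4 * quad (insert x V) g (p(Some x := r)) = 2 * (S * r\<^sup>2 - 2 * r * A + B) + E"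
    unfolding e0 e0' ..
  have "4 * quad V (elim g (Some x) S) p
      = E + (\<Sum>y\<in>vertices V. \<Sum>z\<in>vertices V. w y * w z * (p y - p z)\<^sup>2) / S"
  proof -
    have "(\<Sum>y\<in>vertices V. \<Sum>z\<in>vertices V. elim g (Some x) S y z * (p y - p z)\<^sup>2)
        = E + (\<Sum>y\<in>vertices V. \<Sum>z\<in>vertices V. w y * w z * (p y - p z)\<^sup>2) / S"
      unfolding elim_def E_def w(2) w_def [symmetric] sum_divide_distrib
      by (simp add: sum.distrib [symmetric] algebra_simps diff_divide_distrib add_divide_distrib)
    then show ?thesis unfolding quad_def by simp
  qed
  also have "(\<Sum>y\<in>vertices V. \<Sum>z\<in>vertices V. w y * w z * (p y - p z)\<^sup>2) = 2 * S * B - 2 * A\<^sup>2"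
  proof -
    have "w y * w z * (p y - p z)\<^sup>2
      = (w y * (p y)\<^sup>2) * w z + w y * (w z * (p z)\<^sup>2) - 2 * ((w y * p y) * (w z * p z))" for y z
      by (simp add: power2_eq_square algebra_simps)
    then have "(\<Sum>y\<in>vertices V. \<Sum>z\<in>vertices V. w y * w z * (p y - p z)\<^sup>2)
       = B * S + S * B - 2 * (A * A)"
      unfolding A_def B_def S w_def [symmetric] sum_product
      by (simp add: sum.distrib sum_subtractf sum_distrib_left)
    then show ?thesis by (simp add: power2_eq_square)
  qed
  finally have e2: "4 * quad V (elim g (Some x) S) p = E + 2 * B - 2 * A\<^sup>2 / S"
    using Sp by (simp add: field_simps)
  have "S * (r - A / S)\<^sup>2 = S * r\<^sup>2 - 2 * r * A + A\<^sup>2 / S"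
    using Sp by (simp add: power2_eq_square field_simps)
  then show ?thesis using e1 e2 unfolding A_def [symmetric] w_def [symmetric] by argo
qed

section \<open>Density, measurability and total mass\<close>

definition dens :: "'a set \<Rightarrow> ('a option \<Rightarrow> 'a option \<Rightarrow> real) \<Rightarrow> ('a \<Rightarrow> real) \<Rightarrow> real" where
  "dens V c u = exp (- energy V c (pin u)) * sqrt (det_lap V c u) * (\<Prod>i\<in>V. exp (- u i) / sqrt (2 * pi))"

definition expect :: "'a set \<Rightarrow> ('a option \<Rightarrow> 'a option \<Rightarrow> real) \<Rightarrow> (('a \<Rightarrow> real) \<Rightarrow> ennreal) \<Rightarrow> ennreal" where
  "expect V c f = (\<integral>\<^sup>+u. ennreal (dens V c u) * f u \<partial>(\<Pi>\<^sub>M i\<in>V. lborel))"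

lemma dens_nonneg: "finite V \<Longrightarrow> pos_kernel c \<Longrightarrow> dens V c u \<ge> 0"
  unfolding dens_def using det_lap_pos [of V c u] by (auto intro!: mult_nonneg_nonneg prod_nonneg)

lemma dens_cong:
  assumes "\<And>y z. y \<in> vertices V \<Longrightarrow> z \<in> vertices V \<Longrightarrow> y \<noteq> z \<Longrightarrow> c y z = c' y z"
    and "\<And>i. i \<in> V \<Longrightarrow> u i = u' i"
  shows "dens V c u = dens V c' u'"
proof -
  have p: "pin u k = pin u' k" if "k \<in> vertices V" for k
    using that assms(2) by (cases k) auto
  have "c y z * (cosh (pin u y - pin u z) - 1) = c' y z * (cosh (pin u' y - pin u' z) - 1)"
    if "y \<in> vertices V" "z \<in> vertices V" for y z
    using assms(1) [of y z] p that by (cases "y = z") auto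
  then have "energy V c (pin u) = energy V c' (pin u')"
    unfolding energy_def by (intro arg_cong2 [where f="(/)"] sum.cong refl)
  moreover have "det_lap V c u = det_lap V c' u'"
    using assms by (rule det_lap_cong)
  ultimately show ?thesis
    unfolding dens_def using assms(2) by simp
qed

lemma expect_cong:
  assumes "\<And>y z. y \<in> vertices V \<Longrightarrow> z \<in> vertices V \<Longrightarrow> y \<noteq> z \<Longrightarrow> c y z = c' y z"
  shows "expect V c f = expect V c' f"
proof -
  have "dens V c u = dens V c' u" for u
    using assms by (intro dens_cong) auto
  then show ?thesis by (simp add: expect_def)
qed

lemma det_on_measurable [measurable (raw)]:
  assumes "\<And>i j. i \<in> V \<Longrightarrow> j \<in> V \<Longrightarrow> (\<lambda>p. A p i j) \<in> borel_measurable M"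
  shows "(\<lambda>p. det_on V (A p)) \<in> borel_measurable M"
  unfolding det_on_def using assms
  by (intro borel_measurable_sum borel_measurable_times borel_measurable_const borel_measurable_prod)
     (auto dest: permutes_in_image)

lemma pin_measurable:
  assumes "\<And>i. i \<in> V \<Longrightarrow> (\<lambda>p. U p i) \<in> borel_measurable M" "k \<in> vertices V"
  shows "(\<lambda>p. pin (U p) k) \<in> borel_measurable M"
  using assms by (cases k) auto

lemma energy_measurable:
  assumes "\<And>y z. (\<lambda>p. C p y z) \<in> borel_measurable M"
    and "\<And>i. i \<in> V \<Longrightarrow> (\<lambda>p. U p i) \<in> borel_measurable M"
  shows "(\<lambda>p. energy V (C p) (pin (U p))) \<in> borel_measurable M"
proof -
  have "(\<lambda>x::real. cosh x) \<in> borel_measurable borel"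
    by (intro borel_measurable_continuous_onI continuous_intros)
  then show ?thesis
    unfolding energy_def
    by (intro borel_measurable_divide borel_measurable_sum borel_measurable_times borel_measurable_diff
        borel_measurable_const assms(1) measurable_compose [of _ M borel cosh] pin_measurable [OF assms(2)])
qed

lemma det_lap_measurable:
  assumes [measurable]: "\<And>y z. (\<lambda>p. C p y z) \<in> borel_measurable M"
    and U: "\<And>i. i \<in> V \<Longrightarrow> (\<lambda>p. U p i) \<in> borel_measurable M"
  shows "(\<lambda>p. det_lap V (C p) (U p)) \<in> borel_measurable M"
  unfolding det_lap_def
proof (intro det_on_measurable)
  fix i j assume [simp]: "i \<in> V" "j \<in> V"
  have [measurable]: "(\<lambda>p. U p i) \<in> borel_measurable M" "(\<lambda>p. U p j) \<in> borel_measurable M"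
    by (auto intro: U)
  have "(\<lambda>p. \<Sum>k\<in>vertices V - {Some i}. C p (Some i) k * exp (U p i + pin (U p) k)) \<in> borel_measurable M"
    by (intro borel_measurable_sum borel_measurable_times measurable_compose [OF _ borel_measurable_exp]
        borel_measurable_add assms(1) U pin_measurable [OF U]) auto
  then show "(\<lambda>p. lap V (C p) (U p) i j) \<in> borel_measurable M"
    unfolding lap_def by (cases "i = j") auto
qed

text \<open>Weights and field both depend on a parameter, because exchanging the integrals over a
  rate and over the remaining field requires joint measurability.\<close>

lemma dens_measurable:
  assumes "\<And>y z. (\<lambda>p. C p y z) \<in> borel_measurable M"
    and "\<And>i. i \<in> V \<Longrightarrow> (\<lambda>p. U p i) \<in> borel_measurable M"
  shows "(\<lambda>p. dens V (C p) (U p)) \<in> borel_measurable M"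
proof -
  have "(\<lambda>p. \<Prod>i\<in>V. exp (- U p i) / sqrt (2 * pi)) \<in> borel_measurable M"
    using assms(2) by (intro borel_measurable_prod) auto
  then show ?thesis
    unfolding dens_def using energy_measurable [of C M V U] det_lap_measurable [of C M V U] assms
    by measurable
qed

text \<open>The pivot \<open>exp (2 * r) * t\<close> enters under a square root: its
  \<open>exp r\<close> cancels the \<open>exp (- r)\<close> of the product, and
  \<open>sqrt t = exp (a / 2)\<close> joins the energy difference to form \<open>ig_log\<close>. At
  fixed \<open>u\<close> the map from \<open>r\<close> to \<open>a\<close> is a reflection, so no
  Jacobian is left over.\<close>

lemma dens_insert:
  assumes "finite V" "x \<notin> V" "pos_kernel c"
    and a: "a = ln (\<Sum>k\<in>vertices V. c (Some x) k * exp (pin u k)) - r"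
  shows "dens (insert x V) c (u(x := r))
    = ig_log (\<Sum>k\<in>vertices V. c (Some x) k) a * dens V (elim c (Some x) (exp a)) u"
proof -
  define A S where "A = (\<Sum>k\<in>vertices V. c (Some x) k * exp (pin u k))" and "S = (\<Sum>k\<in>vertices V. c (Some x) k)"
  define t where "t = exp a"
  have "A > 0" unfolding A_def using assms by (intro sum_pos_kernel) auto
  then have tA: "t = exp (- r) * A"
    unfolding t_def a A_def [symmetric] by (simp add: exp_diff exp_minus divide_inverse mult.commute)
  have t: "t > 0" by (simp add: t_def)
  have en: "energy (insert x V) c (pin (u(x := r)))
      = energy V (elim c (Some x) t) (pin u) + (t + S\<^sup>2 / t) / 2 - S"
    unfolding pin_upd using tA by (intro energy_insert assms) (simp_all add: A_def S_def)
  have det: "det_lap (insert x V) c (u(x := r)) = exp (2 * r) * t * det_lap V (elim c (Some x) t) u"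
    using tA t by (intro det_lap_insert assms) (simp_all add: A_def)
  have pr: "(\<Prod>i\<in>insert x V. exp (- (u(x := r)) i) / sqrt (2 * pi))
     = exp (- r) / sqrt (2 * pi) * (\<Prod>i\<in>V. exp (- u i) / sqrt (2 * pi))"
    using assms(1,2) by (auto intro!: prod.cong arg_cong2 [where f="(*)"])
  have sq: "sqrt (exp (2 * r) * t * D) = exp r * exp (a / 2) * sqrt D" for D
  proof -
    have "sqrt (exp (2 * r)) = exp r" "sqrt t = exp (a / 2)"
      by (rule real_sqrt_unique; simp add: t_def power2_eq_square flip: exp_add)+
    then show ?thesis by (simp add: real_sqrt_mult)
  qed
  have ig: "ig_log S a = exp (a / 2) * exp (- ((t + S\<^sup>2 / t) / 2 - S)) / sqrt (2 * pi)"
  proof -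
    have "exp (- a) = 1 / t" by (simp add: t_def exp_minus inverse_eq_divide)
    then show ?thesis
      unfolding ig_log_def t_def [symmetric] exp_add [symmetric] by (simp add: algebra_simps)
  qed
  have "dens (insert x V) c (u(x := r))
    = (exp (- energy V (elim c (Some x) t) (pin u)) * exp (- ((t + S\<^sup>2 / t) / 2 - S)))
      * (exp r * exp (a / 2) * sqrt (det_lap V (elim c (Some x) t) u))
      * (exp (- r) / sqrt (2 * pi) * (\<Prod>i\<in>V. exp (- u i) / sqrt (2 * pi)))"
    unfolding dens_def en det pr sq exp_add [symmetric] by simp
  also have "\<dots> = (exp r * exp (- r)) * ig_log S a * dens V (elim c (Some x) t) u"
    unfolding ig dens_def by (simp only: times_divide_eq_right times_divide_eq_left mult_ac)
  also have "exp r * exp (- r) = 1" by (simp flip: exp_add)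
  finally show ?thesis unfolding S_def t_def mult_1 .
qed

text \<open>The recursion behind everything that follows: for observables that ignore
  \<open>x\<close>, a model on \<open>insert x V\<close> is a mixture of models on \<open>V\<close>
  with random weights. The mixing law knows of the weights only their total at
  \<open>x\<close>.\<close>

lemma expect_insert:
  assumes "finite V" "x \<notin> V" "pos_kernel c"
    and f: "f \<in> borel_measurable (\<Pi>\<^sub>M i\<in>insert x V. lborel)"
    and f': "f \<in> borel_measurable (\<Pi>\<^sub>M i\<in>V. lborel)"
    and upd: "\<And>u r. f (u(x := r)) = f u"
  shows "expect (insert x V) c f
    = (\<integral>\<^sup>+a. ennreal (ig_log (\<Sum>k\<in>vertices V. c (Some x) k) a) * expect V (elim c (Some x) (exp a)) f \<partial>lborel)"
proof -
  interpret product_sigma_finite "\<lambda>_::'a. lborel :: real measure" by standard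
  interpret V: sigma_finite_measure "\<Pi>\<^sub>M i\<in>V. (lborel :: real measure)"
    using assms(1) by (rule sigma_finite)
  interpret P: pair_sigma_finite lborel "\<Pi>\<^sub>M i\<in>V. (lborel :: real measure)" by standard
  define S where "S = (\<Sum>k\<in>vertices V. c (Some x) k)"
  define A where "A u = (\<Sum>k\<in>vertices V. c (Some x) k * exp (pin u k))" for u
  have dm: "(\<lambda>p. dens V (elim c (Some x) (exp (fst p))) (snd p)) \<in> borel_measurable (lborel \<Otimes>\<^sub>M (\<Pi>\<^sub>M i\<in>V. lborel))"
    unfolding elim_def by (intro dens_measurable) measurable
  have dm1: "(\<lambda>a. dens V (elim c (Some x) (exp a)) u) \<in> borel_measurable borel" for u
    unfolding elim_def by (intro dens_measurable) measurable
  have dm2: "(\<lambda>u. dens V c u) \<in> borel_measurable (\<Pi>\<^sub>M i\<in>V. lborel)" for V and c :: "'a option \<Rightarrow> _"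
    by (intro dens_measurable) measurable
  have "expect (insert x V) c f = (\<integral>\<^sup>+u. (\<integral>\<^sup>+r. ennreal (dens (insert x V) c (u(x := r))) * f (u(x := r)) \<partial>lborel) \<partial>(\<Pi>\<^sub>M i\<in>V. lborel))"
    unfolding expect_def using f dm2 assms(1,2)
    by (intro product_nn_integral_insert) auto
  also have "\<dots> = (\<integral>\<^sup>+u. (\<integral>\<^sup>+a. ennreal (ig_log S a * dens V (elim c (Some x) (exp a)) u) * f u \<partial>lborel) \<partial>(\<Pi>\<^sub>M i\<in>V. lborel))"
  proof (rule nn_integral_cong)
    \<comment> \<open>At fixed \<open>u\<close> the inner variable is changed by
      \<open>a = ln (A u) - r\<close>, an affine map with slope -1.\<close>
    fix u
    have "(\<integral>\<^sup>+a. ennreal (ig_log S a * dens V (elim c (Some x) (exp a)) u) * f u \<partial>lborel)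
       = ennreal \<bar>-1\<bar> * (\<integral>\<^sup>+r. ennreal (ig_log S (ln (A u) + (-1) * r)
            * dens V (elim c (Some x) (exp (ln (A u) + (-1) * r))) u) * f u \<partial>lborel)"
      using dm1 [of u] by (intro nn_integral_real_affine) auto
    also have "\<dots> = (\<integral>\<^sup>+r. ennreal (dens (insert x V) c (u(x := r))) * f (u(x := r)) \<partial>lborel)"
      unfolding upd S_def A_def by (simp add: dens_insert [OF assms(1-3) refl])
    finally show "(\<integral>\<^sup>+r. ennreal (dens (insert x V) c (u(x := r))) * f (u(x := r)) \<partial>lborel)
      = (\<integral>\<^sup>+a. ennreal (ig_log S a * dens V (elim c (Some x) (exp a)) u) * f u \<partial>lborel)" ..
  qed
  also have "\<dots> = (\<integral>\<^sup>+a. (\<integral>\<^sup>+u. ennreal (ig_log S a * dens V (elim c (Some x) (exp a)) u) * f u \<partial>(\<Pi>\<^sub>M i\<in>V. lborel)) \<partial>lborel)"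
  proof (rule P.Fubini')
    have "(\<lambda>p. ennreal (ig_log S (fst p) * dens V (elim c (Some x) (exp (fst p))) (snd p)) * f (snd p))
      \<in> borel_measurable (lborel \<Otimes>\<^sub>M (\<Pi>\<^sub>M i\<in>V. lborel))"
      by (rule borel_measurable_times_ennreal [OF measurable_compose [OF borel_measurable_times measurable_ennreal]])
         (auto intro: dm measurable_compose [OF measurable_snd f'])
    then show "(\<lambda>(a, u). ennreal (ig_log S a * dens V (elim c (Some x) (exp a)) u) * f u)
      \<in> borel_measurable (lborel \<Otimes>\<^sub>M (\<Pi>\<^sub>M i\<in>V. lborel))"
      by (simp add: case_prod_beta')
  qed
  also have "\<dots> = (\<integral>\<^sup>+a. ennreal (ig_log S a) * expect V (elim c (Some x) (exp a)) f \<partial>lborel)"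
    unfolding expect_def using dm2 f' ig_log_pos [of S]
    by (intro nn_integral_cong, subst nn_integral_cmult [symmetric])
       (auto simp: ennreal_mult' less_imp_le mult.assoc)
  finally show ?thesis unfolding S_def .
qed

text \<open>Each elimination splits off a probability density. That the mass is one for every
  positive kernel is what later makes two different kernels comparable.\<close>

lemma expect_one:
  "finite V \<Longrightarrow> pos_kernel c \<Longrightarrow> expect V c (\<lambda>_. 1) = 1"
proof (induction V arbitrary: c rule: finite_induct)
  case empty
  then show ?case
    by (simp add: expect_def dens_def energy_def vertices_def det_lap_def det_on_def PiM_empty nn_integral_count_space_finite)
next
  case (insert x V)
  have "expect (insert x V) c (\<lambda>_. 1)
    = (\<integral>\<^sup>+a. ennreal (ig_log (\<Sum>k\<in>vertices V. c (Some x) k) a) * expect V (elim c (Some x) (exp a)) (\<lambda>_. 1) \<partial>lborel)"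
    using insert by (intro expect_insert) auto
  also have "\<dots> = (\<integral>\<^sup>+a. ennreal (ig_log (\<Sum>k\<in>vertices V. c (Some x) k) a) \<partial>lborel)"
    using insert by (simp add: pos_kernel_elim)
  also have "\<dots> = 1"
    using sum_pos_kernel [of V c "\<lambda>_. 1" "Some x"] insert by (intro nn_integral_ig_log) auto
  finally show ?case .
qed

section \<open>The measure after integrating out the second field\<close>

text \<open>Given \<open>u\<close>, the field \<open>s\<close> is Gaussian with these conductances,
  and \<open>lap V c u\<close> is the Laplacian they define.\<close>

definition tilt :: "('a option \<Rightarrow> 'a option \<Rightarrow> real) \<Rightarrow> ('a \<Rightarrow> real) \<Rightarrow> 'a option \<Rightarrow> 'a option \<Rightarrow> real" where
  "tilt c u y z = c y z * exp (pin u y + pin u z)"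

lemma pos_kernel_tilt: "pos_kernel c \<Longrightarrow> pos_kernel (tilt c u)"
  by (auto simp: pos_kernel_def tilt_def add.commute)

lemma quad_measurable:
  assumes "\<And>i. i \<in> V \<Longrightarrow> (\<lambda>p. s p i) \<in> borel_measurable M"
    and "\<And>y z. y \<in> vertices V \<Longrightarrow> z \<in> vertices V \<Longrightarrow> (\<lambda>p. g p y z) \<in> borel_measurable M"
  shows "(\<lambda>p. quad V (g p) (pin (s p))) \<in> borel_measurable M"
  unfolding quad_def
  by (intro borel_measurable_divide borel_measurable_sum borel_measurable_times borel_measurable_diff
      borel_measurable_power borel_measurable_const assms(2) pin_measurable [OF assms(1)])

text \<open>The multivariate Gaussian integral, obtained by the same elimination. Tilting commutes
  with it when the tilted rate \<open>S\<close> is matched with \<open>exp (2 * u x) * t\<close>,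
  and these rates are the very pivots that build up \<open>det_lap\<close>.\<close>

lemma nn_integral_exp_quad:
  "finite V \<Longrightarrow> pos_kernel c \<Longrightarrow>
    (\<integral>\<^sup>+s. ennreal (exp (- quad V (tilt c u) (pin s))) \<partial>(\<Pi>\<^sub>M i\<in>V. lborel))
      = ennreal (sqrt ((2 * pi) ^ card V / det_lap V c u))"
proof (induction V arbitrary: c rule: finite_induct)
  case empty
  then show ?case
    by (simp add: quad_def vertices_def det_lap_def det_on_def PiM_empty nn_integral_count_space_finite)
next
  case (insert x V)
  interpret product_sigma_finite "\<lambda>_::'a. lborel :: real measure" by standard
  define t where "t = elim_rate V c x u"
  define S where "S = (\<Sum>k\<in>vertices V. tilt c u (Some x) k)"
  define m where "m s = (\<Sum>k\<in>vertices V. tilt c u (Some x) k * pin s k) / S" for s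
  have t: "t > 0" unfolding t_def using insert by (intro elim_rate_pos)
  have St: "S = exp (2 * u x) * t"
  proof -
    have "exp (2 * u x) * exp (- u x) = exp (u x)" by (simp flip: exp_add)
    moreover have "S = exp (u x) * (\<Sum>k\<in>vertices V. c (Some x) k * exp (pin u k))"
      unfolding S_def tilt_def by (simp add: exp_add sum_distrib_left mult_ac)
    ultimately show ?thesis
      unfolding t_def elim_rate_def mult.assoc [symmetric] by simp
  qed
  then have S: "S > 0" using t by simp
  have el: "elim (tilt c u) (Some x) S = tilt (elim c (Some x) t) u"
  proof (intro ext)
    fix y z
    have "exp (2 * u x) = exp (u x) * exp (u x)" by (simp flip: exp_add)
    then show "elim (tilt c u) (Some x) S y z = tilt (elim c (Some x) t) u y z"
      unfolding elim_def tilt_def exp_add St using t by (simp add: field_simps)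
  qed
  have gauss: "(\<integral>\<^sup>+r. ennreal (exp (- (S * (r - m) \<^sup>2 / 2))) \<partial>lborel) = ennreal (sqrt (2 * pi / S))" for m
    using nn_integral_gaussian [of "1 / sqrt S" m] S by (simp add: power_divide field_simps)
  have meas: "(\<lambda>s. ennreal (exp (- quad V g (pin s)))) \<in> borel_measurable (\<Pi>\<^sub>M i\<in>V. lborel)" for V :: "'a set" and g
    by (intro measurable_compose [OF _ measurable_ennreal] measurable_compose [OF _ borel_measurable_exp]
        borel_measurable_uminus quad_measurable) auto
  have "(\<integral>\<^sup>+s. ennreal (exp (- quad (insert x V) (tilt c u) (pin s))) \<partial>(\<Pi>\<^sub>M i\<in>insert x V. lborel))
    = (\<integral>\<^sup>+s. (\<integral>\<^sup>+r. ennreal (exp (- quad (insert x V) (tilt c u) (pin (s(x := r))))) \<partial>lborel) \<partial>(\<Pi>\<^sub>M i\<in>V. lborel))"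
    using insert meas by (intro product_nn_integral_insert) auto
  also have "\<dots> = (\<integral>\<^sup>+s. ennreal (exp (- quad V (tilt (elim c (Some x) t) u) (pin s))) * ennreal (sqrt (2 * pi / S)) \<partial>(\<Pi>\<^sub>M i\<in>V. lborel))"
  proof (rule nn_integral_cong)
    fix s
    have "quad (insert x V) (tilt c u) (pin (s(x := r)))
      = quad V (tilt (elim c (Some x) t) u) (pin s) + S * (r - m s)\<^sup>2 / 2" for r
      unfolding pin_upd el [symmetric] m_def
      using insert by (intro quad_insert) (auto simp: S_def pos_kernel_tilt)
    then have "(\<integral>\<^sup>+r. ennreal (exp (- quad (insert x V) (tilt c u) (pin (s(x := r))))) \<partial>lborel)
      = (\<integral>\<^sup>+r. ennreal (exp (- quad V (tilt (elim c (Some x) t) u) (pin s))) * ennreal (exp (- (S * (r - m s)\<^sup>2 / 2))) \<partial>lborel)"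
      by (intro nn_integral_cong) (simp add: ennreal_mult' [symmetric] flip: exp_add)
    also have "\<dots> = ennreal (exp (- quad V (tilt (elim c (Some x) t) u) (pin s))) * ennreal (sqrt (2 * pi / S))"
      by (subst nn_integral_cmult) (auto simp: gauss)
    finally show "(\<integral>\<^sup>+r. ennreal (exp (- quad (insert x V) (tilt c u) (pin (s(x := r))))) \<partial>lborel)
      = ennreal (exp (- quad V (tilt (elim c (Some x) t) u) (pin s))) * ennreal (sqrt (2 * pi / S))" .
  qed
  also have "\<dots> = ennreal (sqrt ((2 * pi) ^ card V / det_lap V (elim c (Some x) t) u)) * ennreal (sqrt (2 * pi / S))"
    using insert t by (subst nn_integral_multc [OF meas]) (simp_all add: pos_kernel_elim)
  also have "\<dots> = ennreal (sqrt ((2 * pi) ^ card V / det_lap V (elim c (Some x) t) u * (2 * pi / S)))"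
    unfolding real_sqrt_mult [of "(2 * pi) ^ card V / det_lap V (elim c (Some x) t) u" "2 * pi / S"]
    using S by (intro ennreal_mult'' [symmetric]) simp
  also have "(2 * pi) ^ card V / det_lap V (elim c (Some x) t) u * (2 * pi / S)
    = (2 * pi) ^ card (insert x V) / det_lap (insert x V) c u"
    using insert det_lap_insert' [of V x c u] by (simp add: St t_def mult_ac)
  finally show ?case .
qed

text \<open>Passage from edges as two-element sets, as in the model, to the symmetric double sums on
  which elimination acts.\<close>

lemma sum_edges:
  fixes \<phi> :: "'v \<Rightarrow> 'v \<Rightarrow> real"
  assumes "finite A" and sym: "\<And>y z. \<phi> y z = \<phi> z y" and diag: "\<And>y. \<phi> y y = 0"
  shows "(\<Sum>e\<in>{e. e \<subseteq> A \<and> card e = 2}. on_edge \<phi> e) = (\<Sum>y\<in>A. \<Sum>z\<in>A. \<phi> y z) / 2"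
  using assms(1)
proof (induction A rule: finite_induct)
  case empty
  have *: "{e. e \<subseteq> {} \<and> card e = 2} = ({} :: 'v set set)" by auto
  show ?case unfolding * by simp
next
  case (insert x A)
  have split: "{e. e \<subseteq> insert x A \<and> card e = 2} = {e. e \<subseteq> A \<and> card e = 2} \<union> (\<lambda>y. {x, y}) ` A"
  proof (intro equalityI subsetI)
    fix e assume e: "e \<in> {e. e \<subseteq> insert x A \<and> card e = 2}"
    then obtain y z where yz: "e = {y, z}" "y \<noteq> z" by (auto simp: card_2_iff)
    then show "e \<in> {e. e \<subseteq> A \<and> card e = 2} \<union> (\<lambda>y. {x, y}) ` A"
      using e by (cases "x \<in> e") auto
  qed (use insert in \<open>auto simp: card_insert_if\<close>)
  have "inj_on (\<lambda>y. {x, y}) A" by (auto simp: inj_on_def doubleton_eq_iff)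
  then have "(\<Sum>e\<in>(\<lambda>y. {x, y}) ` A. on_edge \<phi> e) = (\<Sum>y\<in>A. \<phi> x y)"
    by (simp add: sum.reindex on_edge_doubleton sym)
  moreover have "(\<Sum>e\<in>{e. e \<subseteq> insert x A \<and> card e = 2}. on_edge \<phi> e)
     = (\<Sum>e\<in>{e. e \<subseteq> A \<and> card e = 2}. on_edge \<phi> e) + (\<Sum>e\<in>(\<lambda>y. {x, y}) ` A. on_edge \<phi> e)"
    unfolding split using insert by (intro sum.union_disjoint) auto
  ultimately show ?case
    using insert by (subst sum_sum_insert_symmetric) (auto simp: sym diag)
qed

text \<open>The kernel \<open>c\<close> extends the weights by positive values on the diagonal. Its
  positivity makes every edge belong to \<open>pos_edges\<close>, so the exponent of the model
  splits into \<open>energy\<close> and \<open>quad\<close>, and the field \<open>s\<close> can be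
  integrated out at fixed \<open>u\<close>.\<close>

lemma nn_integral_mu:
  fixes W :: "'a \<Rightarrow> 'a \<Rightarrow> real" and h :: "'a \<Rightarrow> real"
  assumes fin: "finite \<Lambda>" and sym: "\<And>i j. W i j = W j i" and c: "pos_kernel c"
    and cW: "\<And>y z. y \<in> vertices \<Lambda> \<Longrightarrow> z \<in> vertices \<Lambda> \<Longrightarrow> y \<noteq> z \<Longrightarrow> full_weight W h y z = c y z"
    and f: "f \<in> borel_measurable (\<Pi>\<^sub>M i\<in>\<Lambda>. lborel)"
  shows "(\<integral>\<^sup>+(u, s). f u \<partial>mu \<Lambda> W h) = expect \<Lambda> c f"
proof -
  let ?P = "\<Pi>\<^sub>M i\<in>\<Lambda>. (lborel :: real measure)"
  interpret product_sigma_finite "\<lambda>_::'a. lborel :: real measure" by standard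
  interpret P: sigma_finite_measure ?P
    using fin by (rule sigma_finite)
  define d where "d u = (\<Prod>i\<in>\<Lambda>. exp (- u i) / (2 * pi))" for u :: "'a \<Rightarrow> real"
  define \<delta> where "\<delta> u s = exp (- energy \<Lambda> c (pin u)) * exp (- quad \<Lambda> (tilt c u) (pin s)) * det_lap \<Lambda> c u * d u"
    for u s :: "'a \<Rightarrow> real"
  have exponent: "(\<Sum>e\<in>pos_edges \<Lambda> W h. on_edge (full_weight W h) e * (on_edge (Bfun u s) e - 1))
    = energy \<Lambda> c (pin u) + quad \<Lambda> (tilt c u) (pin s)" for u s
  proof -
    let ?b = "\<lambda>y z. c y z * (Bfun u s y z - 1)"
    have edge: "on_edge (full_weight W h) e = on_edge c e \<and> on_edge c e > 0
        \<and> on_edge c e * (on_edge (Bfun u s) e - 1) = on_edge ?b e"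
      if "e \<in> edges \<Lambda>" for e
    proof -
      have e: "e \<subseteq> vertices \<Lambda>" "card e = 2" using that by (simp_all add: edges_def)
      then obtain y z where yz: "e = {y, z}" "y \<noteq> z" by (auto simp: card_2_iff)
      with e have yz': "y \<in> vertices \<Lambda>" "z \<in> vertices \<Lambda>" by auto
      have "on_edge (full_weight W h) e = c y z"
        unfolding yz(1) cW [OF yz' yz(2), symmetric]
        by (intro on_edge_doubleton full_weight_sym sym)
      moreover have "on_edge c e = c y z"
        unfolding yz(1) by (intro on_edge_doubleton pos_kernelD(2) c)
      moreover have "on_edge (Bfun u s) e = Bfun u s y z"
        unfolding yz(1) by (intro on_edge_doubleton Bfun_sym)
      moreover have "on_edge ?b e = ?b y z"
        unfolding yz(1) by (rule on_edge_doubleton) (metis Bfun_sym pos_kernelD(2) c)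
      ultimately show ?thesis using pos_kernelD(1) [OF c] by simp
    qed
    then have "pos_edges \<Lambda> W h = edges \<Lambda>" by (auto simp: pos_edges_def)
    then have "(\<Sum>e\<in>pos_edges \<Lambda> W h. on_edge (full_weight W h) e * (on_edge (Bfun u s) e - 1))
       = (\<Sum>e\<in>edges \<Lambda>. on_edge ?b e)"
      using edge by (intro sum.cong) auto
    also have "\<dots> = (\<Sum>y\<in>vertices \<Lambda>. \<Sum>z\<in>vertices \<Lambda>. ?b y z) / 2"
      unfolding edges_def using fin
      by (intro sum_edges) (auto simp: Bfun_def add.commute power2_commute intro: arg_cong2 [where f="(*)"] pos_kernelD(2) [OF c])
    also have "\<dots> = energy \<Lambda> c (pin u) + quad \<Lambda> (tilt c u) (pin s)"
    proof -
      have "?b y z / 2 = c y z * (cosh (pin u y - pin u z) - 1) / 2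
          + tilt c u y z * (pin s y - pin s z)\<^sup>2 / 4" for y z
        by (simp add: Bfun_def tilt_def field_simps)
      then show ?thesis
        unfolding energy_def quad_def sum_divide_distrib by (simp only: sum.distrib)
    qed
    finally show ?thesis .
  qed
  have det: "det_on \<Lambda> (Dmat \<Lambda> W h u) = det_lap \<Lambda> c u" for u
    unfolding det_lap_def
  proof (intro det_on_cong)
    fix i j assume ij: "i \<in> \<Lambda>" "j \<in> \<Lambda>"
    have "full_weight W h (Some i) k = c (Some i) k" if "k \<in> vertices \<Lambda> - {Some i}" for k
      using cW [of "Some i" k] that ij by auto
    then have "(\<Sum>k\<in>vertices \<Lambda> - {Some i}. full_weight W h (Some i) k * exp (u i + pin u k))
        = (\<Sum>k\<in>vertices \<Lambda> - {Some i}. c (Some i) k * exp (u i + pin u k))"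
      by (intro sum.cong) auto
    moreover have "W i j = c (Some i) (Some j)" if "i \<noteq> j"
      using cW [of "Some i" "Some j"] that ij by simp
    ultimately show "Dmat \<Lambda> W h u i j = lap \<Lambda> c u i j"
      by (cases "i = j") (simp_all add: Dmat_def lap_def)
  qed
  have split: "exp (- (a + b)) = exp (- a) * exp (- b)" for a b :: real
    by (simp flip: exp_add)
  have mu: "mu \<Lambda> W h = density (?P \<Otimes>\<^sub>M ?P) (\<lambda>(u, s). ennreal (\<delta> u s))"
    unfolding mu_def exponent det split \<delta>_def d_def ..
  have meas: "(\<lambda>p. \<delta> (fst p) (snd p)) \<in> borel_measurable (?P \<Otimes>\<^sub>M ?P)"
  proof -
    have fst: "(\<lambda>p. fst p i) \<in> borel_measurable (?P \<Otimes>\<^sub>M ?P)" and snd: "(\<lambda>p. snd p i) \<in> borel_measurable (?P \<Otimes>\<^sub>M ?P)"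
      if "i \<in> \<Lambda>" for i
      using that by measurable
    have tilt: "(\<lambda>p. tilt c (fst p) y z) \<in> borel_measurable (?P \<Otimes>\<^sub>M ?P)"
      if "y \<in> vertices \<Lambda>" "z \<in> vertices \<Lambda>" for y z
      unfolding tilt_def using that
      by (intro borel_measurable_times borel_measurable_const measurable_compose [OF _ borel_measurable_exp]
          borel_measurable_add pin_measurable [where V = \<Lambda>] fst)
    have "(\<lambda>p. d (fst p)) \<in> borel_measurable (?P \<Otimes>\<^sub>M ?P)"
      unfolding d_def by (intro borel_measurable_prod borel_measurable_divide measurable_compose [OF _ borel_measurable_exp]
         borel_measurable_uminus fst) auto
    then show ?thesis
      unfolding \<delta>_def
      by (intro borel_measurable_times measurable_compose [OF _ borel_measurable_exp] borel_measurable_uminus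
          energy_measurable det_lap_measurable quad_measurable tilt fst snd) auto
  qed
  have "(\<integral>\<^sup>+(u, s). f u \<partial>mu \<Lambda> W h) = (\<integral>\<^sup>+p. ennreal (\<delta> (fst p) (snd p)) * f (fst p) \<partial>(?P \<Otimes>\<^sub>M ?P))"
    unfolding mu case_prod_beta using meas f by (intro nn_integral_density) auto
  also have "\<dots> = (\<integral>\<^sup>+u. (\<integral>\<^sup>+s. ennreal (\<delta> u s) * f u \<partial>?P) \<partial>?P)"
    using P.nn_integral_fst [of "\<lambda>p. ennreal (\<delta> (fst p) (snd p)) * f (fst p)" ?P]
      borel_measurable_times_ennreal [OF measurable_compose [OF meas measurable_ennreal] measurable_compose [OF measurable_fst f]]
    by simp
  also have "\<dots> = expect \<Lambda> c f"
    unfolding expect_def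
  proof (rule nn_integral_cong)
    fix u
    define D where "D = det_lap \<Lambda> c u"
    have D: "D > 0" unfolding D_def using fin c by (rule det_lap_pos)
    have d: "d u \<ge> 0" unfolding d_def by (intro prod_nonneg) auto
    have qm: "(\<lambda>s. exp (- quad \<Lambda> (tilt c u) (pin s))) \<in> borel_measurable ?P"
      by (intro measurable_compose [OF _ borel_measurable_exp] borel_measurable_uminus quad_measurable) auto
    define K where "K = exp (- energy \<Lambda> c (pin u)) * D * d u"
    have "(\<integral>\<^sup>+s. ennreal (\<delta> u s) * f u \<partial>?P)
       = (\<integral>\<^sup>+s. ennreal K * f u * ennreal (exp (- quad \<Lambda> (tilt c u) (pin s))) \<partial>?P)"
    proof (rule nn_integral_cong)
      fix s
      have "\<delta> u s = K * exp (- quad \<Lambda> (tilt c u) (pin s))"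
        by (simp add: \<delta>_def K_def D_def)
      then show "ennreal (\<delta> u s) * f u = ennreal K * f u * ennreal (exp (- quad \<Lambda> (tilt c u) (pin s)))"
        by (simp add: ennreal_mult'' mult_ac)
    qed
    also have "\<dots> = ennreal K * f u * ennreal (sqrt ((2 * pi) ^ card \<Lambda> / D))"
      using nn_integral_exp_quad [OF fin c, of u] qm by (subst nn_integral_cmult) (auto simp: D_def)
    also have "\<dots> = ennreal (K * sqrt ((2 * pi) ^ card \<Lambda> / D)) * f u"
      using D by (simp add: ennreal_mult'' mult_ac)
    \<comment> \<open>The Gaussian integral turns \<open>D\<close> into
      \<open>D / sqrt D = sqrt D\<close>; its power of \<open>2 * pi\<close>, distributed over the
      vertices, turns each \<open>1 / (2 * pi)\<close> into
      \<open>1 / sqrt (2 * pi)\<close>.\<close>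
    also have "K * sqrt ((2 * pi) ^ card \<Lambda> / D) = dens \<Lambda> c u"
    proof -
      have "d u * sqrt (2 * pi) ^ card \<Lambda> = (\<Prod>i\<in>\<Lambda>. exp (- u i) / (2 * pi) * sqrt (2 * pi))"
        unfolding d_def prod.distrib by simp
      also have "\<dots> = (\<Prod>i\<in>\<Lambda>. exp (- u i) / sqrt (2 * pi))"
      proof (rule prod.cong [OF refl])
        fix i
        have "sqrt (2 * pi) * sqrt (2 * pi) = 2 * pi" by simp
        then show "exp (- u i) / (2 * pi) * sqrt (2 * pi) = exp (- u i) / sqrt (2 * pi)"
          by (simp add: divide_simps)
      qed
      finally have "d u * sqrt ((2 * pi) ^ card \<Lambda>) = (\<Prod>i\<in>\<Lambda>. exp (- u i) / sqrt (2 * pi))"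
        unfolding real_sqrt_power .
      moreover have "D / sqrt D = sqrt D" using D by (simp add: real_div_sqrt)
      moreover have "K * (sqrt ((2 * pi) ^ card \<Lambda>) / sqrt D)
          = exp (- energy \<Lambda> c (pin u)) * (D / sqrt D) * (d u * sqrt ((2 * pi) ^ card \<Lambda>))"
        by (simp add: K_def)
      ultimately show ?thesis
        unfolding dens_def D_def [symmetric] real_sqrt_divide by simp
    qed
    finally show "(\<integral>\<^sup>+s. ennreal (\<delta> u s) * f u \<partial>?P) = ennreal (dens \<Lambda> c u) * f u" .
  qed
  finally show ?thesis .
qed

section \<open>Merging two vertices\<close>

lemma expect_measurable:
  assumes "finite V" "\<And>y z. (\<lambda>p. C p y z) \<in> borel_measurable borel"
    and f: "f \<in> borel_measurable (\<Pi>\<^sub>M i\<in>V. lborel)"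
  shows "(\<lambda>p::real. expect V (C p) f) \<in> borel_measurable borel"
proof -
  interpret product_sigma_finite "\<lambda>_::'a. lborel :: real measure" by standard
  interpret V: sigma_finite_measure "\<Pi>\<^sub>M i\<in>V. (lborel :: real measure)"
    using assms(1) by (rule sigma_finite)
  have "(\<lambda>p. dens V (C (fst p)) (snd p)) \<in> borel_measurable (borel \<Otimes>\<^sub>M (\<Pi>\<^sub>M i\<in>V. lborel))"
  proof (rule dens_measurable)
    show "(\<lambda>p. C (fst p) y z) \<in> borel_measurable (borel \<Otimes>\<^sub>M (\<Pi>\<^sub>M i\<in>V. lborel))" for y z
      by (rule measurable_compose [OF measurable_fst assms(2)])
  qed measurable
  then have "(\<lambda>p. ennreal (dens V (C (fst p)) (snd p)) * f (snd p)) \<in> borel_measurable (borel \<Otimes>\<^sub>M (\<Pi>\<^sub>M i\<in>V. lborel))"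
    by (intro borel_measurable_times_ennreal measurable_compose [OF _ measurable_ennreal]
        measurable_compose [OF measurable_snd f])
  then show ?thesis
    unfolding expect_def by (intro V.borel_measurable_nn_integral) (simp add: case_prod_beta')
qed

text \<open>Let \<open>w\<close> be the common weights of \<open>x\<close> and \<open>y\<close>.
  After \<open>x\<close> is eliminated at rate \<open>exp a\<close>, the weights of \<open>y\<close>
  are still proportional to \<open>w\<close>, with factor \<open>1 + v * exp (- a)\<close>.
  Eliminating \<open>y\<close> as well therefore raises each remaining weight by
  \<open>w z * w z'\<close> times one scalar. A single vertex with weights \<open>2 * w\<close> does
  the same, and \<open>nn_integral_ig_pair\<close> says that the two scalars have the same
  law.\<close>

lemma expect_collapse:
  fixes c c' :: "'a option \<Rightarrow> 'a option \<Rightarrow> real"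
  assumes fin: "finite V" and x: "x \<notin> V" and y: "y \<notin> V" and xy: "x \<noteq> y"
    and c: "pos_kernel c" and c': "pos_kernel c'"
    and same: "\<And>z. z \<in> vertices V \<Longrightarrow> c (Some y) z = c (Some x) z"
    and c'x: "\<And>z. z \<in> vertices V \<Longrightarrow> c' (Some x) z = 2 * c (Some x) z"
    and c'V: "\<And>z z'. z \<in> vertices V \<Longrightarrow> z' \<in> vertices V \<Longrightarrow> z \<noteq> z' \<Longrightarrow> c' z z' = c z z'"
    and i: "i \<in> V" and g [measurable]: "g \<in> borel_measurable borel"
  shows "expect (insert x (insert y V)) c (\<lambda>u. g (u i)) = expect (insert x V) c' (\<lambda>u. g (u i))"
proof -
  let ?f = "\<lambda>u. g (u i)"
  define v where "v = c (Some x) (Some y)"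
  define s where "s = (\<Sum>z\<in>vertices V. c (Some x) z)"
  \<comment> \<open>The expectation over the remaining vertices as a function of the scalar
    \<open>G\<close>; it is common to both sides of the claim.\<close>
  define \<Psi> where "\<Psi> G = expect V (\<lambda>z z'. c z z' + c z (Some x) * c (Some x) z' * G) ?f" for G :: real
  have v: "v > 0" using c by (simp add: v_def pos_kernelD)
  have meas: "?f \<in> borel_measurable (\<Pi>\<^sub>M i\<in>A. lborel)" if "V \<subseteq> A" for A
  proof -
    have "i \<in> A" using i that by auto
    then show ?thesis by measurable
  qed
  have \<Psi>: "\<Psi> \<in> borel_measurable borel"
    unfolding \<Psi>_def using fin meas [of V] by (intro expect_measurable) auto
  have upd: "?f (u(x := r)) = ?f u" "?f (u(y := r)) = ?f u" for u r
    using i x y by auto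
  have elim_y: "elim c (Some x) (exp a) (Some y) z = c (Some x) z * (1 + v * exp (- a))" if "z \<in> vertices V" for a z
    using same [OF that] pos_kernelD(2) [OF c, of "Some y" "Some x"]
    by (simp add: elim_def v_def exp_minus field_simps)
  have inner: "expect (insert y V) (elim c (Some x) (exp a)) ?f
    = (\<integral>\<^sup>+b. ennreal (ig_log (s * (1 + v * exp (- a))) b)
        * \<Psi> (exp (- a) + (1 + v * exp (- a))\<^sup>2 * exp (- b)) \<partial>lborel)" for a
  proof -
    define c1 where "c1 = elim c (Some x) (exp a)"
    have c1: "pos_kernel c1" unfolding c1_def by (intro pos_kernel_elim c) auto
    have c1y: "c1 (Some y) z = c (Some x) z * (1 + v * exp (- a))"
      "c1 z (Some y) = c (Some x) z * (1 + v * exp (- a))" if "z \<in> vertices V" for z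
      using elim_y [OF that] pos_kernelD(2) [OF c1, of z "Some y"] by (simp_all add: c1_def)
    have \<Psi>_eq: "expect V (elim c1 (Some y) (exp b)) ?f = \<Psi> (exp (- a) + (1 + v * exp (- a))\<^sup>2 * exp (- b))" for b
      unfolding \<Psi>_def
    proof (rule expect_cong)
      fix z z' assume z: "z \<in> vertices V" "z' \<in> vertices V"
      have "c1 z z' = c z z' + c z (Some x) * c (Some x) z' * exp (- a)"
        by (simp add: c1_def elim_def exp_minus divide_inverse)
      then show "elim c1 (Some y) (exp b) z z'
        = c z z' + c z (Some x) * c (Some x) z' * (exp (- a) + (1 + v * exp (- a))\<^sup>2 * exp (- b))"
        using pos_kernelD(2) [OF c, of z "Some x"]
        by (simp add: elim_def [of c1] c1y z exp_minus [of b] divide_inverse power2_eq_square algebra_simps)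
    qed
    have "expect (insert y V) c1 ?f = (\<integral>\<^sup>+b. ennreal (ig_log (\<Sum>k\<in>vertices V. c1 (Some y) k) b)
        * expect V (elim c1 (Some y) (exp b)) ?f \<partial>lborel)"
      using fin y c1 upd by (intro expect_insert meas) auto
    also have "(\<Sum>k\<in>vertices V. c1 (Some y) k) = s * (1 + v * exp (- a))"
      unfolding s_def sum_distrib_right by (intro sum.cong refl c1y)
    finally show ?thesis unfolding \<Psi>_eq unfolding c1_def .
  qed
  have "expect (insert x (insert y V)) c ?f
    = (\<integral>\<^sup>+a. ennreal (ig_log (\<Sum>k\<in>vertices (insert y V). c (Some x) k) a) * expect (insert y V) (elim c (Some x) (exp a)) ?f \<partial>lborel)"
    using fin x y xy c upd by (intro expect_insert meas) auto
  also have "(\<Sum>k\<in>vertices (insert y V). c (Some x) k) = v + s"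
    using fin y by (simp add: vertices_insert v_def s_def)
  also have "(\<integral>\<^sup>+a. ennreal (ig_log (v + s) a) * expect (insert y V) (elim c (Some x) (exp a)) ?f \<partial>lborel)
    = (\<integral>\<^sup>+z. ennreal (ig_log (2 * s) z) * \<Psi> (4 * exp (- z)) \<partial>lborel)"
    unfolding inner by (rule nn_integral_ig_pair [OF v \<Psi>])
  also have "\<dots> = expect (insert x V) c' ?f"
  proof -
    have "expect (insert x V) c' ?f
      = (\<integral>\<^sup>+a. ennreal (ig_log (\<Sum>k\<in>vertices V. c' (Some x) k) a) * expect V (elim c' (Some x) (exp a)) ?f \<partial>lborel)"
      using fin x c' upd by (intro expect_insert meas) auto
    moreover have "(\<Sum>k\<in>vertices V. c' (Some x) k) = 2 * s"
      unfolding s_def sum_distrib_left by (intro sum.cong refl c'x)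
    moreover have "expect V (elim c' (Some x) (exp a)) ?f = \<Psi> (4 * exp (- a))" for a
      unfolding \<Psi>_def
    proof (rule expect_cong)
      fix z z' assume z: "z \<in> vertices V" "z' \<in> vertices V" "z \<noteq> z'"
      show "elim c' (Some x) (exp a) z z' = c z z' + c z (Some x) * c (Some x) z' * (4 * exp (- a))"
        using pos_kernelD(2) [OF c, of z "Some x"] pos_kernelD(2) [OF c', of z "Some x"]
        by (simp add: elim_def c'x z c'V exp_minus divide_inverse)
    qed
    ultimately show ?thesis by simp
  qed
  finally show ?thesis .
qed

section \<open>Exponential moments along a path\<close>

lemma det_lap_singleton: "det_lap {i} c u = c (Some i) None * exp (u i)"
proof -
  have "vertices {i} - {Some i} = {None}" by (auto simp: vertices_def)
  then show ?thesis
    using det_on_zero_column [of "{}" i "lap {i} c u"]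
    by (simp add: det_lap_def lap_def det_on_def [of "{}"])
qed

text \<open>The three summands are the spanning trees of the triangle on \<open>i\<close>,
  \<open>j\<close> and \<rho>, as in the matrix-tree theorem. Together with the singleton it is the
  base of the edge comparison.\<close>

lemma det_lap_doubleton:
  assumes "i \<noteq> j" "pos_kernel c"
  shows "det_lap {i, j} c u = exp (u i) * exp (u j) * (c (Some i) None * c (Some j) None
    + c (Some i) (Some j) * (exp (u j) * c (Some j) None + exp (u i) * c (Some i) None))"
proof -
  define t where "t = elim_rate {j} c i u"
  have t: "t > 0" unfolding t_def using assms by (intro elim_rate_pos) auto
  have "vertices {j} = {None, Some j}" by (auto simp: vertices_def)
  then have et: "exp (u i) * t = c (Some i) None + c (Some i) (Some j) * exp (u j)"
    unfolding t_def elim_rate_def by (simp add: exp_minus)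
  have e2: "exp (2 * u i) = exp (u i) * exp (u i)" by (simp flip: exp_add)
  have "det_lap {i, j} c u = exp (2 * u i) * t * det_lap {j} (elim c (Some i) t) u"
    unfolding t_def using assms by (intro det_lap_insert') auto
  also have "\<dots> = exp (u i) * exp (u j) * (exp (u i) * t * c (Some j) None + exp (u i) * (c (Some j) (Some i) * c (Some i) None))"
    unfolding e2 det_lap_singleton elim_def using t by (simp add: field_simps)
  also have "\<dots> = exp (u i) * exp (u j) * (c (Some i) None * c (Some j) None
    + c (Some i) (Some j) * (exp (u j) * c (Some j) None + exp (u i) * c (Some i) None))"
    unfolding et using pos_kernelD(2) [OF assms(2), of "Some j" "Some i"] by (simp add: algebra_simps)
  finally show ?thesis .
qed

text \<open>
  Eliminating a vertex off the edge adds the same nonnegative constant to both weights of the edge,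
  which reduces the claim to the one or two endpoints in \<open>\<Lambda>\<close>.
\<close>

lemma det_lap_edge:
  assumes "finite V" "pos_kernel c" "pos_kernel c'" "y \<noteq> z" "y \<in> vertices V" "z \<in> vertices V"
    and "\<And>p q. {p, q} \<noteq> {y, z} \<Longrightarrow> c' p q = c p q"
    and "c' y z \<ge> l * c y z" and l: "0 \<le> l" "l \<le> 1"
  shows "det_lap V c' u \<ge> l * det_lap V c u"
  using assms(1-8)
proof (induction V arbitrary: c c' rule: finite_psubset_induct)
  case (psubset V)
  note c = psubset.prems(1) and c' = psubset.prems(2)
  show ?case
  proof (cases "\<exists>x\<in>V. Some x \<notin> {y, z}")
    case True
    then obtain x where x: "x \<in> V" "Some x \<notin> {y, z}" by auto
    define V0 where "V0 = V - {x}"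
    have V: "V = insert x V0" "x \<notin> V0" "finite V0" "V0 \<subset> V"
      using x psubset.hyps by (auto simp: V0_def)
    define t where "t = elim_rate V0 c x u"
    have t: "t > 0" unfolding t_def using V c by (intro elim_rate_pos) auto
    have eqx: "c' (Some x) k = c (Some x) k" "c' k (Some x) = c k (Some x)" for k
      using x by (intro psubset.prems(6); auto simp: doubleton_eq_iff)+
    have t': "elim_rate V0 c' x u = t" unfolding t_def elim_rate_def eqx ..
    have "l * det_lap V0 (elim c (Some x) t) u \<le> det_lap V0 (elim c' (Some x) t) u"
    proof (rule psubset.IH)
      show "V0 \<subset> V" by fact
      show "pos_kernel (elim c (Some x) t)" "pos_kernel (elim c' (Some x) t)"
        using c c' t by (auto intro: pos_kernel_elim)
      show "y \<noteq> z" by fact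
      show "y \<in> vertices V0" "z \<in> vertices V0"
        using psubset.prems(4,5) x unfolding V(1) vertices_insert by auto
      show "elim c' (Some x) t p q = elim c (Some x) t p q" if "{p, q} \<noteq> {y, z}" for p q
        unfolding elim_def eqx using psubset.prems(6) [OF that] by simp
      define K where "K = c y (Some x) * c (Some x) z / t"
      have "K \<ge> 0" unfolding K_def using c t pos_kernelD(1) [OF c] by (simp add: less_imp_le)
      then have "l * K \<le> K" using l by (simp add: mult_left_le_one_le)
      then show "l * elim c (Some x) t y z \<le> elim c' (Some x) t y z"
        unfolding elim_def eqx K_def [symmetric] using psubset.prems(7) by (simp add: algebra_simps)
    qed
    then have "exp (2 * u x) * t * (l * det_lap V0 (elim c (Some x) t) u)
      \<le> exp (2 * u x) * t * det_lap V0 (elim c' (Some x) t) u"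
      using t by (intro mult_left_mono) auto
    then show ?thesis
      using det_lap_insert' [of V0 x c u] det_lap_insert' [of V0 x c' u] V c c'
      by (simp add: t' t_def [symmetric] mult_ac)
  next
    case False
    have pos: "c p q \<ge> 0" "c' p q \<ge> 0" for p q
      using c c' by (auto simp: pos_kernelD less_imp_le)
    have single: ?thesis if "{y, z} = {Some i, None}" for i
    proof -
      have "{y, z} \<subseteq> vertices V" using psubset.prems(4,5) by simp
      then have "i \<in> V" unfolding that by simp
      moreover have "x = i" if "x \<in> V" for x
        using False \<open>{y, z} = {Some i, None}\<close> that by (metis insert_iff option.distinct(1) option.inject singletonD)
      ultimately have V: "V = {i}" by blast
      have "l * c (Some i) None \<le> c' (Some i) None"
      proof (cases "y = None")
        case True
        then have "z = Some i" using that by (metis doubleton_eq_iff option.distinct(1))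
        then show ?thesis
          using psubset.prems(7) True pos_kernelD(2) [OF c, of None "Some i"]
            pos_kernelD(2) [OF c', of None "Some i"] by simp
      next
        case False
        then have "y = Some i" "z = None" using that by (metis doubleton_eq_iff)+
        then show ?thesis using psubset.prems(7) by simp
      qed
      then show ?thesis
        unfolding V det_lap_singleton by (simp add: mult.assoc [symmetric] mult_right_mono)
    qed
    have single': ?thesis if "{y, z} = {None, Some i}" for i
      using single [of i] that by (simp add: insert_commute)
    show ?thesis
    proof (cases y; cases z)
      fix i j assume yz: "y = Some i" "z = Some j"
      have V: "V = {i, j}" "i \<noteq> j" using False psubset.prems(3-5) yz by auto
      define P R where "P = c (Some i) None * c (Some j) None"
        and "R = exp (u j) * c (Some j) None + exp (u i) * c (Some i) None"
      have PR: "P \<ge> 0" "R \<ge> 0" unfolding P_def R_def using pos by auto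
      have eq: "c' (Some i) None = c (Some i) None" "c' (Some j) None = c (Some j) None"
        using yz by (intro psubset.prems(6); auto simp: doubleton_eq_iff)+
      have "l * P \<le> P" using PR l by (simp add: mult_left_le_one_le)
      moreover have "l * c (Some i) (Some j) * R \<le> c' (Some i) (Some j) * R"
        using psubset.prems(7) PR yz by (intro mult_right_mono) auto
      ultimately have "l * (P + c (Some i) (Some j) * R) \<le> P + c' (Some i) (Some j) * R"
        by (simp add: algebra_simps)
      then have "exp (u i) * exp (u j) * (l * (P + c (Some i) (Some j) * R))
        \<le> exp (u i) * exp (u j) * (P + c' (Some i) (Some j) * R)"
        by (intro mult_left_mono) auto
      then show ?thesis
        unfolding V(1) det_lap_doubleton [OF V(2) c] det_lap_doubleton [OF V(2) c'] eq
          P_def [symmetric] R_def [symmetric]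
        by (simp add: mult_ac)
    qed (use single single' psubset.prems(3) in auto)
  qed
qed

text \<open>Lowering the weight by \<open>m\<close> lowers the energy by exactly the exponent on the
  left, so the exponential is absorbed completely. The price is paid by the determinant, at most a
  factor \<open>1 - m / c y z\<close>, of which the density sees the square root.\<close>

lemma dens_edge:
  assumes "finite V" "pos_kernel c" "y \<noteq> z" "y \<in> vertices V" "z \<in> vertices V"
    and m: "0 \<le> m" "m < c y z"
  defines "c' \<equiv> \<lambda>p q. if {p, q} = {y, z} then c p q - m else c p q"
  shows "pos_kernel c'"
    and "exp (m * (cosh (pin u y - pin u z) - 1)) * dens V c u \<le> dens V c' u / sqrt (1 - m / c y z)"
proof -
  have cpos: "c y z > 0" and csym: "c z y = c y z" using assms(2) by (auto simp: pos_kernelD)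
  show c': "pos_kernel c'"
    using assms(2) m csym unfolding pos_kernel_def c'_def
    by (auto simp: insert_commute doubleton_eq_iff)
  have "(\<Sum>p\<in>vertices V. \<Sum>q\<in>vertices V. c p q * (cosh (pin u p - pin u q) - 1))
     = (\<Sum>p\<in>vertices V. \<Sum>q\<in>vertices V. c' p q * (cosh (pin u p - pin u q) - 1))
       + (\<Sum>p\<in>vertices V. \<Sum>q\<in>vertices V. if {p, q} = {y, z} then m * (cosh (pin u y - pin u z) - 1) else 0)"
    unfolding sum.distrib [symmetric]
  proof (intro sum.cong refl)
    fix p q
    have "cosh (pin u z - pin u y) = cosh (pin u y - pin u z)"
      by (metis cosh_minus minus_diff_eq)
    then show "c p q * (cosh (pin u p - pin u q) - 1) = c' p q * (cosh (pin u p - pin u q) - 1)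
       + (if {p, q} = {y, z} then m * (cosh (pin u y - pin u z) - 1) else 0)"
      by (auto simp: c'_def doubleton_eq_iff algebra_simps)
  qed
  \<comment> \<open>The edge is met in both orders; the factor 2 cancels against the 1/2 in
    \<open>energy\<close>.\<close>
  also have "(\<Sum>p\<in>vertices V. \<Sum>q\<in>vertices V. if {p, q} = {y, z} then m * (cosh (pin u y - pin u z) - 1) else 0)
     = 2 * (m * (cosh (pin u y - pin u z) - 1))"
  proof -
    define K where "K = m * (cosh (pin u y - pin u z) - 1)"
    have "(\<Sum>q\<in>vertices V. if {p, q} = {y, z} then K else 0) = (if p = y then K else 0) + (if p = z then K else 0)" for p
    proof -
      have "(\<Sum>q\<in>vertices V. if {p, q} = {y, z} then K else 0)
        = (\<Sum>q\<in>vertices V. (if q = z then if p = y then K else 0 else 0) + (if q = y then if p = z then K else 0 else 0))"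
        using assms(3) by (intro sum.cong) (auto simp: doubleton_eq_iff)
      then show ?thesis using assms by (simp add: sum.distrib)
    qed
    then show ?thesis unfolding K_def [symmetric] using assms by (simp add: sum.distrib)
  qed
  finally have en: "energy V c (pin u) = energy V c' (pin u) + m * (cosh (pin u y - pin u z) - 1)"
    unfolding energy_def by (simp add: field_simps)
  define l where "l = 1 - m / c y z"
  have l: "l > 0" "l \<le> 1" using m cpos by (auto simp: l_def)
  have "l * det_lap V c u \<le> det_lap V c' u"
  proof (rule det_lap_edge [OF assms(1,2) c' assms(3-5)])
    show "l * c y z \<le> c' y z" using cpos by (simp add: l_def c'_def field_simps)
  qed (use l in \<open>auto simp: c'_def\<close>)
  then have "sqrt (l * det_lap V c u) \<le> sqrt (det_lap V c' u)" by simp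
  then have det: "sqrt (det_lap V c u) \<le> sqrt (det_lap V c' u) / sqrt l"
    using l by (simp add: real_sqrt_mult field_simps)
  define p where "p = (\<Prod>i\<in>V. exp (- u i) / sqrt (2 * pi))"
  have p: "p \<ge> 0" unfolding p_def by (intro prod_nonneg) auto
  have "exp (m * (cosh (pin u y - pin u z) - 1)) * dens V c u
    = (exp (m * (cosh (pin u y - pin u z) - 1)) * exp (- energy V c (pin u))) * sqrt (det_lap V c u) * p"
    by (simp add: dens_def p_def)
  also have "exp (m * (cosh (pin u y - pin u z) - 1)) * exp (- energy V c (pin u)) = exp (- energy V c' (pin u))"
    unfolding exp_add [symmetric] en by simp
  also have "exp (- energy V c' (pin u)) * sqrt (det_lap V c u) * p
    \<le> exp (- energy V c' (pin u)) * (sqrt (det_lap V c' u) / sqrt l) * p"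
    using det p by (intro mult_right_mono mult_left_mono) auto
  also have "\<dots> = dens V c' u / sqrt l" by (simp add: dens_def p_def)
  finally show "exp (m * (cosh (pin u y - pin u z) - 1)) * dens V c u \<le> dens V c' u / sqrt (1 - m / c y z)"
    unfolding l_def .
qed

section \<open>Comparison of cosh with quadratic functions, and moments along a path\<close>

lemma cosh_ge_quadratic: "1 + x\<^sup>2 / 2 \<le> cosh (x::real)"
proof -
  have "\<bar>x / 2\<bar> \<le> \<bar>sinh (x / 2)\<bar>"
    using real_le_abs_sinh [of "x / 2"] by (simp add: sinh_field_def exp_minus)
  then have "(x / 2)\<^sup>2 \<le> (sinh (x / 2))\<^sup>2" by (rule abs_le_square_iff [THEN iffD1])
  moreover have "cosh x = 1 + 2 * (sinh (x / 2))\<^sup>2"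
    using cosh_double [of "x / 2"] by (simp add: cosh_square_eq)
  ultimately show ?thesis by (simp add: power_divide)
qed

text \<open>On the nonnegative half-line \<open>y^2 / 2 - ln (cosh y)\<close> has derivative
  \<open>y - tanh y\<close>, which is nonnegative because \<open>sinh z \<le> z * cosh z\<close>;
  evenness covers negative arguments.\<close>

lemma cosh_le_exp_half_square: "cosh (x::real) \<le> exp (x\<^sup>2 / 2)"
proof -
  have *: "cosh y \<le> exp (y\<^sup>2 / 2)" if y: "y \<ge> 0" for y :: real
  proof -
    have sinh_le: "sinh z \<le> z * cosh z" if "z \<ge> 0" for z :: real
    proof -
      have "0 * cosh 0 - sinh 0 \<le> z * cosh z - sinh (z::real)"
        by (rule DERIV_nonneg_imp_nondecreasing [OF that])
           (auto intro!: exI derivative_eq_intros)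
      then show ?thesis by simp
    qed
    have "0\<^sup>2 / 2 - ln (cosh 0) \<le> y\<^sup>2 / 2 - ln (cosh (y::real))"
    proof (rule DERIV_nonneg_imp_nondecreasing [OF y])
      fix z :: real assume z: "0 \<le> z" "z \<le> y"
      have c: "cosh z > 0" by (rule cosh_real_pos)
      have "((\<lambda>y. y\<^sup>2 / 2 - ln (cosh y)) has_real_derivative z - sinh z / cosh z) (at z)"
        by (rule derivative_eq_intros refl c | simp)+
      moreover have "0 \<le> z - sinh z / cosh z"
        using sinh_le [OF z(1)] c by (simp add: field_simps)
      ultimately show "\<exists>d. ((\<lambda>y. y\<^sup>2 / 2 - ln (cosh y)) has_real_derivative d) (at z) \<and> 0 \<le> d"
        by blast
    qed
    then have "ln (cosh y) \<le> y\<^sup>2 / 2" by simp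
    then have "exp (ln (cosh y)) \<le> exp (y\<^sup>2 / 2)" by (simp only: exp_le_cancel_iff)
    then show ?thesis by (simp only: exp_ln [OF cosh_real_pos])
  qed
  show ?thesis using * [of x] * [of "- x"] by (cases "x \<ge> 0") auto
qed

text \<open>\<open>dens_edge\<close> applied to the first \<open>k\<close> edges in turn. The kernel
  changes at each step, hence the existential. Injectivity of \<open>p\<close> makes the edges
  distinct, so those still to come keep their original weights and the loss at each step is measured
  against \<open>c\<close>.\<close>

lemma dens_path:
  assumes fin: "finite V" and c: "pos_kernel c" and inj: "inj_on p {..n}"
    and p: "\<And>r. r \<le> n \<Longrightarrow> p r \<in> vertices V"
    and m: "\<And>r. r < n \<Longrightarrow> 0 \<le> m r" "\<And>r. r < n \<Longrightarrow> m r < c (p r) (p (Suc r))"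
  shows "k \<le> n \<Longrightarrow> \<exists>c'. pos_kernel c' \<and> (\<forall>r. k \<le> r \<and> r < n \<longrightarrow> c' (p r) (p (Suc r)) = c (p r) (p (Suc r)))
    \<and> (\<forall>u. exp (\<Sum>r<k. m r * (cosh (pin u (p r) - pin u (p (Suc r))) - 1)) * dens V c u
          \<le> (\<Prod>r<k. 1 / sqrt (1 - m r / c (p r) (p (Suc r)))) * dens V c' u)"
proof (induction k)
  case 0
  then show ?case using c by (intro exI [of _ c]) auto
next
  case (Suc k)
  then obtain c' where c': "pos_kernel c'" "\<And>r. k \<le> r \<Longrightarrow> r < n \<Longrightarrow> c' (p r) (p (Suc r)) = c (p r) (p (Suc r))"
    and IH: "\<And>u. exp (\<Sum>r<k. m r * (cosh (pin u (p r) - pin u (p (Suc r))) - 1)) * dens V c u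
          \<le> (\<Prod>r<k. 1 / sqrt (1 - m r / c (p r) (p (Suc r)))) * dens V c' u" by auto
  have k: "k < n" using Suc.prems by simp
  have eq: "p r = p s \<longleftrightarrow> r = s" if "r \<le> n" "s \<le> n" for r s
    using inj that by (auto simp: inj_on_def)
  define c'' where "c'' = (\<lambda>y z. if {y, z} = {p k, p (Suc k)} then c' y z - m k else c' y z)"
  have ck: "c' (p k) (p (Suc k)) = c (p k) (p (Suc k))" using c'(2) k by simp
  have ne: "p k \<noteq> p (Suc k)" using eq [of k "Suc k"] k by simp
  have edge: "pos_kernel c''"
    "exp (m k * (cosh (pin u (p k) - pin u (p (Suc k))) - 1)) * dens V c' u
      \<le> dens V c'' u / sqrt (1 - m k / c (p k) (p (Suc k)))" for u
    unfolding c''_def using dens_edge(1) [OF fin c'(1) ne, of "m k"] dens_edge(2) [OF fin c'(1) ne, of "m k" u]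
      p [of k] p [of "Suc k"] m [of k] k ck
    by auto
  show ?case
  proof (intro exI [of _ c''] conjI allI impI)
    show "pos_kernel c''" by (rule edge(1))
    show "c'' (p r) (p (Suc r)) = c (p r) (p (Suc r))" if "Suc k \<le> r \<and> r < n" for r
      using that c'(2) [of r] eq k by (auto simp: c''_def doubleton_eq_iff)
    fix u
    let ?E = "\<lambda>r. m r * (cosh (pin u (p r) - pin u (p (Suc r))) - 1)"
    let ?C = "\<Prod>r<k. 1 / sqrt (1 - m r / c (p r) (p (Suc r)))"
    have C: "?C \<ge> 0"
    proof (intro prod_nonneg ballI)
      fix r assume "r \<in> {..<k}"
      then have "m r < c (p r) (p (Suc r))" using m k by auto
      then have "m r / c (p r) (p (Suc r)) < 1" using pos_kernelD(1) [OF c] by simp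
      then show "0 \<le> 1 / sqrt (1 - m r / c (p r) (p (Suc r)))" by simp
    qed
    have "exp (\<Sum>r<Suc k. ?E r) * dens V c u = exp (?E k) * (exp (\<Sum>r<k. ?E r) * dens V c u)"
      by (simp add: exp_add mult_ac)
    also have "\<dots> \<le> exp (?E k) * (?C * dens V c' u)"
      by (intro mult_left_mono IH) auto
    also have "\<dots> = ?C * (exp (?E k) * dens V c' u)" by simp
    also have "\<dots> \<le> ?C * (dens V c'' u / sqrt (1 - m k / c (p k) (p (Suc k))))"
      by (intro mult_left_mono edge C)
    finally show "exp (\<Sum>r<Suc k. ?E r) * dens V c u
      \<le> (\<Prod>r<Suc k. 1 / sqrt (1 - m r / c (p r) (p (Suc r)))) * dens V c'' u"
      by (simp add: mult_ac)
  qed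
qed

text \<open>By the Weierstrass inequality the product of the factors \<open>1 - x r\<close> is at
  least one minus the sum of the \<open>x r\<close>, so only the total relative reduction matters.
  The density that remains belongs to another positive kernel and has mass one.\<close>

lemma expect_exp_path:
  assumes fin: "finite V" and c: "pos_kernel c" and inj: "inj_on p {..n}"
    and p: "\<And>r. r \<le> n \<Longrightarrow> p r \<in> vertices V"
    and m: "\<And>r. r < n \<Longrightarrow> 0 \<le> m r" and X: "(\<Sum>r<n. m r / c (p r) (p (Suc r))) \<le> X" "X < 1"
  shows "expect V c (\<lambda>u. ennreal (exp (\<Sum>r<n. m r * (cosh (pin u (p r) - pin u (p (Suc r))) - 1))))
    \<le> ennreal (1 / sqrt (1 - X))"
proof -
  define x where "x r = m r / c (p r) (p (Suc r))" for r
  have cpos: "c y z > 0" for y z using c by (rule pos_kernelD)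
  have x0: "0 \<le> x r" if "r < n" for r using m [OF that] cpos by (simp add: x_def less_imp_le)
  have x1: "x r < 1" if "r < n" for r
  proof -
    have "x r \<le> (\<Sum>r<n. x r)" using that x0 by (intro member_le_sum) auto
    then show ?thesis using X by (simp add: x_def)
  qed
  then have m1: "m r < c (p r) (p (Suc r))" if "r < n" for r
    using x1 [OF that] cpos [of "p r" "p (Suc r)"] by (simp add: x_def)
  obtain c' where c': "pos_kernel c'"
    and le: "\<And>u. exp (\<Sum>r<n. m r * (cosh (pin u (p r) - pin u (p (Suc r))) - 1)) * dens V c u
          \<le> (\<Prod>r<n. 1 / sqrt (1 - x r)) * dens V c' u"
    using dens_path [OF fin c inj p m m1, of n] unfolding x_def by auto
  have "1 - X \<le> 1 - (\<Sum>r<n. x r)" using X by (simp add: x_def)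
  also have "\<dots> \<le> (\<Prod>r<n. 1 - x r)"
    using x0 x1 by (intro Weierstrass_prod_ineq) (auto simp: less_imp_le)
  finally have "1 / sqrt (\<Prod>r<n. 1 - x r) \<le> 1 / sqrt (1 - X)"
    using X by (intro divide_left_mono) (auto intro!: mult_pos_pos)
  moreover have "(\<Prod>r<k. 1 / sqrt (1 - x r)) = 1 / sqrt (\<Prod>r<k. 1 - x r)" for k
    by (induction k) (simp_all add: real_sqrt_mult)
  ultimately have C: "(\<Prod>r<n. 1 / sqrt (1 - x r)) \<le> 1 / sqrt (1 - X)" by simp
  have "expect V c (\<lambda>u. ennreal (exp (\<Sum>r<n. m r * (cosh (pin u (p r) - pin u (p (Suc r))) - 1))))
    \<le> (\<integral>\<^sup>+u. ennreal (1 / sqrt (1 - X)) * ennreal (dens V c' u) \<partial>(\<Pi>\<^sub>M i\<in>V. lborel))"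
    unfolding expect_def
  proof (rule nn_integral_mono)
    fix u
    have d: "dens V c u \<ge> 0" "dens V c' u \<ge> 0" using fin c c' by (auto intro: dens_nonneg)
    have "exp (\<Sum>r<n. m r * (cosh (pin u (p r) - pin u (p (Suc r))) - 1)) * dens V c u
        \<le> 1 / sqrt (1 - X) * dens V c' u"
      using le [of u] mult_right_mono [OF C d(2)] by linarith
    then show "ennreal (dens V c u) * ennreal (exp (\<Sum>r<n. m r * (cosh (pin u (p r) - pin u (p (Suc r))) - 1)))
      \<le> ennreal (1 / sqrt (1 - X)) * ennreal (dens V c' u)"
      using d X by (simp add: ennreal_mult' [symmetric] mult_ac ennreal_leI)
  qed
  also have "\<dots> = ennreal (1 / sqrt (1 - X)) * expect V c' (\<lambda>_. 1)"
  proof -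
    have "(\<lambda>u. dens V c' u) \<in> borel_measurable (\<Pi>\<^sub>M i\<in>V. lborel)"
      by (intro dens_measurable) measurable
    then show ?thesis unfolding expect_def by (subst nn_integral_cmult [symmetric]) auto
  qed
  finally show ?thesis using expect_one [OF fin c'] by simp
qed

text \<open>The exponents \<open>M r = m * Q / q r\<close> are those produced by Cauchy-Schwarz with
  weights \<open>q r\<close>. Against a weight of at least \<open>W / (q r)^2\<close> they cost the
  fraction \<open>m * Q / W * q r\<close>, which sums to at most \<open>Q^2 * m / W\<close>.\<close>

lemma expect_cosh_powr:
  fixes q :: "nat \<Rightarrow> real"
  assumes fin: "finite V" and c: "pos_kernel c" and inj: "inj_on p {..n}"
    and p: "\<And>r. r \<le> n \<Longrightarrow> p r \<in> vertices V" "p 0 = Some i" "p n = None"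
    and W: "W > 0" and q: "\<And>r. r < n \<Longrightarrow> q r > 0" "(\<Sum>r<n. q r) \<le> Q"
    and cW: "\<And>r. r < n \<Longrightarrow> W / (q r)\<^sup>2 \<le> c (p r) (p (Suc r))"
    and m: "0 \<le> m" "Q\<^sup>2 * m / W < 1"
  shows "expect V c (\<lambda>u. ennreal (cosh (u i) powr m)) \<le> ennreal (1 / sqrt (1 - Q\<^sup>2 * m / W))"
proof -
  have "0 \<le> (\<Sum>r<n. q r)" using q(1) by (intro sum_nonneg) (auto simp: less_imp_le)
  with q(2) have Q: "Q \<ge> 0" by linarith
  have q0: "q r \<noteq> 0" if "r < n" for r using q(1) [OF that] by simp
  define M where "M r = m * Q / q r" for r
  have le: "cosh (u i) powr m \<le> exp (\<Sum>r<n. M r * (cosh (pin u (p r) - pin u (p (Suc r))) - 1))" for u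
  proof -
    define x where "x r = pin u (p r) - pin u (p (Suc r))" for r
    \<comment> \<open>Telescoping from \<open>p 0 = Some i\<close> to \<open>p n = None\<close>,
      where \<open>pin\<close> vanishes.\<close>
    have "u i = (\<Sum>r<n. x r)"
      unfolding x_def using sum_lessThan_telescope' [of "\<lambda>r. pin u (p r)" n] p by simp
    also have "\<dots> = (\<Sum>r<n. sqrt (q r) * (x r / sqrt (q r)))"
      using q0 by (intro sum.cong) auto
    finally have "(u i)\<^sup>2 \<le> (\<Sum>r<n. (sqrt (q r))\<^sup>2) * (\<Sum>r<n. (x r / sqrt (q r))\<^sup>2)"
      by (simp only: Cauchy_Schwarz_ineq_sum)
    also have "(\<Sum>r<n. (sqrt (q r))\<^sup>2) = (\<Sum>r<n. q r)"
      using q(1) by (intro sum.cong) (auto simp: less_imp_le)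
    also have "(\<Sum>r<n. (x r / sqrt (q r))\<^sup>2) = (\<Sum>r<n. (x r)\<^sup>2 / q r)"
      using q(1) by (intro sum.cong) (auto simp: power_divide less_imp_le)
    also have "(\<Sum>r<n. q r) * (\<Sum>r<n. (x r)\<^sup>2 / q r) \<le> Q * (\<Sum>r<n. (x r)\<^sup>2 / q r)"
      using q by (intro mult_right_mono sum_nonneg) (auto simp: less_imp_le)
    finally have "m * ((u i)\<^sup>2 / 2) \<le> m * (Q * (\<Sum>r<n. (x r)\<^sup>2 / q r) / 2)"
      using m by (intro mult_left_mono) auto
    also have "\<dots> = (\<Sum>r<n. M r * ((x r)\<^sup>2 / 2))"
      unfolding M_def by (simp add: sum_distrib_left sum_divide_distrib mult_ac)
    also have "\<dots> \<le> (\<Sum>r<n. M r * (cosh (x r) - 1))"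
    proof (intro sum_mono mult_left_mono)
      show "(x r)\<^sup>2 / 2 \<le> cosh (x r) - 1" for r using cosh_ge_quadratic [of "x r"] by simp
      show "0 \<le> M r" if "r \<in> {..<n}" for r
        unfolding M_def using m Q q(1) [of r] that by (simp add: less_imp_le)
    qed
    finally have e: "m * ((u i)\<^sup>2 / 2) \<le> (\<Sum>r<n. M r * (cosh (x r) - 1))" .
    have "cosh (u i) powr m \<le> exp ((u i)\<^sup>2 / 2) powr m"
      using m cosh_le_exp_half_square cosh_real_nonneg by (intro powr_mono2) auto
    also have "\<dots> = exp (m * ((u i)\<^sup>2 / 2))" by (simp add: powr_def)
    also have "\<dots> \<le> exp (\<Sum>r<n. M r * (cosh (x r) - 1))" using e by simp
    finally show ?thesis unfolding x_def .
  qed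
  have "expect V c (\<lambda>u. ennreal (cosh (u i) powr m))
    \<le> expect V c (\<lambda>u. ennreal (exp (\<Sum>r<n. M r * (cosh (pin u (p r) - pin u (p (Suc r))) - 1))))"
    unfolding expect_def by (intro nn_integral_mono mult_left_mono ennreal_leI le) auto
  also have "\<dots> \<le> ennreal (1 / sqrt (1 - Q\<^sup>2 * m / W))"
  proof (rule expect_exp_path [OF fin c inj p(1)])
    show "0 \<le> M r" if "r < n" for r
      unfolding M_def using m Q q(1) [of r] that by (simp add: less_imp_le)
    have "(\<Sum>r<n. M r / c (p r) (p (Suc r))) \<le> (\<Sum>r<n. m * Q / W * q r)"
    proof (rule sum_mono)
      fix r assume "r \<in> {..<n}"
      then have r: "r < n" "q r > 0" using q by auto
      have "M r / c (p r) (p (Suc r)) \<le> M r / (W / (q r)\<^sup>2)"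
        using cW [OF r(1)] r W m Q pos_kernelD(1) [OF c]
        by (intro divide_left_mono) (auto simp: M_def less_imp_le intro!: mult_pos_pos divide_pos_pos)
      also have "\<dots> = m * Q / W * q r"
        using r by (simp add: M_def power2_eq_square)
      finally show "M r / c (p r) (p (Suc r)) \<le> m * Q / W * q r" .
    qed
    also have "\<dots> = m * Q / W * (\<Sum>r<n. q r)" by (simp add: sum_distrib_left)
    also have "\<dots> \<le> m * Q / W * Q" using q(2) m Q W by (intro mult_left_mono) auto
    finally show "(\<Sum>r<n. M r / c (p r) (p (Suc r))) \<le> Q\<^sup>2 * m / W"
      by (simp add: power2_eq_square mult_ac)
  qed (use m in auto)
  finally show ?thesis .
qed

section \<open>Reduction of the hierarchical model\<close>

text \<open>
  The ball of radius \<open>k\<close> in the hierarchical distance consists of the sequences that share the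
  coordinates from \<open>k\<close> on.
\<close>

definition hball :: "nat \<Rightarrow> nat list \<Rightarrow> nat list set" where
  "hball k suf = (\<lambda>p. p @ suf) ` Lambda_N k"

lemma hball_iff: "x \<in> hball k suf \<longleftrightarrow> set (take k x) \<subseteq> {0, 1} \<and> length x = k + length suf \<and> drop k x = suf"
proof
  assume r: "set (take k x) \<subseteq> {0, 1} \<and> length x = k + length suf \<and> drop k x = suf"
  then have "x = take k x @ suf" by (metis append_take_drop_id)
  moreover have "take k x \<in> Lambda_N k" using r by (simp add: Lambda_N_def)
  ultimately show "x \<in> hball k suf" unfolding hball_def by blast
qed (auto simp: hball_def Lambda_N_def)

lemma hball_0: "hball 0 suf = {suf}"
  by (auto simp: hball_def Lambda_N_def)

lemma hball_Nil: "hball N [] = Lambda_N N"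
  by (auto simp: hball_def)

lemma hball_Suc: "hball (Suc k) suf = hball k (0 # suf) \<union> hball k (1 # suf)"
proof -
  have "p \<in> Lambda_N (Suc k) \<longleftrightarrow> (\<exists>q\<in>Lambda_N k. p = q @ [0] \<or> p = q @ [1])" for p
  proof
    assume p: "p \<in> Lambda_N (Suc k)"
    then have "p \<noteq> []" by (auto simp: Lambda_N_def)
    then have "p = butlast p @ [last p]" by simp
    moreover have "last p \<in> {0, 1}" using p last_in_set [OF \<open>p \<noteq> []\<close>] by (auto simp: Lambda_N_def)
    moreover have "butlast p \<in> Lambda_N k" using p by (auto simp: Lambda_N_def dest: in_set_butlastD)
    ultimately show "\<exists>q\<in>Lambda_N k. p = q @ [0] \<or> p = q @ [1]" by (metis empty_iff insert_iff)
  qed (auto simp: Lambda_N_def)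
  then have "Lambda_N (Suc k) = (\<lambda>q. q @ [0]) ` Lambda_N k \<union> (\<lambda>q. q @ [1]) ` Lambda_N k"
    by (auto simp: set_eq_iff)
  then show ?thesis unfolding hball_def by (simp add: image_Un image_image)
qed

lemma hball_disjoint: "a \<noteq> b \<Longrightarrow> hball k (a # suf) \<inter> hball k (b # suf) = {}"
  by (auto simp: hball_iff)

lemma finite_hball: "finite (hball k suf)"
proof -
  have "finite (Lambda_N k)" unfolding Lambda_N_def by (intro finite_lists_length_eq) auto
  then show ?thesis by (simp add: hball_def)
qed

lemma hball_subset_Lambda_N: "set suf \<subseteq> {0, 1} \<Longrightarrow> k + length suf = N \<Longrightarrow> hball k suf \<subseteq> Lambda_N N"
  by (auto simp: hball_def Lambda_N_def simp del: insert_iff)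

text \<open>At \<open>l = N\<close> both suffixes are empty, so the default value \<open>N\<close>
  in \<open>d_H\<close> needs no separate treatment here.\<close>

lemma d_H_eq_Least:
  assumes "length a = N" "length b = N"
  shows "d_H N a b = (LEAST l. drop l a = drop l b)"
proof -
  have iff: "(\<forall>k. l \<le> k \<and> k < N \<longrightarrow> a ! k = b ! k) \<longleftrightarrow> drop l a = drop l b" for l
  proof
    assume *: "\<forall>k. l \<le> k \<and> k < N \<longrightarrow> a ! k = b ! k"
    show "drop l a = drop l b" by (rule nth_equalityI) (use * assms in auto)
  next
    assume *: "drop l a = drop l b"
    show "\<forall>k. l \<le> k \<and> k < N \<longrightarrow> a ! k = b ! k"
    proof (intro allI impI)
      fix k assume k: "l \<le> k \<and> k < N"
      then show "a ! k = b ! k"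
        using arg_cong [OF *, of "\<lambda>x. x ! (k - l)"] assms by simp
    qed
  qed
  define L where "L = (LEAST l. drop l a = drop l b)"
  have N: "drop N a = drop N b" using assms by simp
  then have L: "drop L a = drop L b" unfolding L_def by (rule LeastI)
  have "L \<le> N" unfolding L_def using N by (rule Least_le)
  show ?thesis
    unfolding d_H_def iff L_def [symmetric]
  proof (rule Min_eqI)
    show "L \<in> {l \<in> {..<N}. drop l a = drop l b} \<union> {N}"
      using L \<open>L \<le> N\<close> by (cases "L = N") auto
    show "L \<le> y" if "y \<in> {l \<in> {..<N}. drop l a = drop l b} \<union> {N}" for y
      using that \<open>L \<le> N\<close> by (auto simp: L_def intro: Least_le)
  qed simp
qed

lemma drop_eq_mono: "drop l a = drop l b \<Longrightarrow> l \<le> k \<Longrightarrow> drop k a = drop k b"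
  by (metis drop_drop le_add_diff_inverse2)

lemma d_H_siblings:
  assumes "x \<in> hball k (a # suf)" "y \<in> hball k (b # suf)" "a \<noteq> b" "N = Suc k + length suf"
  shows "d_H N x y = Suc k"
proof -
  have x: "length x = N" "drop k x = a # suf" and y: "length y = N" "drop k y = b # suf"
    using assms by (auto simp: hball_iff)
  have "drop (Suc k) x = drop (Suc k) y"
    using x(2) y(2) by (metis drop_Suc list.sel(3) tl_drop)
  moreover have "Suc k \<le> l" if "drop l x = drop l y" for l
  proof (rule ccontr)
    assume "\<not> Suc k \<le> l"
    then have "drop k x = drop k y" using drop_eq_mono [OF that] by simp
    then show False using x y assms(3) by simp
  qed
  ultimately show ?thesis
    unfolding d_H_eq_Least [OF x(1) y(1)] by (rule Least_equality)
qed

text \<open>The ultrametric property. Up to level \<open>k\<close> the suffix of \<open>z\<close>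
  differs from those of both points; beyond \<open>k\<close> the suffixes of \<open>x\<close> and
  \<open>y\<close> coincide.\<close>

lemma d_H_outside_hball:
  assumes "x \<in> hball k suf" "y \<in> hball k suf" "z \<in> Lambda_N N" "z \<notin> hball k suf" "N = k + length suf"
  shows "d_H N x z = d_H N y z"
proof -
  have x: "length x = N" "drop k x = suf" and y: "length y = N" "drop k y = suf"
    using assms by (auto simp: hball_iff)
  have z: "length z = N" "drop k z \<noteq> suf"
    using assms(3-5) by (auto simp: hball_iff Lambda_N_def dest: in_set_takeD)
  have "drop l x = drop l z \<longleftrightarrow> drop l y = drop l z" for l
  proof (cases "l \<le> k")
    case True
    then show ?thesis
      using drop_eq_mono [of l x z k] drop_eq_mono [of l y z k] x y z by auto
  next
    case False
    then have "drop l x = drop l y" using drop_eq_mono [of k x y l] x y by simp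
    then show ?thesis by simp
  qed
  then show ?thesis unfolding d_H_eq_Least [OF x(1) z(1)] d_H_eq_Least [OF y(1) z(1)] by simp
qed

text \<open>
  A vertex \<open>y\<close> standing for a merged ball carries the multiplicity \<open>n y\<close>, the size of the ball.
\<close>

definition mult_kernel :: "('v \<Rightarrow> real) \<Rightarrow> ('v \<Rightarrow> 'v \<Rightarrow> real) \<Rightarrow> 'v \<Rightarrow> 'v \<Rightarrow> real" where
  "mult_kernel n K y z = n y * n z * K y z"

lemma pos_kernel_mult: "pos_kernel K \<Longrightarrow> (\<And>y. n y > 0) \<Longrightarrow> pos_kernel (mult_kernel n K)"
  by (auto simp: pos_kernel_def mult_kernel_def)

text \<open>Padding with zeros makes the representative of a ball also that of its 0-child, so
  recursive merging can always keep this one.\<close>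

definition rep :: "nat \<Rightarrow> nat list \<Rightarrow> nat list" where
  "rep k suf = replicate k 0 @ suf"

lemma rep_in_hball: "rep k suf \<in> hball k suf"
  by (auto simp: rep_def hball_def Lambda_N_def)

lemma rep_Suc: "rep (Suc k) suf = rep k (0 # suf)"
  by (simp add: rep_def replicate_app_Cons_same)

text \<open>The properties of the weights on which merging rests. \<open>vertices\<close> always
  contains \<open>None\<close>, so \<open>K_hball\<close> also encodes that the pinning is constant
  on balls. \<open>K_siblings\<close> only supplies the weights along the final path.\<close>

locale ultrametric_kernel =
  fixes N :: nat and K :: "nat list option \<Rightarrow> nat list option \<Rightarrow> real" and \<omega> :: "nat \<Rightarrow> real"
  assumes K: "pos_kernel K"
    and K_hball: "\<And>k suf x y z. k + length suf = N \<Longrightarrow> x \<in> hball k suf \<Longrightarrow> y \<in> hball k suf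
      \<Longrightarrow> z \<in> vertices (Lambda_N N - hball k suf) \<Longrightarrow> K (Some x) z = K (Some y) z"
    and K_siblings: "\<And>k suf a b x y. Suc k + length suf = N \<Longrightarrow> a \<noteq> b
      \<Longrightarrow> x \<in> hball k (a # suf) \<Longrightarrow> y \<in> hball k (b # suf) \<Longrightarrow> K (Some x) (Some y) = \<omega> (Suc k)"
begin

text \<open>Each child ball is merged with everything else as environment, which is why
  \<open>V\<close> and \<open>n\<close> vary in the induction. The two representatives then carry
  equal multiplicities, and by \<open>K_hball\<close> they have equal weights to \<open>V\<close>;
  merging them doubles the multiplicity of the survivor, in accordance with
  \<open>mult_kernel\<close>.\<close>

lemma expect_collapse_hball:
  assumes g: "g \<in> borel_measurable borel"
  shows "k + length suf = N \<Longrightarrow> set suf \<subseteq> {0, 1} \<Longrightarrow> V \<subseteq> Lambda_N N - hball k suf \<Longrightarrow> i \<in> V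
    \<Longrightarrow> (\<And>y. n y > 0) \<Longrightarrow> (\<And>x. x \<in> hball k suf \<Longrightarrow> n (Some x) = \<nu>)
    \<Longrightarrow> expect (V \<union> hball k suf) (mult_kernel n K) (\<lambda>u. g (u i))
      = expect (insert (rep k suf) V) (mult_kernel (n(Some (rep k suf) := 2 ^ k * \<nu>)) K) (\<lambda>u. g (u i))"
proof (induction k arbitrary: suf V n)
  case 0
  have "n(Some suf := \<nu>) = n" using 0(6) [of suf] by (auto simp: hball_0)
  then show ?case by (simp add: hball_0 rep_def)
next
  case (Suc k)
  let ?B0 = "hball k (0 # suf)" and ?B1 = "hball k (1 # suf)"
  define b0 b1 where "b0 = rep k (0 # suf)" and "b1 = rep k (1 # suf)"
  have b: "b0 \<in> ?B0" "b1 \<in> ?B1" unfolding b0_def b1_def by (rule rep_in_hball)+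
  have disj: "?B0 \<inter> ?B1 = {}" by (rule hball_disjoint) simp
  have V: "V \<subseteq> Lambda_N N" "V \<inter> ?B0 = {}" "V \<inter> ?B1 = {}" using Suc.prems(3) by (auto simp: hball_Suc)
  have balls: "?B0 \<subseteq> Lambda_N N" "?B1 \<subseteq> Lambda_N N"
    using hball_subset_Lambda_N [OF Suc.prems(2,1)] by (auto simp: hball_Suc)
  have fin: "finite V" using V(1) finite_hball [of N "[]"] by (auto simp: hball_Nil intro: finite_subset)
  have "b0 \<in> hball (Suc k) suf" using b by (simp add: hball_Suc)
  then have nu: "\<nu> > 0" using Suc.prems(5) [of "Some b0"] Suc.prems(6) [of b0] by simp
  have ne: "b0 \<noteq> b1" "b0 \<notin> V" "b1 \<notin> V" using b disj V by auto
  define n1 n2 n3 where "n1 = n(Some b0 := 2 ^ k * \<nu>)" and "n2 = n1(Some b1 := 2 ^ k * \<nu>)"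
    and "n3 = n(Some b0 := 2 ^ Suc k * \<nu>)"
  have pos: "n1 y > 0" "n2 y > 0" "n3 y > 0" for y
    using nu Suc.prems(5) by (auto simp: n1_def n2_def n3_def)
  have "expect (V \<union> hball (Suc k) suf) (mult_kernel n K) (\<lambda>u. g (u i))
    = expect ((V \<union> ?B1) \<union> ?B0) (mult_kernel n K) (\<lambda>u. g (u i))"
    by (simp add: hball_Suc Un_ac)
  also have "\<dots> = expect (insert b0 (V \<union> ?B1)) (mult_kernel n1 K) (\<lambda>u. g (u i))"
    unfolding b0_def n1_def
  proof (rule Suc.IH)
    show "V \<union> ?B1 \<subseteq> Lambda_N N - ?B0" using V balls disj by auto
  qed (use Suc.prems in \<open>auto simp: hball_Suc\<close>)
  also have "insert b0 (V \<union> ?B1) = insert b0 V \<union> ?B1" by simp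
  also have "expect \<dots> (mult_kernel n1 K) (\<lambda>u. g (u i)) = expect (insert b1 (insert b0 V)) (mult_kernel n2 K) (\<lambda>u. g (u i))"
    unfolding b1_def n2_def
  proof (rule Suc.IH)
    show "insert b0 V \<subseteq> Lambda_N N - ?B1" using V balls disj b by auto
    show "n1 (Some x) = \<nu>" if "x \<in> ?B1" for x
      using that Suc.prems(6) [of x] b disj by (auto simp: n1_def hball_Suc)
  qed (use Suc.prems pos in auto)
  also have "insert b1 (insert b0 V) = insert b0 (insert b1 V)" by auto
  also have "expect \<dots> (mult_kernel n2 K) (\<lambda>u. g (u i)) = expect (insert b0 V) (mult_kernel n3 K) (\<lambda>u. g (u i))"
  proof (rule expect_collapse)
    show "pos_kernel (mult_kernel n2 K)" "pos_kernel (mult_kernel n3 K)"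
      using K pos by (auto intro: pos_kernel_mult)
    fix z assume z: "z \<in> vertices V"
    then have zne: "z \<noteq> Some b0" "z \<noteq> Some b1" using ne by auto
    have "K (Some b1) z = K (Some b0) z"
    proof (rule K_hball [of "Suc k" suf])
      show "b1 \<in> hball (Suc k) suf" "b0 \<in> hball (Suc k) suf" using b by (auto simp: hball_Suc)
      show "z \<in> vertices (Lambda_N N - hball (Suc k) suf)"
        using z Suc.prems(3) by (auto simp: vertices_def)
    qed (rule Suc.prems(1))
    then show "mult_kernel n2 K (Some b1) z = mult_kernel n2 K (Some b0) z"
      using ne by (simp add: mult_kernel_def n2_def n1_def)
    show "mult_kernel n3 K (Some b0) z = 2 * mult_kernel n2 K (Some b0) z"
      using ne zne by (simp add: mult_kernel_def n1_def n2_def n3_def)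
    fix z' assume z': "z' \<in> vertices V"
    then have "z' \<noteq> Some b0" "z' \<noteq> Some b1" using ne by auto
    then show "mult_kernel n3 K z z' = mult_kernel n2 K z z'"
      using zne by (simp add: mult_kernel_def n1_def n2_def n3_def)
  qed (use fin ne Suc.prems g in auto)
  finally show ?case unfolding rep_Suc b0_def n3_def .
qed

text \<open>Descent towards \<open>i\<close>: at each level the child ball not containing
  \<open>i\<close> is merged into one vertex of multiplicity \<open>2 ^ k\<close>, appended to the
  path as its outermost vertex. The clause that \<open>n'\<close> agrees with \<open>n\<close> on
  \<open>vertices V\<close> preserves the multiplicities fixed at outer levels, including that of
  \<open>None\<close>.\<close>

lemma expect_chain:
  assumes g: "g \<in> borel_measurable borel"
  shows "k + length suf = N \<Longrightarrow> set suf \<subseteq> {0, 1} \<Longrightarrow> V \<subseteq> Lambda_N N - hball k suf \<Longrightarrow> i \<in> hball k suf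
    \<Longrightarrow> (\<And>y. n y > 0) \<Longrightarrow> (\<And>x. x \<in> hball k suf \<Longrightarrow> n (Some x) = 1)
    \<Longrightarrow> \<exists>a n'. a 0 = i \<and> inj_on a {..k} \<and> a ` {..k} \<subseteq> hball k suf \<and> (\<forall>y. n' y > 0)
      \<and> (\<forall>y\<in>vertices V. n' y = n y) \<and> n' (Some (a 0)) = 1
      \<and> (\<forall>r<k. n' (Some (a (Suc r))) = 2 ^ r \<and> K (Some (a r)) (Some (a (Suc r))) = \<omega> (Suc r))
      \<and> expect (V \<union> hball k suf) (mult_kernel n K) (\<lambda>u. g (u i))
        = expect (V \<union> a ` {..k}) (mult_kernel n' K) (\<lambda>u. g (u i))"
proof (induction k arbitrary: suf V n)
  case 0
  then show ?case
    by (intro exI [of _ "\<lambda>_. i"] exI [of _ n]) (auto simp: hball_0)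
next
  case (Suc k)
  from Suc.prems(4) obtain b b' where bb: "b \<in> {0, 1}" "b' \<in> {0, 1}" and b: "i \<in> hball k (b # suf)" "b \<noteq> b'"
    "hball (Suc k) suf = hball k (b # suf) \<union> hball k (b' # suf)"
  proof (cases "i \<in> hball k (0 # suf)")
    case True
    then show ?thesis using that [of 0 1] by (auto simp: hball_Suc)
  next
    case False
    then show ?thesis using that [of 1 0] Suc.prems(4) by (auto simp: hball_Suc)
  qed
  let ?B = "hball k (b # suf)" and ?B' = "hball k (b' # suf)"
  define s where "s = rep k (b' # suf)"
  define n1 where "n1 = n(Some s := 2 ^ k * 1)"
  have s: "s \<in> ?B'" unfolding s_def by (rule rep_in_hball)
  have disj: "?B \<inter> ?B' = {}" using b(2) by (rule hball_disjoint)
  have "hball (Suc k) suf \<subseteq> Lambda_N N"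
    using Suc.prems(1,2) by (intro hball_subset_Lambda_N) auto
  then have balls: "?B \<subseteq> Lambda_N N" "?B' \<subseteq> Lambda_N N" using b(3) by auto
  have V: "V \<subseteq> Lambda_N N" "V \<inter> ?B = {}" "V \<inter> ?B' = {}" using Suc.prems(3) b(3) by auto
  have e1: "expect (V \<union> hball (Suc k) suf) (mult_kernel n K) (\<lambda>u. g (u i))
    = expect (insert s (V \<union> ?B)) (mult_kernel n1 K) (\<lambda>u. g (u i))"
  proof -
    have "expect ((V \<union> ?B) \<union> ?B') (mult_kernel n K) (\<lambda>u. g (u i))
      = expect (insert s (V \<union> ?B)) (mult_kernel n1 K) (\<lambda>u. g (u i))"
      unfolding s_def n1_def
    proof (rule expect_collapse_hball [OF g])
      show "V \<union> ?B \<subseteq> Lambda_N N - ?B'" using V balls disj by auto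
    qed (use Suc.prems b bb in auto)
    then show ?thesis by (simp add: b(3) Un_assoc)
  qed
  have "\<exists>a n'. a 0 = i \<and> inj_on a {..k} \<and> a ` {..k} \<subseteq> ?B \<and> (\<forall>y. n' y > 0)
      \<and> (\<forall>y\<in>vertices (insert s V). n' y = n1 y) \<and> n' (Some (a 0)) = 1
      \<and> (\<forall>r<k. n' (Some (a (Suc r))) = 2 ^ r \<and> K (Some (a r)) (Some (a (Suc r))) = \<omega> (Suc r))
      \<and> expect (insert s V \<union> ?B) (mult_kernel n1 K) (\<lambda>u. g (u i))
        = expect (insert s V \<union> a ` {..k}) (mult_kernel n' K) (\<lambda>u. g (u i))"
  proof (rule Suc.IH)
    show "insert s V \<subseteq> Lambda_N N - ?B" using V balls disj s by auto
    show "n1 y > 0" for y using Suc.prems(5) by (simp add: n1_def)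
    show "n1 (Some x) = 1" if "x \<in> ?B" for x
      using that s disj Suc.prems(6) [of x] b(3) by (auto simp: n1_def)
  qed (use Suc.prems b bb in auto)
  then obtain a n' where a: "a 0 = i" "inj_on a {..k}" "a ` {..k} \<subseteq> ?B" and n': "\<And>y. n' y > 0"
    "\<And>y. y \<in> vertices (insert s V) \<Longrightarrow> n' y = n1 y" "n' (Some (a 0)) = 1"
    and step: "\<And>r. r < k \<Longrightarrow> n' (Some (a (Suc r))) = 2 ^ r"
      "\<And>r. r < k \<Longrightarrow> K (Some (a r)) (Some (a (Suc r))) = \<omega> (Suc r)"
    and e2: "expect (insert s V \<union> ?B) (mult_kernel n1 K) (\<lambda>u. g (u i))
        = expect (insert s V \<union> a ` {..k}) (mult_kernel n' K) (\<lambda>u. g (u i))"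
    by blast
  define a' where "a' = a(Suc k := s)"
  have im: "a' ` {..Suc k} = insert s (a ` {..k})"
    by (auto simp: a'_def atMost_Suc)
  have sa: "s \<notin> a ` {..k}" using a(3) s disj by auto
  have sV: "s \<notin> V" using V s by auto
  show ?case
  proof (intro exI [of _ a'] exI [of _ n'] conjI allI impI ballI)
    show "a' 0 = i" using a by (simp add: a'_def)
    show "inj_on a' {..Suc k}"
      using a(2) sa by (auto simp: a'_def atMost_Suc inj_on_def)
    show "a' ` {..Suc k} \<subseteq> hball (Suc k) suf" unfolding im using a(3) s b(3) by auto
    show "n' y > 0" for y by (rule n')
    show "n' y = n y" if "y \<in> vertices V" for y
      using n'(2) [of y] that sV by (auto simp: n1_def vertices_insert)
    show "n' (Some (a' 0)) = 1" using n' by (simp add: a'_def)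
    fix r assume r: "r < Suc k"
    show "n' (Some (a' (Suc r))) = 2 ^ r"
      using r step(1) [of r] n'(2) [of "Some s"] by (cases "r = k") (auto simp: a'_def n1_def)
    show "K (Some (a' r)) (Some (a' (Suc r))) = \<omega> (Suc r)"
    proof (cases "r = k")
      \<comment> \<open>The outermost edge joins the two children of the current ball: all earlier
        path vertices lie in the child that contains \<open>i\<close>, the new one in its
        sibling.\<close>
      case True
      have "a k \<in> ?B" using a(3) by auto
      then show ?thesis
        using K_siblings [OF _ b(2) _ s] Suc.prems(1) True by (simp add: a'_def)
    next
      case False
      then show ?thesis using r step(2) [of r] by (simp add: a'_def)
    qed
  next
    show "expect (V \<union> hball (Suc k) suf) (mult_kernel n K) (\<lambda>u. g (u i))
      = expect (V \<union> a' ` {..Suc k}) (mult_kernel n' K) (\<lambda>u. g (u i))"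
      using e1 e2 by (simp add: im)
  qed
qed

end

section \<open>The bound for the hierarchical model\<close>

text \<open>The value 1 at vanishing distance and at the pair \<open>None\<close>,
  \<open>None\<close> only serves to make the kernel positive everywhere; \<open>w\<close> is known
  to be positive on arguments from 1 on.\<close>

definition hier_kernel :: "nat \<Rightarrow> (real \<Rightarrow> real) \<Rightarrow> real \<Rightarrow> nat list option \<Rightarrow> nat list option \<Rightarrow> real" where
  "hier_kernel N w h y z =
     (case y of None \<Rightarrow> (case z of None \<Rightarrow> 1 | Some _ \<Rightarrow> h)
      | Some a \<Rightarrow> (case z of None \<Rightarrow> h | Some b \<Rightarrow> if d_H N a b = 0 then 1 else w (real (d_H N a b))))"

lemma d_H_sym: "d_H N i j = d_H N j i"
  by (simp add: d_H_def eq_commute)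

lemma ultrametric_hier_kernel:
  assumes "\<And>r. r \<ge> 1 \<Longrightarrow> w r > 0" "h > 0"
  shows "ultrametric_kernel N (hier_kernel N w h) (\<lambda>r. w (real r))"
proof
  show "pos_kernel (hier_kernel N w h)"
    using assms by (auto simp: pos_kernel_def hier_kernel_def d_H_sym split: option.splits)
  show "hier_kernel N w h (Some x) z = hier_kernel N w h (Some y) z"
    if "k + length suf = N" "x \<in> hball k suf" "y \<in> hball k suf"
      "z \<in> vertices (Lambda_N N - hball k suf)" for k suf x y z
  proof (cases z)
    case (Some c)
    then have "d_H N x c = d_H N y c"
      using that by (intro d_H_outside_hball) auto
    then show ?thesis using Some by (simp add: hier_kernel_def)
  qed (simp add: hier_kernel_def)
  show "hier_kernel N w h (Some x) (Some y) = w (real (Suc k))"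
    if "Suc k + length suf = N" "a \<noteq> b" "x \<in> hball k (a # suf)" "y \<in> hball k (b # suf)" for k suf a b x y
    using d_H_siblings [OF that(3,4,2), of N] that(1) by (simp add: hier_kernel_def)
qed

lemma d_H_neq_0:
  assumes "a \<in> Lambda_N N" "b \<in> Lambda_N N" "a \<noteq> b"
  shows "d_H N a b \<noteq> 0"
proof -
  have len: "length a = N" "length b = N" using assms by (auto simp: Lambda_N_def)
  have "drop (d_H N a b) a = drop (d_H N a b) b"
    unfolding d_H_eq_Least [OF len] by (rule LeastI [of _ N]) (simp add: len)
  then show ?thesis using assms(3) by (metis drop0)
qed

text \<open>The sequence \<open>q\<close> is left free, since its best choice depends on
  \<open>\<alpha>\<close>. The path consists of \<open>i\<close>, the \<open>N\<close> merged
  siblings and \<rho>, and the constants 8 and 2 normalize its \<open>r\<close>-th weight to at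
  least \<open>W * (r + 1) powr \<alpha>\<close>.\<close>

lemma hierarchical_cosh_bound:
  fixes q :: "nat \<Rightarrow> real"
  assumes w: "\<And>r. r \<ge> 1 \<Longrightarrow> w r > 0" and h: "h > 0" and W: "W > 0"
    and wr: "\<And>r::nat. r \<ge> 1 \<Longrightarrow> w (real r) \<ge> 8 * W * 2 powr (- 2 * real r) * real r powr \<alpha>"
    and hN: "h \<ge> 2 * W * 2 powr (- real N) * (real N + 1) powr \<alpha>"
    and i: "i \<in> Lambda_N N"
    and q: "\<And>r. q r > 0" "\<And>n. (\<Sum>r<n. q r) \<le> Q" "\<And>r. 1 / (q r)\<^sup>2 \<le> (real r + 1) powr \<alpha>"
    and m: "0 \<le> m" "Q\<^sup>2 * m / W < 1"
  shows "(\<integral>\<^sup>+ (u, s). ennreal (cosh (u i) powr m) \<partial>mu (Lambda_N N) (W_H N w) (\<lambda>_. h))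
    \<le> ennreal (1 / sqrt (1 - Q\<^sup>2 * m / W))"
proof -
  interpret ultrametric_kernel N "hier_kernel N w h" "\<lambda>r. w (real r)"
    using w h by (rule ultrametric_hier_kernel)
  have fin: "finite (Lambda_N N)" using finite_hball [of N "[]"] by (simp add: hball_Nil)
  have chm: "(\<lambda>x::real. cosh x) \<in> borel_measurable borel"
    by (intro borel_measurable_continuous_onI continuous_intros)
  then have g: "(\<lambda>x::real. ennreal (cosh x powr m)) \<in> borel_measurable borel"
    by measurable
  have e0: "(\<integral>\<^sup>+ (u, s). ennreal (cosh (u i) powr m) \<partial>mu (Lambda_N N) (W_H N w) (\<lambda>_. h))
    = expect (Lambda_N N) (hier_kernel N w h) (\<lambda>u. ennreal (cosh (u i) powr m))"
  proof (rule nn_integral_mu [OF fin W_H_sym K])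
    show "full_weight (W_H N w) (\<lambda>_. h) y z = hier_kernel N w h y z"
      if "y \<in> vertices (Lambda_N N)" "z \<in> vertices (Lambda_N N)" "y \<noteq> z" for y z
      using that by (cases y; cases z) (auto simp: hier_kernel_def W_H_def d_H_neq_0)
    show "(\<lambda>u. ennreal (cosh (u i) powr m)) \<in> borel_measurable (\<Pi>\<^sub>M i\<in>Lambda_N N. lborel)"
      by (rule measurable_compose [OF _ g]) (use i in measurable)
  qed
  \<comment> \<open>The descent starts with the ball \<open>Lambda_N N\<close> and empty
    \<open>V\<close>; outside of it there is only the pinning vertex, which keeps multiplicity
    1.\<close>
  have "\<exists>a n. a 0 = i \<and> inj_on a {..N} \<and> a ` {..N} \<subseteq> Lambda_N N \<and> (\<forall>y. n y > 0)
      \<and> n None = 1 \<and> n (Some (a 0)) = 1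
      \<and> (\<forall>r<N. n (Some (a (Suc r))) = 2 ^ r
          \<and> hier_kernel N w h (Some (a r)) (Some (a (Suc r))) = w (real (Suc r)))
      \<and> expect (Lambda_N N) (mult_kernel (\<lambda>_. 1) (hier_kernel N w h)) (\<lambda>u. ennreal (cosh (u i) powr m))
        = expect (a ` {..N}) (mult_kernel n (hier_kernel N w h)) (\<lambda>u. ennreal (cosh (u i) powr m))"
    using expect_chain [OF g, of N "[]" "{}" i "\<lambda>_. 1"] i
    by (simp add: hball_Nil vertices_def del: of_nat_Suc)
  then obtain a and n :: "nat list option \<Rightarrow> real"
    where a: "a 0 = i" "inj_on a {..N}" "a ` {..N} \<subseteq> Lambda_N N"
    and n: "\<And>y. n y > 0" "n None = (1::real)" "n (Some (a 0)) = 1"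
    and step: "\<And>r. r < N \<Longrightarrow> n (Some (a (Suc r))) = 2 ^ r"
      "\<And>r. r < N \<Longrightarrow> hier_kernel N w h (Some (a r)) (Some (a (Suc r))) = w (real (Suc r))"
    and e: "expect (Lambda_N N) (mult_kernel (\<lambda>_. 1) (hier_kernel N w h)) (\<lambda>u. ennreal (cosh (u i) powr m))
      = expect (a ` {..N}) (mult_kernel n (hier_kernel N w h)) (\<lambda>u. ennreal (cosh (u i) powr m))"
    by blast
  have "mult_kernel (\<lambda>_. 1) (hier_kernel N w h) = hier_kernel N w h"
    by (simp add: mult_kernel_def fun_eq_iff)
  then have e1: "expect (Lambda_N N) (hier_kernel N w h) (\<lambda>u. ennreal (cosh (u i) powr m))
    = expect (a ` {..N}) (mult_kernel n (hier_kernel N w h)) (\<lambda>u. ennreal (cosh (u i) powr m))"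
    using e by simp
  have "expect (a ` {..N}) (mult_kernel n (hier_kernel N w h)) (\<lambda>u. ennreal (cosh (u i) powr m))
    \<le> ennreal (1 / sqrt (1 - Q\<^sup>2 * m / W))"
  proof -
    define p where "p r = (if r \<le> N then Some (a r) else None)" for r
    \<comment> \<open>An equality except at \<open>r = 0\<close>, where the multiplicities are 1 and
      1 instead of following the pattern \<open>2 ^ r\<close>, \<open>2 ^ (r - 1)\<close>.\<close>
    have n2: "n (Some (a (Suc r))) * n (Some (a r)) \<ge> 2 powr (2 * real r - 1)" if "r < N" for r
    proof (cases r)
      case 0
      then show ?thesis using step(1) [OF that] n by (simp add: powr_minus)
    next
      case (Suc l)
      have "n (Some (a (Suc r))) * n (Some (a r)) = 2 ^ Suc l * 2 ^ l"
        using step(1) [of r] step(1) [of l] that Suc by simp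
      also have "\<dots> = 2 powr (real (Suc l) + real l)"
        by (simp only: powr_add powr_realpow [symmetric] zero_less_numeral)
      finally show ?thesis using Suc by (simp add: algebra_simps)
    qed
    show ?thesis
    proof (rule expect_cosh_powr [where p = p and n = "Suc N" and q = q])
      show "finite (a ` {..N})" by simp
      show "pos_kernel (mult_kernel n (hier_kernel N w h))"
        using K n(1) by (rule pos_kernel_mult)
      show "inj_on p {..Suc N}"
        using a(2) by (auto simp: inj_on_def p_def le_Suc_eq)
      show "p r \<in> vertices (a ` {..N})" if "r \<le> Suc N" for r by (auto simp: p_def)
      show "p 0 = Some i" "p (Suc N) = None" using a by (auto simp: p_def)
      show "W / (q r)\<^sup>2 \<le> mult_kernel n (hier_kernel N w h) (p r) (p (Suc r))" if "r < Suc N" for r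
      proof -
        have "W / (q r)\<^sup>2 \<le> W * (real r + 1) powr \<alpha>"
          using mult_left_mono [OF q(3) [of r], of W] W by simp
        also have "\<dots> \<le> mult_kernel n (hier_kernel N w h) (p r) (p (Suc r))"
        proof (cases "r < N")
          case True
          \<comment> \<open>The edge from \<open>a r\<close> to \<open>a (Suc r)\<close> has
            hierarchical distance \<open>Suc r\<close>. The powers of two combine to
            \<open>2 powr (- 3)\<close>, which explains the 8.\<close>
          have "W * (real r + 1) powr \<alpha> = 2 powr (2 * real r - 1) * (8 * W * 2 powr (- 2 * real (Suc r)) * real (Suc r) powr \<alpha>)"
          proof -
            have "2 powr (2 * real r - 1) * 2 powr (- 2 * real (Suc r)) = 2 powr (- 3 :: real)"
              unfolding powr_add [symmetric] by (simp add: algebra_simps)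
            also have "\<dots> = 1 / 8" by (simp add: powr_minus)
            finally have "2 powr (2 * real r - 1) * 2 powr (- 2 * real (Suc r)) = 1 / 8" .
            then show ?thesis by (simp add: mult_ac add.commute)
          qed
          also have "\<dots> \<le> n (Some (a (Suc r))) * n (Some (a r)) * w (real (Suc r))"
            using n2 [OF True] wr [of "Suc r"] W n(1) by (intro mult_mono) (auto simp: less_imp_le)
          also have "\<dots> = mult_kernel n (hier_kernel N w h) (p r) (p (Suc r))"
            using True step(2) [OF True] by (simp add: mult_kernel_def p_def)
          finally show ?thesis .
        next
          case False
          with that have r: "r = N" by simp
          \<comment> \<open>The last merged ball has \<open>2 ^ (N - 1)\<close> elements. For
            \<open>N = 0\<close> the path starts at the end with multiplicity 1, and the bound 1/2
            still holds.\<close>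
          have nN: "n (Some (a N)) \<ge> 2 powr (real N - 1)"
          proof (cases N)
            case 0
            then show ?thesis using n by (simp add: powr_minus)
          next
            case (Suc l)
            then show ?thesis using step(1) [of l] by (simp add: powr_realpow)
          qed
          have "W * (real N + 1) powr \<alpha> = 2 powr (real N - 1) * (2 * W * 2 powr (- real N) * (real N + 1) powr \<alpha>)"
          proof -
            have "2 powr (real N - 1) * 2 powr (- real N) = 2 powr (- 1 :: real)"
              unfolding powr_add [symmetric] by simp
            also have "\<dots> = 1 / 2" by (simp add: powr_minus)
            finally have "2 powr (real N - 1) * 2 powr (- real N) = 1 / 2" .
            then show ?thesis by (simp add: mult_ac)
          qed
          also have "\<dots> \<le> n (Some (a N)) * h"
            using nN hN W n(1) by (intro mult_mono) (auto simp: less_imp_le)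
          finally show ?thesis using r n(2) by (simp add: mult_kernel_def p_def hier_kernel_def)
        qed
        finally show ?thesis .
      qed
      show "(\<Sum>r<Suc N. q r) \<le> Q" by (rule q(2))
    qed (use q m W in auto)
  qed
  then show ?thesis unfolding e0 e1 .
qed

section \<open>Numerical constants\<close>

lemma sum_inverse_square_le: "(\<Sum>r<n. 1 / (real r + 1)\<^sup>2) \<le> 2"
proof -
  have "(\<Sum>r<Suc n. 1 / (real r + 1)\<^sup>2) \<le> 2 - 1 / (real n + 1)" for n
  proof (induction n)
    case (Suc n)
    have "1 / (real n + 2)\<^sup>2 + 1 / (real n + 2) \<le> 1 / (real n + 1)"
      by (simp add: divide_simps power2_eq_square) (simp add: algebra_simps)
    moreover have "(\<Sum>r<Suc (Suc n). 1 / (real r + 1)\<^sup>2) = (\<Sum>r<Suc n. 1 / (real r + 1)\<^sup>2) + 1 / (real n + 2)\<^sup>2"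
      by (simp add: add_ac)
    ultimately show ?case using Suc by (simp add: add_ac)
  qed simp
  moreover have "1 / (real n + 1) \<ge> 0" for n by simp
  ultimately have "(\<Sum>r<Suc n. 1 / (real r + 1)\<^sup>2) \<le> 2" for n
    by (smt (verit))
  then show ?thesis by (cases n) auto
qed

text \<open>Comparison with a telescoping sum: for \<open>b * b = a * a + 1\<close> the difference
  \<open>2 / a - 2 / b\<close> equals \<open>2 / (a * b * (a + b))\<close>, which is at least
  \<open>1 / (b * b * b)\<close>.\<close>

lemma sum_inverse_three_halves_le: "(\<Sum>r<n. 1 / ((real r + 1) * sqrt (real r + 1))) \<le> 3"
proof -
  have "(\<Sum>r<Suc n. 1 / ((real r + 1) * sqrt (real r + 1))) \<le> 3 - 2 / sqrt (real n + 1)" for n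
  proof (induction n)
    case (Suc n)
    define a b where "a = sqrt (real n + 1)" and "b = sqrt (real n + 2)"
    have ab: "a > 0" "b > 0" "a \<le> b" "b * b = a * a + 1" "b * b = real n + 2" by (auto simp: a_def b_def)
    have "1 / (b * b * b) \<le> 2 / (a * b * (a + b))"
    proof -
      have "a * b * (a + b) \<le> b * b * (b + b)"
        using ab by (intro mult_mono add_mono) auto
      then have "a * b * (a + b) \<le> 2 * (b * b * b)" by (simp add: algebra_simps)
      moreover have "1 / Y \<le> 2 / X" if "X \<le> 2 * Y" "0 < X" "0 < Y" for X Y :: real
        using that by (simp add: field_simps)
      ultimately show ?thesis using ab(1,2) by simp
    qed
    also have "\<dots> = 2 / a - 2 / b"
    proof -
      have "2 / a - 2 / b = 2 * (b - a) / (a * b)" using ab by (simp add: field_simps)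
      also have "\<dots> = 2 * ((b - a) * (a + b)) / (a * b * (a + b))" using ab by simp
      also have "(b - a) * (a + b) = 1" using ab(4) by (simp add: algebra_simps)
      finally show ?thesis by simp
    qed
    finally have "1 / ((real n + 2) * b) + 2 / b \<le> 2 / a" using ab(5) by simp
    moreover have "(\<Sum>r<Suc (Suc n). 1 / ((real r + 1) * sqrt (real r + 1)))
       = (\<Sum>r<Suc n. 1 / ((real r + 1) * sqrt (real r + 1))) + 1 / ((real n + 2) * b)"
      by (simp add: b_def add_ac)
    moreover have b: "sqrt (real (Suc n) + 1) = b" by (simp add: b_def add_ac)
    ultimately show ?case using Suc.IH unfolding a_def [symmetric] b by linarith
  qed simp
  moreover have "2 / sqrt (real n + 1) \<ge> 0" for n by simp
  ultimately have "(\<Sum>r<Suc n. 1 / ((real r + 1) * sqrt (real r + 1))) \<le> 3" for n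
    by (smt (verit))
  then show ?thesis by (cases n) auto
qed

text \<open>The quadratic Taylor bound at \<open>sqrt 2\<close> gives only about 3.41. Applied to a
  quarter of the exponent and raised to the fourth power it gives \<open>1.416 ^ 4\<close>, just
  above 4.\<close>

lemma exp_sqrt2_ge: "4 \<le> exp (sqrt 2)"
proof -
  have "(1.414 :: real) \<le> sqrt 2" by (rule real_le_rsqrt) (simp add: power2_eq_square)
  then have "1.416 \<le> 1 + sqrt 2 / 4 + (sqrt 2 / 4)\<^sup>2 / 2"
    by (simp add: power_divide)
  also have "\<dots> \<le> exp (sqrt 2 / 4)"
    by (intro exp_lower_Taylor_quadratic) simp
  finally have "1.416 ^ 4 \<le> exp (sqrt 2 / 4) ^ 4"
    by (intro power_mono) auto
  also have "exp (sqrt 2 / 4) ^ 4 = exp (sqrt 2)"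
    by (simp flip: exp_of_nat_mult)
  finally show ?thesis by (simp add: power_divide)
qed

lemma c1_pos: "c1 \<alpha> > 0" by (simp add: c1_def)

lemma c1_le:
  assumes "real k \<le> (\<alpha> - 1) / (\<alpha> - 3)"
  shows "c1 \<alpha> \<le> 2 / 3 / 4 ^ k"
proof -
  have "exp (- sqrt 2 * ((\<alpha> - 1) / (\<alpha> - 3))) \<le> exp (- (real k * sqrt 2))"
    using mult_left_mono [OF assms, of "sqrt 2"] by (simp add: mult.commute)
  also have "\<dots> = 1 / exp (sqrt 2) ^ k" by (simp add: exp_minus exp_of_nat_mult inverse_eq_divide)
  also have "\<dots> \<le> 1 / 4 ^ k"
    using exp_sqrt2_ge by (intro divide_left_mono power_mono) auto
  finally show ?thesis unfolding c1_def by simp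
qed

text \<open>Equivalent to \<open>(1 + \<kappa>)^2 * (1 - x) \<ge> 1\<close>. At
  \<open>x = 2 / 3 * \<kappa>\<close> the left side is at least \<open>1 + \<kappa> / 3\<close>,
  because the higher powers of \<open>\<kappa>\<close> are at most \<open>\<kappa>\<close>. The
  prefactor 2/3 of \<open>c1\<close> is spent here.\<close>

lemma inverse_sqrt_le:
  fixes \<kappa> x :: real
  assumes "0 < \<kappa>" "\<kappa> \<le> 1" "x \<le> 2 / 3 * \<kappa>"
  shows "1 / sqrt (1 - x) \<le> 1 + \<kappa>"
proof -
  have k2: "\<kappa> * \<kappa> \<le> \<kappa>" using assms by (simp add: mult_left_le)
  have "\<kappa> * \<kappa> * \<kappa> \<le> \<kappa> * \<kappa>" using assms by (simp add: mult_left_le)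
  moreover have "(1 + \<kappa>)\<^sup>2 * (1 - 2 / 3 * \<kappa>) = 1 + 4 / 3 * \<kappa> - \<kappa> * \<kappa> / 3 - 2 / 3 * (\<kappa> * \<kappa> * \<kappa>)"
    by (simp add: power2_eq_square field_simps)
  ultimately have "1 \<le> (1 + \<kappa>)\<^sup>2 * (1 - 2 / 3 * \<kappa>)"
    using k2 assms(1) by linarith
  also have "\<dots> \<le> (1 + \<kappa>)\<^sup>2 * (1 - x)"
    using assms by (intro mult_left_mono) auto
  finally have "sqrt 1 \<le> sqrt ((1 + \<kappa>)\<^sup>2 * (1 - x))" by (rule real_sqrt_le_mono)
  then have "1 \<le> (1 + \<kappa>) * sqrt (1 - x)"
    using assms by (simp add: real_sqrt_mult)
  then show ?thesis using assms by (simp add: field_simps)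
qed

lemma hierarchical_bound:
  assumes \<alpha>: "\<alpha> > 3" and adm: "admissible \<alpha> \<kappa> W m"
    and w: "\<And>r. r \<ge> 1 \<Longrightarrow> w r > 0" and h: "h > 0"
    and wr: "\<And>r::nat. r \<ge> 1 \<Longrightarrow> w (real r) \<ge> 8 * W * 2 powr (- 2 * real r) * real r powr \<alpha>"
    and hN: "h \<ge> 2 * W * 2 powr (- real N) * (real N + 1) powr \<alpha>"
    and i: "i \<in> Lambda_N N"
  shows "(\<integral>\<^sup>+ (u, s). ennreal (cosh (u i) powr m) \<partial>mu (Lambda_N N) (W_H N w) (\<lambda>_. h)) \<le> ennreal (1 + \<kappa>)"
proof -
  have ad: "0 < \<kappa>" "\<kappa> \<le> 1" "W > 0" "m \<ge> 0" "m \<le> c1 \<alpha> * \<kappa> * W"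
    using adm by (auto simp: admissible_def)
  have main: ?thesis
    if q: "\<And>r. q r > 0" "\<And>n. (\<Sum>r<n. q r) \<le> Q" "\<And>r. 1 / (q r)\<^sup>2 \<le> (real r + 1) powr \<alpha>"
      and Q: "Q\<^sup>2 * c1 \<alpha> \<le> 2 / 3" for q :: "nat \<Rightarrow> real" and Q :: real
  proof -
    have "Q\<^sup>2 * m / W \<le> Q\<^sup>2 * (c1 \<alpha> * \<kappa> * W) / W"
      using ad by (intro divide_right_mono mult_left_mono) auto
    also have "\<dots> = Q\<^sup>2 * c1 \<alpha> * \<kappa>" using ad by simp
    also have "\<dots> \<le> 2 / 3 * \<kappa>" using Q ad by (intro mult_right_mono) auto
    finally have x: "Q\<^sup>2 * m / W \<le> 2 / 3 * \<kappa>" .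
    then have "Q\<^sup>2 * m / W < 1" using ad by linarith
    then have "(\<integral>\<^sup>+ (u, s). ennreal (cosh (u i) powr m) \<partial>mu (Lambda_N N) (W_H N w) (\<lambda>_. h))
      \<le> ennreal (1 / sqrt (1 - Q\<^sup>2 * m / W))"
      by (intro hierarchical_cosh_bound [where \<alpha> = \<alpha> and q = q] w h ad(3,4) wr hN i q)
    also have "\<dots> \<le> ennreal (1 + \<kappa>)"
      using inverse_sqrt_le [OF ad(1,2) x] by (rule ennreal_leI)
    finally show ?thesis .
  qed
  \<comment> \<open>Two fixed sequences suffice, with \<open>1 / (q r)^2\<close> equal to the third
    or fourth power of \<open>r + 1\<close>. For \<open>\<alpha> \<le> 4\<close> the exponent ratio
    in \<open>c1\<close> is at least 3, so \<open>c1 \<alpha>\<close> is at most 2/3 divided by 64,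
    and \<open>Q = 3\<close> is affordable. For larger \<open>\<alpha>\<close> the ratio is only
    known to exceed 1, which leaves 2/3 divided by 4; the fourth power gives \<open>Q = 2\<close>,
    and the requirement is met exactly.\<close>
  show ?thesis
  proof (cases "\<alpha> \<le> 4")
    case True
    show ?thesis
    proof (rule main [of "\<lambda>r. 1 / ((real r + 1) * sqrt (real r + 1))" 3])
      have "real 3 \<le> (\<alpha> - 1) / (\<alpha> - 3)" using \<alpha> True by (simp add: field_simps)
      then have "c1 \<alpha> \<le> 2 / 3 / 4 ^ 3" by (rule c1_le)
      then show "3\<^sup>2 * c1 \<alpha> \<le> 2 / 3" by simp
      fix r :: nat
      have "1 / (1 / ((real r + 1) * sqrt (real r + 1)))\<^sup>2 = (real r + 1) ^ 3"
        by (simp add: power_divide power_mult_distrib power3_eq_cube power2_eq_square)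
      also have "\<dots> = (real r + 1) powr 3" by (simp add: powr_numeral)
      also have "\<dots> \<le> (real r + 1) powr \<alpha>" using \<alpha> by (intro powr_mono) auto
      finally show "1 / (1 / ((real r + 1) * sqrt (real r + 1)))\<^sup>2 \<le> (real r + 1) powr \<alpha>" .
    qed (simp_all add: sum_inverse_three_halves_le)
  next
    case False
    show ?thesis
    proof (rule main [of "\<lambda>r. 1 / (real r + 1)\<^sup>2" 2])
      have "real 1 \<le> (\<alpha> - 1) / (\<alpha> - 3)" using \<alpha> by (simp add: field_simps)
      then have "c1 \<alpha> \<le> 2 / 3 / 4 ^ 1" by (rule c1_le)
      then show "2\<^sup>2 * c1 \<alpha> \<le> 2 / 3" by simp
      fix r :: nat
      have "1 / (1 / (real r + 1)\<^sup>2)\<^sup>2 = (real r + 1) ^ 4"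
        by (simp add: power_divide power_mult [symmetric])
      also have "\<dots> = (real r + 1) powr 4" by (simp add: powr_numeral)
      also have "\<dots> \<le> (real r + 1) powr \<alpha>" using False by (intro powr_mono) auto
      finally show "1 / (1 / (real r + 1)\<^sup>2)\<^sup>2 \<le> (real r + 1) powr \<alpha>" .
    qed (simp_all add: sum_inverse_square_le)
  qed
qed

section \<open>Admissible parameters for large weights\<close>

lemma admissible_power:
  assumes "0 < \<sigma>" "\<sigma> < 1"
  shows "\<forall>\<^sub>F W in at_top. \<forall>m. 0 \<le> m \<and> m \<le> c1 \<alpha> * W powr (1 - \<sigma>) \<longrightarrow> admissible \<alpha> (W powr (- \<sigma>)) W m"
proof -
  define c where "c = c1 \<alpha>"
  have c: "c > 0" unfolding c_def by (rule c1_pos)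
  have "1 / (16 * c * ln 2) > 0" using c by simp
  then have e1: "\<forall>\<^sub>F W in at_top. W powr (- \<sigma>) \<le> 1 / (16 * c * ln 2)"
    using assms by real_asymp
  have e2: "\<forall>\<^sub>F W in at_top. W powr (- \<sigma>) \<le> 1"
    using assms by real_asymp
  have e3: "\<forall>\<^sub>F W in at_top. W \<ge> 1 / (2 * c) * (1 / W powr (- \<sigma>)) * (ln (36 / W powr (- \<sigma>)) / ln 2)"
    using assms c by real_asymp
  show ?thesis
    using e1 e2 e3 eventually_gt_at_top [of 0]
  proof eventually_elim
    case (elim W)
    then have "c * W powr (1 - \<sigma>) = c * W powr (- \<sigma>) * W"
      by (simp add: powr_diff powr_minus field_simps)
    then show ?case using elim by (auto simp: admissible_def log_def c_def)
  qed
qed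

text \<open>The critical scaling: with \<open>\<kappa> = c2 * (ln W / W)\<close> both sides of the
  lower bound on \<open>W\<close> are of order \<open>W\<close>, so the comparison is decided by the
  constant.\<close>

lemma admissible_log:
  assumes c2: "c2 > 1 / (2 * c1 \<alpha> * ln 2)"
  shows "\<forall>\<^sub>F W in at_top. \<forall>m. 0 \<le> m \<and> m \<le> c1 \<alpha> * c2 * ln W \<longrightarrow> admissible \<alpha> (c2 * (ln W / W)) W m"
proof -
  define c where "c = c1 \<alpha>"
  have c: "c > 0" unfolding c_def by (rule c1_pos)
  have "0 < 1 / (2 * c * ln 2)" using c by simp
  then have c2pos: "c2 > 0" using c2 unfolding c_def by linarith
  have K: "1 / (2 * c * c2 * ln 2) < 1" using c2 c c2pos unfolding c_def [symmetric] by (simp add: field_simps)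
  have "1 / (16 * c * ln 2) > 0" using c by simp
  then have e1: "\<forall>\<^sub>F W in at_top. c2 * (ln W / W) \<le> 1 / (16 * c * ln 2)"
    using c2pos by real_asymp
  have e2: "\<forall>\<^sub>F W in at_top. c2 * (ln W / W) \<le> 1"
    using c2pos by real_asymp
  \<comment> \<open>The limiting ratio of the two sides as \<open>W\<close> tends to infinity; the
    assumption on \<open>c2\<close> says exactly that it is below 1.\<close>
  define k where "k = 1 / (2 * c * c2 * ln 2)"
  have "k < 1" "k > 0" using K c c2pos by (auto simp: k_def)
  then have e3: "\<forall>\<^sub>F W in at_top. k * (ln (36 / (c2 * (ln W / W)))) \<le> ln W"
    using c2pos by real_asymp
  show ?thesis
    using e1 e2 e3 eventually_gt_at_top [of 1]
  proof eventually_elim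
    case (elim W)
    then have lW: "ln W > 0" by simp
    have "1 / (2 * c) * (1 / (c2 * (ln W / W))) * (ln (36 / (c2 * (ln W / W))) / ln 2)
        = W / ln W * (k * (ln (36 / (c2 * (ln W / W)))))"
      unfolding k_def using elim lW c c2pos by simp
    also have "\<dots> \<le> W / ln W * ln W"
      using elim lW by (intro mult_left_mono) auto
    also have "\<dots> = W" using lW by simp
    finally show ?case
      using elim lW c2pos by (auto simp: admissible_def log_def c_def)
  qed
qed

theorem theorem1p2:
  fixes \<alpha> :: real
  assumes "\<alpha> > 3"
  shows
    "(\<forall>\<kappa> Wbar m. admissible \<alpha> \<kappa> Wbar m \<longrightarrow>
        (\<forall>(N::nat) (w::real \<Rightarrow> real) (h::real).
           (\<forall>r\<ge>1. w r > 0) \<and> h > 0 \<and>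
           (\<forall>r::nat. r \<ge> 1 \<longrightarrow>
              w (real r) \<ge> 8 * Wbar * 2 powr (- 2 * real r) * real r powr \<alpha>) \<and>
           h \<ge> 2 * Wbar * 2 powr (- real N) * (real N + 1) powr \<alpha> \<longrightarrow>
           (\<forall>i\<in>Lambda_N N.
              (\<integral>\<^sup>+ (u, s). ennreal (cosh (u i) powr m) \<partial>mu (Lambda_N N) (W_H N w) (\<lambda>_. h))
                \<le> ennreal (1 + \<kappa>))))
     \<and> (\<forall>\<sigma>::real. 0 < \<sigma> \<and> \<sigma> < 1 \<longrightarrow>
          (\<forall>\<^sub>F Wbar in at_top. \<forall>m. 0 \<le> m \<and> m \<le> c1 \<alpha> * Wbar powr (1 - \<sigma>) \<longrightarrow>
             admissible \<alpha> (Wbar powr (- \<sigma>)) Wbar m))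
     \<and> (\<forall>c2::real. c2 > 1 / (2 * c1 \<alpha> * ln 2) \<longrightarrow>
          (\<forall>\<^sub>F Wbar in at_top. \<forall>m. 0 \<le> m \<and> m \<le> c1 \<alpha> * c2 * ln Wbar \<longrightarrow>
             admissible \<alpha> (c2 * (ln Wbar / Wbar)) Wbar m))"
  using hierarchical_bound [OF assms] admissible_power admissible_log by blast

end
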